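(* Let $p\ge2$ be an integer, and let $\mathcal W_p$ denote the triplet $W$-algebra. Then there exists a module $\mathbb M\in\mathrm{Mod}(\mathcal W_p)$ that is not lowest generated.
   Context: The triplet $W$-algebra $\mathcal W_p$: let $L=\mathbb Z\alpha$ be the lattice with $(\alpha,\alpha)=2p$, $V_L$ the lattice vertex algebra with conformal vector $\frac1{4p}\alpha(-1)^2\mathbf 1+\frac{p-1}{2p}\alpha(-2)\mathbf 1$ (central charge $1-6(p-1)^2/p$), and let $\widetilde Q=e^{-\alpha/p}_0:V_L\to V_{L-\alpha/p}$ be the zero mode (residue) of the vertex operator of $e^{-\alpha/p}$. Then $\mathcal W_p=\ker_{V_L}\widetilde Q$; it is an $\mathbb N$-graded $C_2$-cofinite vertex operator algebra. For an $\mathbb N$-graded $C_2$-cofinite vertex operator algebra $\mathbb V$, $\mathrm{Mod}(\mathbb V)$ is the category of grading-restricted generalized $\mathbb V$-modules: weak modules $\mathbb W=\bigoplus_{\lambda\in\mathbb C}\mathbb W_{[\lambda]}$ with $\mathbb W_{[\lambda]}$ the generalized $L(0)$-eigenspaces, such that $\bigoplus_{\mathrm{Re}(\mu)\le\mathrm{Re}(\lambda)}\mathbb W_{[\mu]}$ is finite dimensional for each $\lambda$. Write $Y(v,z)=\sum_{n\in\mathbb Z}Y(v)_nz^{-n-1}$. For a weak $\mathbb V$-module $\mathbb X$, $\Omega(\mathbb X)=\{w\in\mathbb X: Y(v)_nw=0$ for all homogeneous $v\in\mathbb V$ and $n\in\mathbb Z$ with $\mathrm{wt}(v)-n-1<0\}$.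 $\mathbb X$ is lowest generated if it is generated by $\Omega(\mathbb X)$ as a $\mathbb V$-module. *)

theory Defs
  imports Complex_Main "HOL-Library.Poly_Mapping" "HOL-Library.Multiset" "HOL-Library.Product_Plus"
begin

section \<open>Complex vector spaces\<close>

text \<open>Up to isomorphism every complex vector space is a space \<open>'a \<Rightarrow>\<^sub>0 complex\<close> of finitely
  supported functions on a basis \<open>'a\<close>. Vertex algebras and their modules are subspaces of
  such spaces.\<close>

definition cscale :: "complex \<Rightarrow> ('a \<Rightarrow>\<^sub>0 complex) \<Rightarrow> ('a \<Rightarrow>\<^sub>0 complex)"  (infixr "*\<^sub>c" 75)
  where "c *\<^sub>c f = Poly_Mapping.map ((*) c) f"

lemma lookup_cscale [simp]: "Poly_Mapping.lookup (c *\<^sub>c f) k = c * Poly_Mapping.lookup f k"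
  by (auto simp: cscale_def Poly_Mapping.map.rep_eq when_def)

global_interpretation cvec: vector_space "cscale :: complex \<Rightarrow> ('a \<Rightarrow>\<^sub>0 complex) \<Rightarrow> _"
  defines csubspace = cvec.subspace and cspan = cvec.span
  by unfold_locales (auto intro!: poly_mapping_eqI simp: lookup_add algebra_simps)

definition lin_ext :: "('a \<Rightarrow> ('b \<Rightarrow>\<^sub>0 complex)) \<Rightarrow> ('a \<Rightarrow>\<^sub>0 complex) \<Rightarrow> ('b \<Rightarrow>\<^sub>0 complex)"
  where "lin_ext g f = (\<Sum>k\<in>Poly_Mapping.keys f. Poly_Mapping.lookup f k *\<^sub>c g k)"


section \<open>Modules over a vertex operator algebra\<close>

text \<open>The vertex operators are given by their modes: \<open>modes V v n\<close> is the coefficient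
  \<open>Y(v)\<^sub>n\<close> of \<open>z\<close> to the power \<open>-n-1\<close> in \<open>Y(v,z)\<close>.\<close>

record 'v voa =
  carrier :: "('v \<Rightarrow>\<^sub>0 complex) set"
  modes :: "('v \<Rightarrow>\<^sub>0 complex) \<Rightarrow> int \<Rightarrow> ('v \<Rightarrow>\<^sub>0 complex) \<Rightarrow> ('v \<Rightarrow>\<^sub>0 complex)"
  vacuum :: "'v \<Rightarrow>\<^sub>0 complex"
  conformal :: "'v \<Rightarrow>\<^sub>0 complex"

record ('v, 'w) voa_module =
  mcarrier :: "('w \<Rightarrow>\<^sub>0 complex) set"
  act :: "('v \<Rightarrow>\<^sub>0 complex) \<Rightarrow> int \<Rightarrow> ('w \<Rightarrow>\<^sub>0 complex) \<Rightarrow> ('w \<Rightarrow>\<^sub>0 complex)"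

text \<open>The last clause is the Jacobi identity, written out in components (the Borcherds
  identity). By lower truncation, in \<open>V\<close> and in the module, all sums over \<open>i\<close> have only
  finitely many nonzero terms.\<close>

definition weak_module :: "'v voa \<Rightarrow> ('v, 'w) voa_module \<Rightarrow> bool" where
  "weak_module V M \<longleftrightarrow>
     csubspace (mcarrier M) \<and>
     (\<forall>v\<in>carrier V. \<forall>n. \<forall>w\<in>mcarrier M. act M v n w \<in> mcarrier M) \<and>
     (\<forall>v\<in>carrier V. \<forall>n a b. \<forall>w\<in>mcarrier M. \<forall>w'\<in>mcarrier M.
        act M v n (a *\<^sub>c w + b *\<^sub>c w') = a *\<^sub>c act M v n w + b *\<^sub>c act M v n w') \<and>
     (\<forall>v\<in>carrier V. \<forall>v'\<in>carrier V. \<forall>n a b. \<forall>w\<in>mcarrier M.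
        act M (a *\<^sub>c v + b *\<^sub>c v') n w = a *\<^sub>c act M v n w + b *\<^sub>c act M v' n w) \<and>
     (\<forall>v\<in>carrier V. \<forall>w\<in>mcarrier M. \<exists>N. \<forall>n\<ge>N. act M v n w = 0) \<and>
     (\<forall>n. \<forall>w\<in>mcarrier M. act M (vacuum V) n w = (if n = - 1 then w else 0)) \<and>
     (\<forall>u\<in>carrier V. \<forall>v\<in>carrier V. \<forall>w\<in>mcarrier M. \<forall>m n k.
        Sum_any (\<lambda>i::nat. (of_int m gchoose i) *\<^sub>c
            act M (modes V u (n + int i) v) (m + k - int i) w) =
        Sum_any (\<lambda>i::nat. ((- 1) ^ i * (of_int n gchoose i)) *\<^sub>c
            (act M u (m + n - int i) (act M v (k + int i) w)
             - ((- 1) powi n) *\<^sub>c act M v (n + k - int i) (act M u (m + int i) w))))"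

text \<open>\<open>L(0)\<close> is the mode with index 1 of the conformal vector.\<close>

definition gen_weight_space :: "'v voa \<Rightarrow> ('v, 'w) voa_module \<Rightarrow> complex \<Rightarrow> ('w \<Rightarrow>\<^sub>0 complex) set" where
  "gen_weight_space V M \<mu> =
     {w \<in> mcarrier M. \<exists>k. ((\<lambda>x. act M (conformal V) 1 x - \<mu> *\<^sub>c x) ^^ k) w = 0}"

text \<open>Generalized eigenspaces for different eigenvalues are always independent, so their sum
  is direct as soon as it is everything. The finiteness condition forces countable dimension, so
  any countably infinite basis type \<open>'w\<close> hosts all objects of \<open>Mod V\<close> up to isomorphism.\<close>

definition Mod :: "'v voa \<Rightarrow> ('v, 'w) voa_module set" where
  "Mod V = {M. weak_module V M \<and>
     mcarrier M = cspan (\<Union>\<mu>. gen_weight_space V M \<mu>) \<and>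
     (\<forall>\<mu>. \<exists>B. finite B \<and>
        cspan (\<Union>\<nu>\<in>{\<nu>. Re \<nu> \<le> Re \<mu>}. gen_weight_space V M \<nu>) = cspan B)}"

definition homogeneous :: "'v voa \<Rightarrow> int \<Rightarrow> ('v \<Rightarrow>\<^sub>0 complex) \<Rightarrow> bool" where
  "homogeneous V h v \<longleftrightarrow> v \<in> carrier V \<and> modes V (conformal V) 1 v = of_int h *\<^sub>c v"

definition lowest_vectors :: "'v voa \<Rightarrow> ('v, 'w) voa_module \<Rightarrow> ('w \<Rightarrow>\<^sub>0 complex) set" where
  "lowest_vectors V M =
     {w \<in> mcarrier M. \<forall>h v n. homogeneous V h v \<and> h - n - 1 < 0 \<longrightarrow> act M v n w = 0}"

definition submodule :: "'v voa \<Rightarrow> ('v, 'w) voa_module \<Rightarrow> ('w \<Rightarrow>\<^sub>0 complex) set \<Rightarrow> bool" where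
  "submodule V M N \<longleftrightarrow> N \<subseteq> mcarrier M \<and> csubspace N \<and>
     (\<forall>v\<in>carrier V. \<forall>n. \<forall>w\<in>N. act M v n w \<in> N)"

definition generated :: "'v voa \<Rightarrow> ('v, 'w) voa_module \<Rightarrow> ('w \<Rightarrow>\<^sub>0 complex) set \<Rightarrow> ('w \<Rightarrow>\<^sub>0 complex) set" where
  "generated V M S = \<Inter> {N. submodule V M N \<and> S \<subseteq> N}"

definition lowest_generated :: "'v voa \<Rightarrow> ('v, 'w) voa_module \<Rightarrow> bool" where
  "lowest_generated V M \<longleftrightarrow> generated V M (lowest_vectors V M) = mcarrier M"


section \<open>Lattice vertex algebra and triplet algebra\<close>

text \<open>The key \<open>(r, {#n\<^sub>1, \<dots>, n\<^sub>k#})\<close> stands for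
  \<open>\<alpha>(-n\<^sub>1) \<dots> \<alpha>(-n\<^sub>k) e\<^bsup>r\<alpha>\<^esup>\<close>, where \<open>(\<alpha>,\<alpha>) = 2p\<close>. Rational \<open>r\<close> is allowed so that the
  coset \<open>L - \<alpha>/p\<close> lives in the same space. Only keys with all \<open>n\<^sub>i > 0\<close> are used (see
  \<open>fock_space\<close>). The product of \<open>'a \<Rightarrow>\<^sub>0 complex\<close> is that of the commutative algebra
  generated by the \<open>\<alpha>(-n)\<close> and the \<open>e\<^bsup>r\<alpha>\<^esup>\<close>; since \<open>L\<close> has rank one and is even, no
  cocycle is needed.\<close>

type_synonym fock_key = "rat \<times> nat multiset"
type_synonym fock = "fock_key \<Rightarrow>\<^sub>0 complex"

definition exp_vec :: "rat \<Rightarrow> fock"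
  where "exp_vec r = Poly_Mapping.single (r, {#}) 1"

definition fock_space :: "rat set \<Rightarrow> fock set"
  where "fock_space A = {f. \<forall>(r, M)\<in>Poly_Mapping.keys f. r \<in> A \<and> 0 \<notin># M}"

text \<open>The Heisenberg operators \<open>\<alpha>(k)\<close>, with \<open>[\<alpha>(j), \<alpha>(k)] = 2 p j\<close> if \<open>j + k = 0\<close> and
  \<open>0\<close> otherwise.\<close>

definition heis :: "nat \<Rightarrow> int \<Rightarrow> fock \<Rightarrow> fock" where
  "heis p k f =
     (if k < 0 then Poly_Mapping.single (0, {#nat (- k)#}) 1 * f
      else if k = 0 then
        lin_ext (\<lambda>(r, M). (2 * of_nat p * of_rat r) *\<^sub>c Poly_Mapping.single (r, M) 1) f
      else
        lin_ext (\<lambda>(r, M). (2 * of_nat p * of_int k * of_nat (count M (nat k))) *\<^sub>c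
          Poly_Mapping.single (r, M - {#nat k#}) 1) f)"

text \<open>Coefficient of \<open>x\<^sup>i\<close> in \<open>exp (\<Sum>k\<ge>1. A k x\<^sup>k)\<close> for commuting operators \<open>A k\<close>.\<close>

definition exp_coeff :: "(nat \<Rightarrow> fock \<Rightarrow> fock) \<Rightarrow> nat \<Rightarrow> fock \<Rightarrow> fock" where
  "exp_coeff A i w =
     (\<Sum>ks | 0 \<notin> set ks \<and> sum_list ks = i. (1 / fact (length ks)) *\<^sub>c foldr A ks w)"

text \<open>Modes of
  \<open>Y(e\<^bsup>r\<alpha>\<^esup>, z) = e\<^bsup>r\<alpha>\<^esup> z\<^bsup>r\<alpha>(0)\<^esup> exp (\<Sum>k\<ge>1. r\<alpha>(-k)/k z\<^bsup>k\<^esup>) exp (- \<Sum>k\<ge>1. r\<alpha>(k)/k z\<^bsup>-k\<^esup>)\<close>,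
  where \<open>z\<^bsup>r\<alpha>(0)\<^esup>\<close> is multiplication by \<open>z\<close> to the power \<open>2 p r s\<close> on vectors of
  charge \<open>s\<alpha>\<close>. Only integral powers of \<open>z\<close> are recorded; for \<open>r\<alpha>\<close> and \<open>s\<alpha>\<close> in \<open>L\<close>, and for
  \<open>r = -1/p\<close> with \<open>s\<alpha>\<close> in \<open>L\<close>, no others occur.\<close>

definition exp_mode :: "nat \<Rightarrow> rat \<Rightarrow> int \<Rightarrow> fock \<Rightarrow> fock" where
  "exp_mode p r n = lin_ext (\<lambda>(s, M).
     Sum_any (\<lambda>j::nat. Sum_any (\<lambda>i::nat.
       if 2 * of_nat p * r * s + of_nat i - of_nat j = - of_int n - 1
       then exp_vec r *
         exp_coeff (\<lambda>k x. (of_rat r / of_nat k) *\<^sub>c heis p (- int k) x) i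
           (exp_coeff (\<lambda>k x. (- of_rat r / of_nat k) *\<^sub>c heis p (int k) x) j
             (Poly_Mapping.single (s, M) 1))
       else 0)))"

text \<open>Modes of \<open>Y(\<alpha>(-n\<^sub>1) \<dots> \<alpha>(-n\<^sub>k) e\<^bsup>r\<alpha>\<^esup>, z)\<close>, by recursion: \<open>Y(\<alpha>(-m)v, z)\<close> is the normally
  ordered product of the divided derivative of order \<open>m - 1\<close> of
  \<open>\<alpha>(z) = \<Sum>k. \<alpha>(k) z\<^bsup>-k-1\<^esup>\<close> with \<open>Y(v, z)\<close>; that derivative has the coefficient
  \<open>binomial(-k-1, m-1) \<alpha>(k)\<close> at \<open>z\<^bsup>-k-m\<^esup>\<close>. On a given vector
  only finitely many \<open>k\<close> contribute.\<close>

fun monomial_mode :: "nat \<Rightarrow> rat \<Rightarrow> nat list \<Rightarrow> int \<Rightarrow> fock \<Rightarrow> fock" where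
  "monomial_mode p r [] n w = exp_mode p r n w"
| "monomial_mode p r (m # ms) n w = Sum_any (\<lambda>k::int.
     (of_int (- k - 1) gchoose (m - 1)) *\<^sub>c
       (if k < 0 then heis p k (monomial_mode p r ms (n - k - int m) w)
        else monomial_mode p r ms (n - k - int m) (heis p k w)))"

definition lattice_mode :: "nat \<Rightarrow> fock \<Rightarrow> int \<Rightarrow> fock \<Rightarrow> fock" where
  "lattice_mode p v n w = lin_ext (\<lambda>(r, M). monomial_mode p r (sorted_list_of_multiset M) n w) v"

definition lattice_voa :: "nat \<Rightarrow> fock_key voa" where
  "lattice_voa p = \<lparr>
     carrier = fock_space \<int>,
     modes = lattice_mode p,
     vacuum = exp_vec 0,
     conformal = (1 / (4 * of_nat p)) *\<^sub>c Poly_Mapping.single (0, {#1, 1#}) 1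
       + ((of_nat p - 1) / (2 * of_nat p)) *\<^sub>c Poly_Mapping.single (0, {#2#}) 1\<rparr>"

definition screening :: "nat \<Rightarrow> fock \<Rightarrow> fock" where
  "screening p v = lattice_mode p (exp_vec (- 1 / of_nat p)) 0 v"

definition triplet :: "nat \<Rightarrow> fock_key voa" where
  "triplet p = (lattice_voa p)\<lparr>carrier := {v \<in> carrier (lattice_voa p). screening p v = 0}\<rparr>"

end

theory Submission
  imports Defs
begin

text \<open>The lattice vertex algebra \<open>V\<^sub>L\<close> itself, restricted to \<open>W\<^sub>p = ker Q\<close>, is not lowest
  generated. A lowest vector \<open>w\<close> has no component of weight \<open>1\<close>: there \<open>V\<^sub>L\<close> is spanned by
  \<open>\<alpha>(-1)1\<close> and \<open>e\<^bsup>\<alpha>\<^esup>\<close>, which \<open>L(1)\<close> and \<open>(e\<^bsup>-\<alpha>\<^esup>)\<^sub>2\<^sub>p\<^sub>-\<^sub>1\<close> map to nonzero multiples of the vacuum.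
  So \<open>w\<close> is a multiple of the vacuum, which generates \<open>W\<^sub>p\<close>, plus a lowest vector of weights at
  least \<open>2\<close>, which generates a submodule of weights at least \<open>2\<close>. Hence \<open>Q\<close> maps the weight \<open>1\<close>
  part of the submodule generated by all lowest vectors to \<open>0\<close>, whereas
  \<open>Q \<alpha>(-1)1 = 2 e\<^bsup>-\<alpha>/p\<^esup>\<close>.

  That \<open>V\<^sub>L\<close> is a module, and that \<open>Q\<close> commutes with \<open>W\<^sub>p\<close>, are instances of the Borcherds
  identity. It follows from locality and translation covariance by Dong's lemma and
  Goddard's uniqueness argument. For exponentials both properties are checked on the vectors
  \<open>e\<^bsup>t\<alpha>\<^esup>\<close> and carried to all of Fock space by the commutators with the \<open>\<alpha>(n)\<close>.\<close>

text \<open>Two facts make weight 1 decisive. The vector e^{-\<alpha>/p} has weight 1, so Q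
  preserves weights. A homogeneous lowest vector generates nothing below its own weight, so
  \<alpha>(-1)1 could only be reached from lowest vectors of weight 0 or 1. The hypothesis p >= 2
  enters twice: L(1) maps \<alpha>(-1)1 to -2(p-1) times the vacuum, and e^{-\<alpha>} has weight
  2p-1 >= 3, so it does not appear in weight 1.

  Most of the work is the Borcherds identity for modes given by explicit formulas. It must also
  cover u = e^{-\<alpha>/p}, which lies outside V_L and has fractional charge. Hence it is proved
  for u with charges in \<open>charges p\<close> and for v, w in V_L. The pairings of such u with
  V_L are even integers, so ordinary locality of commutators holds, and two vectors of fractional
  charge are never paired.\<close>

abbreviation lookup :: "('a \<Rightarrow>\<^sub>0 'b::zero) \<Rightarrow> 'a \<Rightarrow> 'b" where "lookup \<equiv> Poly_Mapping.lookup"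
abbreviation keys :: "('a \<Rightarrow>\<^sub>0 'b::zero) \<Rightarrow> 'a set" where "keys \<equiv> Poly_Mapping.keys"
abbreviation single :: "'a \<Rightarrow> 'b \<Rightarrow> 'a \<Rightarrow>\<^sub>0 'b::zero" where "single \<equiv> Poly_Mapping.single"

section \<open>Linear maps and finitely supported sums\<close>

definition clin :: "(('a \<Rightarrow>\<^sub>0 complex) \<Rightarrow> ('b \<Rightarrow>\<^sub>0 complex)) \<Rightarrow> bool" where
  "clin f \<longleftrightarrow> (\<forall>x y. f (x + y) = f x + f y) \<and> (\<forall>c x. f (c *\<^sub>c x) = c *\<^sub>c f x)"

lemma clinI:
  "(\<And>x y. f (x + y) = f x + f y) \<Longrightarrow> (\<And>c x. f (c *\<^sub>c x) = c *\<^sub>c f x) \<Longrightarrow> clin f"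
  by (simp add: clin_def)

lemma clin_add: "clin f \<Longrightarrow> f (x + y) = f x + f y"
  and clin_scale: "clin f \<Longrightarrow> f (c *\<^sub>c x) = c *\<^sub>c f x"
  by (simp_all add: clin_def)

lemma clin_0: "clin f \<Longrightarrow> f 0 = 0"
  using clin_scale[of f 0 0] by simp

lemma clin_diff: "clin f \<Longrightarrow> f (x - y) = f x - f y"
  using clin_add[of f "x - y" y] by (simp add: algebra_simps)

lemma clin_minus: "clin f \<Longrightarrow> f (- y) = - f y"
  using clin_diff[of f 0 y] by (simp add: clin_0)

lemma clin_sum: "clin f \<Longrightarrow> f (sum g A) = (\<Sum>i\<in>A. f (g i))"
  by (induction A rule: infinite_finite_induct) (auto simp: clin_0 clin_add)

lemma clin_comp: "clin f \<Longrightarrow> clin g \<Longrightarrow> clin (\<lambda>x. f (g x))"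
  by (simp add: clin_def)

lemma clin_lin_comb:
  "clin f \<Longrightarrow> f (a *\<^sub>c x + b *\<^sub>c y) = a *\<^sub>c f x + b *\<^sub>c f y"
  by (simp add: clin_def)

lemma clin_id [simp]: "clin (\<lambda>x. x)"
  by (simp add: clin_def)

lemma clin_zero [simp]: "clin (\<lambda>x. 0)"
  by (simp add: clin_def)

lemma clin_plus: "clin f \<Longrightarrow> clin g \<Longrightarrow> clin (\<lambda>x. f x + g x)"
  by (simp add: clin_def cvec.scale_right_distrib algebra_simps)

lemma clin_minus_fun: "clin f \<Longrightarrow> clin g \<Longrightarrow> clin (\<lambda>x. f x - g x)"
  by (simp add: clin_def cvec.scale_right_diff_distrib algebra_simps)

lemma clin_scale_fun: "clin f \<Longrightarrow> clin (\<lambda>x. c *\<^sub>c f x)"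
  by (simp add: clin_def cvec.scale_right_distrib mult.commute)

lemma clin_sum_fun: "(\<And>i. i \<in> A \<Longrightarrow> clin (f i)) \<Longrightarrow> clin (\<lambda>x. \<Sum>i\<in>A. f i x)"
  by (induction A rule: infinite_finite_induct) (auto intro: clin_plus)

lemma Sum_any_lessThan:
  fixes f :: "nat \<Rightarrow> 'a::comm_monoid_add"
  assumes "\<And>i. i \<ge> K \<Longrightarrow> f i = 0"
  shows "Sum_any f = (\<Sum>i<K. f i)"
  by (rule Sum_any.expand_superset) (use assms in \<open>auto simp: not_le[symmetric]\<close>)

text \<open>\<open>Sum_any\<close> is 0 on an infinite support, so each linearity rule needs a bound
  beyond which the terms vanish.\<close>

lemma Sum_any_add_nat:
  fixes f g :: "nat \<Rightarrow> 'a::comm_monoid_add"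
  assumes "\<And>i. i \<ge> K \<Longrightarrow> f i = 0" "\<And>i. i \<ge> L \<Longrightarrow> g i = 0"
  shows "Sum_any (\<lambda>i. f i + g i) = Sum_any f + Sum_any g"
  by (rule Sum_any.distrib; rule finite_subset[of _ "{..<K}"] finite_subset[of _ "{..<L}"])
     (use assms in \<open>auto simp: not_le[symmetric]\<close>)

lemma Sum_any_diff_nat:
  fixes f g :: "nat \<Rightarrow> 'a::ab_group_add"
  assumes "\<And>i. i \<ge> K \<Longrightarrow> f i = 0" "\<And>i. i \<ge> L \<Longrightarrow> g i = 0"
  shows "Sum_any (\<lambda>i. f i - g i) = Sum_any f - Sum_any g"
proof -
  have "Sum_any (\<lambda>i. f i - g i) = (\<Sum>i<max K L. f i - g i)"
    using assms by (intro Sum_any_lessThan) auto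
  also have "\<dots> = (\<Sum>i<max K L. f i) - (\<Sum>i<max K L. g i)"
    by (rule sum_subtractf)
  also have "(\<Sum>i<max K L. f i) = Sum_any f"
    using assms by (intro Sum_any_lessThan[symmetric]) auto
  also have "(\<Sum>i<max K L. g i) = Sum_any g"
    using assms by (intro Sum_any_lessThan[symmetric]) auto
  finally show ?thesis .
qed

lemma clin_Sum_any:
  assumes "clin f" "finite {i. g i \<noteq> 0}"
  shows "f (Sum_any g) = Sum_any (\<lambda>i. f (g i))"
proof -
  have "Sum_any (\<lambda>i. f (g i)) = (\<Sum>i | g i \<noteq> 0. f (g i))"
    by (rule Sum_any.expand_superset) (use assms in \<open>auto simp: clin_0\<close>)
  thus ?thesis by (simp add: Sum_any.expand_set clin_sum[OF assms(1)])
qed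

lemma clin_Sum_any_nat:
  assumes "clin f" "\<And>i. i \<ge> (K::nat) \<Longrightarrow> g i = 0"
  shows "f (Sum_any g) = Sum_any (\<lambda>i. f (g i))"
  by (rule clin_Sum_any[OF assms(1) finite_subset[of _ "{..<K}"]])
     (use assms in \<open>auto simp: not_le[symmetric]\<close>)

lemma clin_Sum_any_fun:
  assumes "\<And>i. clin (f i)" "\<And>x. \<exists>N. \<forall>i\<ge>(N::nat). f i x = 0"
  shows "clin (\<lambda>x. Sum_any (\<lambda>i. f i x))"
proof (rule clinI)
  fix x y
  obtain M where "\<forall>i\<ge>M. f i x = 0" using assms(2) by blast
  moreover obtain N where "\<forall>i\<ge>N. f i y = 0" using assms(2) by blast
  ultimately show "Sum_any (\<lambda>i. f i (x + y)) = Sum_any (\<lambda>i. f i x) + Sum_any (\<lambda>i. f i y)"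
    unfolding clin_add[OF assms(1)] by (intro Sum_any_add_nat[of M _ N]) auto
next
  fix c x
  obtain M where "\<forall>i\<ge>M. f i x = 0" using assms(2) by blast
  thus "Sum_any (\<lambda>i. f i (c *\<^sub>c x)) = c *\<^sub>c Sum_any (\<lambda>i. f i x)"
    unfolding clin_scale[OF assms(1)]
    by (intro clin_Sum_any_nat[symmetric, of _ M]) (auto simp: clin_def cvec.scale_right_distrib mult.commute)
qed

section \<open>Formal calculus in two variables\<close>

text \<open>A function \<open>f\<close> on pairs of integers stands for the formal distribution
  \<open>\<Sum>m k. f m k x\<^bsup>-m-1\<^esup> y\<^bsup>-k-1\<^esup>\<close>; \<open>dlt\<close> is multiplication by \<open>x - y\<close>, and \<open>expand_xy n\<close>,
  \<open>expand_yx n\<close> are multiplication by \<open>(x - y)\<^bsup>n\<^esup>\<close> expanded in the regions \<open>|x| > |y|\<close>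
  and \<open>|y| > |x|\<close>.\<close>

definition dlt :: "(int \<Rightarrow> int \<Rightarrow> 'v::ab_group_add) \<Rightarrow> int \<Rightarrow> int \<Rightarrow> 'v" where
  "dlt f m k = f (m + 1) k - f m (k + 1)"

definition expand_xy :: "int \<Rightarrow> (int \<Rightarrow> int \<Rightarrow> ('a \<Rightarrow>\<^sub>0 complex)) \<Rightarrow> int \<Rightarrow> int \<Rightarrow> ('a \<Rightarrow>\<^sub>0 complex)" where
  "expand_xy n f m k =
     Sum_any (\<lambda>i::nat. ((- 1) ^ i * (of_int n gchoose i)) *\<^sub>c f (m + n - int i) (k + int i))"

definition expand_yx :: "int \<Rightarrow> (int \<Rightarrow> int \<Rightarrow> ('a \<Rightarrow>\<^sub>0 complex)) \<Rightarrow> int \<Rightarrow> int \<Rightarrow> ('a \<Rightarrow>\<^sub>0 complex)" where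
  "expand_yx n f m k = (- 1) powi n *\<^sub>c expand_xy n (\<lambda>a b. f b a) k m"

text \<open>The bound on k is uniform in m. It makes the sum in \<open>expand_xy\<close> finite at
  every coefficient, as k + i eventually passes K.\<close>

definition below2 :: "int \<Rightarrow> (int \<Rightarrow> int \<Rightarrow> 'v::zero) \<Rightarrow> bool" where
  "below2 K f \<longleftrightarrow> (\<forall>m k. k \<ge> K \<longrightarrow> f m k = 0)"

lemma below2D: "below2 K f \<Longrightarrow> k \<ge> K \<Longrightarrow> f m k = 0"
  by (simp add: below2_def)

lemma expand_xy_eq_sum:
  assumes "below2 K f" "K - k \<le> int I"
  shows "expand_xy n f m k =
    (\<Sum>i<I. ((- 1) ^ i * (of_int n gchoose i)) *\<^sub>c f (m + n - int i) (k + int i))"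
  unfolding expand_xy_def using assms by (intro Sum_any_lessThan) (auto simp: below2D)

lemma gchoose_Suc_of_int:
  "(of_int (n + 1) :: complex) gchoose Suc i = (of_int n gchoose i) + (of_int n gchoose Suc i)"
  by (simp add: gbinomial_Suc_Suc)

text \<open>Pascal's rule: the factor x - y turns the coefficients binomial(n, i) into binomial(n +
  1, i), for negative n as well.\<close>

lemma expand_xy_step:
  assumes "below2 K f"
  shows "expand_xy (n + 1) f m k = dlt (expand_xy n f) m k"
proof -
  define I where "I = Suc (nat (K - k))"
  have I: "K - k \<le> int I" "K - k \<le> int (Suc I)" "K - (k + 1) \<le> int I"
    by (auto simp: I_def)
  let ?g = "\<lambda>i. f (m + 1 + n - int i) (k + int i)"
  \<comment> \<open>The term i = I vanishes, so sums with I and with \<open>Suc I\<close> terms may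
    be exchanged.\<close>
  have g0: "?g I = 0"
    using assms I by (intro below2D[of K]) auto
  let ?c = "\<lambda>i. (of_int n gchoose i) :: complex"
  have "expand_xy (n + 1) f m k =
      (\<Sum>i<Suc I. ((- 1) ^ i * (of_int (n + 1) gchoose i)) *\<^sub>c ?g i)"
    by (subst expand_xy_eq_sum[OF assms I(2)]) (simp add: algebra_simps del: sum.lessThan_Suc)
  also have "\<dots> = ?g 0 + (\<Sum>i<I. ((- 1) ^ Suc i * (of_int (n + 1) gchoose Suc i)) *\<^sub>c ?g (Suc i))"
    by (subst sum.lessThan_Suc_shift) simp
  also have "(\<Sum>i<I. ((- 1) ^ Suc i * (of_int (n + 1) gchoose Suc i)) *\<^sub>c ?g (Suc i)) =
      (\<Sum>i<I. ((- 1) ^ Suc i * ?c (Suc i)) *\<^sub>c ?g (Suc i)) - (\<Sum>i<I. ((- 1) ^ i * ?c i) *\<^sub>c ?g (Suc i))"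
    unfolding sum_subtractf [symmetric] gchoose_Suc_of_int
    by (intro sum.cong refl poly_mapping_eqI) (simp add: lookup_minus algebra_simps)
  also have "(\<Sum>i<I. ((- 1) ^ i * ?c i) *\<^sub>c ?g (Suc i)) = expand_xy n f m (k + 1)"
    by (subst expand_xy_eq_sum[OF assms I(3)]) (simp add: algebra_simps)
  also have "?g 0 + ((\<Sum>i<I. ((- 1) ^ Suc i * ?c (Suc i)) *\<^sub>c ?g (Suc i)) - expand_xy n f m (k + 1)) =
     (\<Sum>i<Suc I. ((- 1) ^ i * ?c i) *\<^sub>c ?g i) - expand_xy n f m (k + 1)"
    by (subst sum.lessThan_Suc_shift) simp
  also have "(\<Sum>i<Suc I. ((- 1) ^ i * ?c i) *\<^sub>c ?g i) = expand_xy n f (m + 1) k"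
    by (subst expand_xy_eq_sum[OF assms I(1)]) (simp add: g0)
  finally show ?thesis by (simp add: dlt_def)
qed

lemma expand_yx_step:
  assumes "below2 K (\<lambda>a b. f b a)"
  shows "expand_yx (n + 1) f m k = dlt (expand_yx n f) m k"
proof -
  have "(- 1 :: complex) powi (n + 1) = - ((- 1) powi n)"
    by (simp add: power_int_add)
  thus ?thesis
    unfolding expand_yx_def dlt_def expand_xy_step[OF assms]
    by (intro poly_mapping_eqI) (simp add: lookup_minus algebra_simps)
qed

lemma expand_xy_0 [simp]: "expand_xy 0 f = f"
  by (intro ext) (simp add: expand_xy_def gbinomial_0_left if_distrib[of "\<lambda>x. y * x" for y]
      if_distrib[of "\<lambda>x. x *\<^sub>c y" for y] Sum_any.delta cong: if_cong)

lemma expand_yx_0 [simp]: "expand_yx 0 f = f"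
  by (intro ext) (simp add: expand_yx_def)

lemma expand_xy_funpow:
  assumes "below2 K f"
  shows "(dlt ^^ N) (expand_xy n f) = expand_xy (n + int N) f"
proof (induction N)
  case (Suc N)
  have "(dlt ^^ Suc N) (expand_xy n f) = dlt (expand_xy (n + int N) f)"
    using Suc by simp
  also have "\<dots> = expand_xy (n + int N + 1) f"
    by (intro ext) (simp add: expand_xy_step[OF assms])
  finally show ?case by (simp add: algebra_simps)
qed simp

lemma expand_yx_funpow:
  assumes "below2 K (\<lambda>a b. f b a)"
  shows "(dlt ^^ N) (expand_yx n f) = expand_yx (n + int N) f"
proof (induction N)
  case (Suc N)
  have "(dlt ^^ Suc N) (expand_yx n f) = dlt (expand_yx (n + int N) f)"
    using Suc by simp
  also have "\<dots> = expand_yx (n + int N + 1) f"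
    by (intro ext) (simp add: expand_yx_step[OF assms])
  finally show ?case by (simp add: algebra_simps)
qed simp

lemma dlt_diff: "dlt (\<lambda>m k. f m k - g m k) = (\<lambda>m k. dlt f m k - dlt g m k)"
  by (intro ext) (simp add: dlt_def)

lemma dlt_funpow_diff: "(dlt ^^ N) (\<lambda>m k. f m k - g m k) = (\<lambda>m k. (dlt ^^ N) f m k - (dlt ^^ N) g m k)"
  by (induction N) (simp_all add: dlt_diff)

lemma dlt_zero [simp]: "dlt (\<lambda>m k. 0) = (\<lambda>m k. 0)"
  by (intro ext) (simp add: dlt_def)

lemma dlt_funpow_zero [simp]: "(dlt ^^ N) (\<lambda>m k. 0) = (\<lambda>m k. 0)"
  by (induction N) simp_all

lemma dlt_funpow_zero_mono:
  assumes "(dlt ^^ N) f = (\<lambda>m k. 0)" "N \<le> M"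
  shows "(dlt ^^ M) f = (\<lambda>m k. 0)"
proof -
  have "(dlt ^^ M) f = (dlt ^^ (M - N)) ((dlt ^^ N) f)"
    using assms(2) by (simp add: funpow_add[symmetric, THEN fun_cong, unfolded comp_def])
  thus ?thesis using assms(1) by simp
qed

lemma dlt_funpow_clin:
  assumes "clin g"
  shows "(dlt ^^ N) (\<lambda>m k. g (f m k)) = (\<lambda>m k. g ((dlt ^^ N) f m k))"
  by (induction N) (auto simp: dlt_def clin_diff[OF assms] fun_eq_iff)

text \<open>(d/dx + d/dy) (x - y)^n = 0, so multiplication by (x - y)^n commutes with d/dx + d/dy.
  On coefficients d/dx gives - m f (m - 1) k; the common sign is dropped.\<close>

lemma expand_xy_deriv:
  assumes "below2 K f"
  shows "expand_xy n (\<lambda>m k. of_int m *\<^sub>c f (m - 1) k + of_int k *\<^sub>c f m (k - 1)) m k =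
    of_int m *\<^sub>c expand_xy n f (m - 1) k + of_int k *\<^sub>c expand_xy n f m (k - 1)"
proof -
  define I where "I = Suc (nat (K - k))"
  have I: "K - k \<le> int I" "K - (k - 1) \<le> int (Suc I)" "K + 1 - k \<le> int I"
    by (auto simp: I_def)
  let ?c = "\<lambda>i. (- 1) ^ i * (of_int n gchoose i) :: complex"
  let ?f = "\<lambda>m k. of_int m *\<^sub>c f (m - 1) k + of_int k *\<^sub>c f m (k - 1)"
  have b: "below2 (K + 1) ?f"
    using assms by (auto simp: below2_def)
  have "expand_xy n ?f m k = (\<Sum>i<I. ?c i *\<^sub>c ?f (m + n - int i) (k + int i))"
    by (rule expand_xy_eq_sum[OF b I(3)])
  also have "\<dots> = of_int m *\<^sub>c (\<Sum>i<I. ?c i *\<^sub>c f (m - 1 + n - int i) (k + int i)) +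
      (\<Sum>i<I. (?c i * (of_int n - of_nat i)) *\<^sub>c f (m + n - 1 - int i) (k + int i)) +
      (\<Sum>i<I. (?c i * of_int (k + int i)) *\<^sub>c f (m + n - int i) (k - 1 + int i))"
    unfolding cvec.scale_sum_right sum.distrib [symmetric]
    by (intro sum.cong refl poly_mapping_eqI) (simp add: lookup_add algebra_simps)
  also have "(\<Sum>i<I. ?c i *\<^sub>c f (m - 1 + n - int i) (k + int i)) = expand_xy n f (m - 1) k"
    by (rule expand_xy_eq_sum[OF assms I(1), symmetric])
  also have "(\<Sum>i<I. (?c i * of_int (k + int i)) *\<^sub>c f (m + n - int i) (k - 1 + int i)) =
     (\<Sum>i<Suc I. (?c i * of_int (k + int i)) *\<^sub>c f (m + n - int i) (k - 1 + int i))"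
  proof -
    have "f (m + n - int I) (k - 1 + int I) = 0"
      using assms I by (intro below2D[of K]) (auto simp: I_def)
    thus ?thesis by simp
  qed
  also have "\<dots> = of_int k *\<^sub>c (\<Sum>i<Suc I. ?c i *\<^sub>c f (m + n - int i) (k - 1 + int i)) +
     (\<Sum>i<Suc I. (?c i * of_nat i) *\<^sub>c f (m + n - int i) (k - 1 + int i))"
    unfolding cvec.scale_sum_right sum.distrib [symmetric]
    by (intro sum.cong refl poly_mapping_eqI) (simp add: lookup_add algebra_simps)
  also have "(\<Sum>i<Suc I. ?c i *\<^sub>c f (m + n - int i) (k - 1 + int i)) = expand_xy n f m (k - 1)"
    by (rule expand_xy_eq_sum[OF assms I(2), symmetric])
  also have "(\<Sum>i<Suc I. (?c i * of_nat i) *\<^sub>c f (m + n - int i) (k - 1 + int i)) =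
     (\<Sum>i<I. (?c (Suc i) * of_nat (Suc i)) *\<^sub>c f (m + n - 1 - int i) (k + int i))"
    by (subst sum.lessThan_Suc_shift) (simp add: algebra_simps)
  \<comment> \<open>By (i + 1) binomial(n, i + 1) = (n - i) binomial(n, i), this sum cancels the one
    with the factors n - i above.\<close>
  also have "\<dots> = - (\<Sum>i<I. (?c i * (of_int n - of_nat i)) *\<^sub>c f (m + n - 1 - int i) (k + int i))"
    unfolding sum_negf [symmetric]
  proof (rule sum.cong[OF refl])
    fix i
    have "of_nat (Suc i) * ((of_int n :: complex) gchoose Suc i) = (of_int n - of_nat i) * (of_int n gchoose i)"
      using gbinomial_mult_1'[of "of_int n :: complex" i] by (simp add: algebra_simps)
    hence eq: "?c (Suc i) * of_nat (Suc i) = - (?c i * (of_int n - of_nat i))"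
      by (simp add: mult_ac)
    show "(?c (Suc i) * of_nat (Suc i)) *\<^sub>c f (m + n - 1 - int i) (k + int i) =
       - ((?c i * (of_int n - of_nat i)) *\<^sub>c f (m + n - 1 - int i) (k + int i))"
      unfolding eq cvec.scale_minus_left ..
  qed
  finally show ?thesis by simp
qed

section \<open>Fields, locality and products of fields\<close>

definition field_on :: "(int \<Rightarrow> ('a \<Rightarrow>\<^sub>0 complex) \<Rightarrow> ('a \<Rightarrow>\<^sub>0 complex)) \<Rightarrow> bool" where
  "field_on a \<longleftrightarrow> (\<forall>n. clin (a n)) \<and> (\<forall>w. \<exists>N. \<forall>n\<ge>N. a n w = 0)"

text \<open>The order N does not depend on w: Dong's lemma applies the condition to the vectors b_k
  w for all k at once.\<close>

definition local_pair where
  "local_pair a b \<longleftrightarrow> (\<exists>N. \<forall>w. (dlt ^^ N) (\<lambda>m k. a m (b k w) - b k (a m w)) = (\<lambda>m k. 0))"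

text \<open>The right side of the Borcherds identity: (x - y)^n a(x) b(y) - (x - y)^n b(y) a(x),
  each product multiplied by the expansion that makes sense for it.\<close>

definition borcherds where
  "borcherds a b n w m k =
     expand_xy n (\<lambda>m k. a m (b k w)) m k - expand_yx n (\<lambda>m k. b k (a m w)) m k"

text \<open>The residue in \<open>x\<close> of \<open>(x - y)\<^bsup>n\<^esup> [a(x), b(y)]\<close>.\<close>

definition nprod where
  "nprod a b n k w = borcherds a b n w 0 k"

lemma field_clin: "field_on a \<Longrightarrow> clin (a n)"
  by (simp add: field_on_def)

lemma field_below:
  assumes "field_on a" obtains K where "\<And>n. n \<ge> K \<Longrightarrow> a n w = 0"
  using assms unfolding field_on_def by metis

lemma field_below2_xy:
  assumes "field_on a" "field_on b"
  obtains K where "below2 K (\<lambda>m k. a m (b k w))"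
proof -
  obtain K where "\<And>n. n \<ge> K \<Longrightarrow> b n w = 0"
    using field_below[OF assms(2)] by blast
  thus ?thesis
    using clin_0[OF field_clin[OF assms(1)]] by (intro that[of K]) (simp add: below2_def)
qed

lemma borcherds_step:
  assumes "field_on a" "field_on b"
  shows "borcherds a b (n + 1) w = dlt (borcherds a b n w)"
proof -
  obtain K L where "below2 K (\<lambda>m k. a m (b k w))" "below2 L (\<lambda>m k. b m (a k w))"
    using assms field_below2_xy by metis
  thus ?thesis
    by (intro ext) (simp add: borcherds_def expand_xy_step expand_yx_step dlt_def)
qed

lemma borcherds_0: "borcherds a b 0 w m k = a m (b k w) - b k (a m w)"
  by (simp add: borcherds_def)

lemma borcherds_funpow:
  assumes "field_on a" "field_on b"
  shows "borcherds a b (n + int N) w = (dlt ^^ N) (borcherds a b n w)"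
proof (induction N)
  case (Suc N)
  thus ?case using borcherds_step[OF assms, of "n + int N" w] by (simp add: algebra_simps)
qed simp

text \<open>For n >= 0 the two expansions of (x - y)^n agree, so the expression is (x - y)^n times
  the commutator, which locality kills.\<close>

lemma local_pair_borcherds:
  assumes "field_on a" "field_on b" "local_pair a b"
  obtains N where "\<And>n w m k. n \<ge> N \<Longrightarrow> borcherds a b n w m k = 0"
proof -
  obtain N where N: "\<And>w. (dlt ^^ N) (\<lambda>m k. a m (b k w) - b k (a m w)) = (\<lambda>m k. 0)"
    using assms(3) by (auto simp: local_pair_def)
  show ?thesis
  proof (rule that[of "int N"])
    fix n w m k assume "n \<ge> int N"
    define M where "M = nat n"
    have M: "n = 0 + int M" "N \<le> M" using \<open>n \<ge> int N\<close> by (auto simp: M_def)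
    have "borcherds a b 0 w = (\<lambda>m k. a m (b k w) - b k (a m w))"
      by (intro ext) (simp add: borcherds_0)
    thus "borcherds a b n w m k = 0"
      unfolding M(1) borcherds_funpow[OF assms(1,2)] using dlt_funpow_zero_mono[OF N M(2)] by simp
  qed
qed

lemma borcherds_eq_sum:
  assumes "field_on a" "field_on b"
      "\<And>n. n \<ge> k + int I \<Longrightarrow> b n w = 0" "\<And>n. n \<ge> m + int I \<Longrightarrow> a n w = 0"
  shows "borcherds a b n w m k = (\<Sum>i<I. ((- 1) ^ i * (of_int n gchoose i)) *\<^sub>c
     (a (m + n - int i) (b (k + int i) w) - (- 1) powi n *\<^sub>c b (n + k - int i) (a (m + int i) w)))"
proof -
  have 1: "below2 (k + int I) (\<lambda>m k. a m (b k w))" "below2 (m + int I) (\<lambda>m k. b m (a k w))"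
    using assms(3,4) clin_0[OF field_clin[OF assms(1)]] clin_0[OF field_clin[OF assms(2)]]
    by (auto simp: below2_def)
  show ?thesis
    unfolding borcherds_def expand_yx_def
    by (subst expand_xy_eq_sum[OF 1(1), where I = I], simp, subst expand_xy_eq_sum[OF 1(2), where I = I], simp)
       (simp add: cvec.scale_sum_right sum_subtractf[symmetric] cvec.scale_right_diff_distrib algebra_simps)
qed

lemma borcherds_Sum_any:
  assumes "field_on a" "field_on b"
  shows "borcherds a b n w m k = Sum_any (\<lambda>i. ((- 1) ^ i * (of_int n gchoose i)) *\<^sub>c
     (a (m + n - int i) (b (k + int i) w) - (- 1) powi n *\<^sub>c b (n + k - int i) (a (m + int i) w)))"
proof -
  obtain K L where K: "\<And>n. n \<ge> K \<Longrightarrow> b n w = 0" and L: "\<And>n. n \<ge> L \<Longrightarrow> a n w = 0"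
    using assms field_below by metis
  define I where "I = nat (max (K - k) (L - m))"
  have "borcherds a b n w m k = (\<Sum>i<I. ((- 1) ^ i * (of_int n gchoose i)) *\<^sub>c
     (a (m + n - int i) (b (k + int i) w) - (- 1) powi n *\<^sub>c b (n + k - int i) (a (m + int i) w)))"
    by (rule borcherds_eq_sum[OF assms]; rule K L) (auto simp: I_def split: if_splits)
  also have "\<dots> = Sum_any (\<lambda>i. ((- 1) ^ i * (of_int n gchoose i)) *\<^sub>c
     (a (m + n - int i) (b (k + int i) w) - (- 1) powi n *\<^sub>c b (n + k - int i) (a (m + int i) w)))"
    using K L clin_0[OF field_clin[OF assms(1)]] clin_0[OF field_clin[OF assms(2)]]
    by (intro Sum_any_lessThan[symmetric]) (auto simp: I_def)
  finally show ?thesis .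
qed

lemma field_nprod:
  assumes a: "field_on a" and b: "field_on b"
  shows "field_on (nprod a b n)"
  unfolding field_on_def
proof (intro conjI allI)
  fix k
  let ?t = "\<lambda>i w. ((- 1) ^ i * (of_int n gchoose i)) *\<^sub>c
     (a (0 + n - int i) (b (k + int i) w) - (- 1) powi n *\<^sub>c b (n + k - int i) (a (0 + int i) w))"
  have "clin (\<lambda>w. Sum_any (\<lambda>i. ?t i w))"
  proof (rule clin_Sum_any_fun)
    fix i show "clin (?t i)"
      by (rule clin_scale_fun, rule clin_minus_fun, rule clin_comp[OF field_clin[OF a] field_clin[OF b]],
          rule clin_scale_fun, rule clin_comp[OF field_clin[OF b] field_clin[OF a]])
  next
    fix w
    obtain K L where "\<And>n. n \<ge> K \<Longrightarrow> b n w = 0" "\<And>n. n \<ge> L \<Longrightarrow> a n w = 0"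
      using assms field_below by metis
    thus "\<exists>N. \<forall>i\<ge>N. ?t i w = 0"
      using clin_0[OF field_clin[OF a]] clin_0[OF field_clin[OF b]]
      by (intro exI[of _ "nat (max (K - k) L)"]) auto
  qed
  thus "clin (nprod a b n k)"
    unfolding nprod_def[abs_def] borcherds_Sum_any[OF a b] .
next
  fix w
  obtain K L where K: "\<And>n. n \<ge> K \<Longrightarrow> b n w = 0" and L: "\<And>n. n \<ge> L \<Longrightarrow> a n w = 0"
    using assms field_below by metis
  define I where "I = nat L"
  \<comment> \<open>In the products b a the truncation bound depends on i through the vector a_i w.
    Since a_i w = 0 for i >= I, finitely many bounds matter and one N serves all.\<close>
  have "\<forall>i. \<exists>N. \<forall>k\<ge>N. b k (a (int i) w) = 0"
    using b by (simp add: field_on_def)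
  from choice[OF this] obtain H where H: "\<And>i k. k \<ge> H i \<Longrightarrow> b k (a (int i) w) = 0"
    by blast
  define N where "N = Max (insert K ((\<lambda>i. H i + int i - n) ` {..<I}))"
  have N: "K \<le> N" "\<And>i. i < I \<Longrightarrow> H i + int i - n \<le> N"
    by (auto simp: N_def)
  show "\<exists>N. \<forall>k\<ge>N. nprod a b n k w = 0"
  proof (intro exI[of _ N] allI impI)
    fix k assume k: "k \<ge> N"
    show "nprod a b n k w = 0"
      unfolding nprod_def
    proof (subst borcherds_eq_sum[OF a b, where I = I])
      show "(\<Sum>i<I. ((- 1) ^ i * (of_int n gchoose i)) *\<^sub>c
        (a (0 + n - int i) (b (k + int i) w) - (- 1) powi n *\<^sub>c b (n + k - int i) (a (0 + int i) w))) = 0"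
      proof (intro sum.neutral ballI)
        fix i assume "i \<in> {..<I}"
        hence "b (k + int i) w = 0" "b (n + k - int i) (a (int i) w) = 0"
          using k N by (auto intro!: K H) (use N(2)[of i] in linarith)
        thus "((- 1) ^ i * (of_int n gchoose i)) *\<^sub>c
        (a (0 + n - int i) (b (k + int i) w) - (- 1) powi n *\<^sub>c b (n + k - int i) (a (0 + int i) w)) = 0"
          by (simp add: clin_0[OF field_clin[OF a]])
      qed
    qed (use k N in \<open>auto intro!: K L simp: I_def split: if_splits\<close>)
  qed
qed

section \<open>Translation covariance\<close>

definition transl_cov where
  "transl_cov T a \<longleftrightarrow> (\<forall>n w. T (a n w) - a n (T w) = - of_int n *\<^sub>c a (n - 1) w)"

lemma transl_covD: "transl_cov T a \<Longrightarrow> T (a n w) = a n (T w) - of_int n *\<^sub>c a (n - 1) w"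
  by (simp add: transl_cov_def algebra_simps)

lemma expand_xy_diff:
  assumes "below2 K f" "below2 L g"
  shows "expand_xy n (\<lambda>m k. f m k - g m k) m k = expand_xy n f m k - expand_xy n g m k"
proof -
  have 1: "below2 (max K L) f" "below2 (max K L) g"  "below2 (max K L) (\<lambda>m k. f m k - g m k)"
    using assms by (auto simp: below2_def)
  show ?thesis
    by (subst (1 2 3) expand_xy_eq_sum[where I = "nat (max K L - k)"])
       (use 1 in \<open>auto simp: sum_subtractf[symmetric] cvec.scale_right_diff_distrib\<close>)
qed

lemma expand_xy_clin:
  assumes "below2 K f" "clin T"
  shows "T (expand_xy n f m k) = expand_xy n (\<lambda>m k. T (f m k)) m k"
proof -
  have "below2 K (\<lambda>m k. T (f m k))"
    using assms by (auto simp: below2_def clin_0)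
  thus ?thesis
    by (subst (1 2) expand_xy_eq_sum[where I = "nat (K - k)"])
       (use assms in \<open>auto simp: clin_sum clin_scale\<close>)
qed

text \<open>Commuting with T acts on a(x) b(y) as d/dx + d/dy, which passes through (x - y)^n by
  \<open>expand_xy_deriv\<close>.\<close>

lemma transl_cov_expand:
  assumes "field_on a" "field_on b" "clin T" "transl_cov T a" "transl_cov T b"
  shows "T (expand_xy n (\<lambda>m k. a m (b k w)) m k) - expand_xy n (\<lambda>m k. a m (b k (T w))) m k =
    - (of_int m *\<^sub>c expand_xy n (\<lambda>m k. a m (b k w)) (m - 1) k +
       of_int k *\<^sub>c expand_xy n (\<lambda>m k. a m (b k w)) m (k - 1))"
proof -
  obtain K where K: "below2 K (\<lambda>m k. a m (b k w))"
    using field_below2_xy assms by metis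
  obtain L where L: "below2 L (\<lambda>m k. a m (b k (T w)))"
    using field_below2_xy assms by metis
  have K': "below2 K (\<lambda>m k. T (a m (b k w)))"
    using K by (auto simp: below2_def clin_0 assms)
  have K2: "below2 (K + 1) (\<lambda>m k. of_int m *\<^sub>c a (m - 1) (b k w) + of_int k *\<^sub>c a m (b (k - 1) w))"
    using K by (auto simp: below2_def)
  have "T (expand_xy n (\<lambda>m k. a m (b k w)) m k) - expand_xy n (\<lambda>m k. a m (b k (T w))) m k =
     expand_xy n (\<lambda>m k. T (a m (b k w)) - a m (b k (T w))) m k"
    by (simp add: expand_xy_diff[OF K' L] expand_xy_clin[OF K assms(3)])
  also have "(\<lambda>m k. T (a m (b k w)) - a m (b k (T w))) =
      (\<lambda>m k. 0 - (of_int m *\<^sub>c a (m - 1) (b k w) + of_int k *\<^sub>c a m (b (k - 1) w)))"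
    by (intro ext)
       (simp add: transl_covD[OF assms(4)] transl_covD[OF assms(5)] algebra_simps
         clin_diff[OF field_clin[OF assms(1)]] clin_scale[OF field_clin[OF assms(1)]])
  also have "expand_xy n \<dots> m k = expand_xy n (\<lambda>m k. 0) m k -
     expand_xy n (\<lambda>m k. of_int m *\<^sub>c a (m - 1) (b k w) + of_int k *\<^sub>c a m (b (k - 1) w)) m k"
    by (rule expand_xy_diff[OF _ K2, of 0]) (simp add: below2_def)
  finally show ?thesis
    by (simp add: expand_xy_deriv[OF K]) (simp add: expand_xy_def)
qed

lemma transl_cov_nprod:
  assumes "field_on a" "field_on b" "clin T" "transl_cov T a" "transl_cov T b"
  shows "transl_cov T (nprod a b n)"
  unfolding transl_cov_def
proof (intro allI)
  fix k w
  let ?P = "\<lambda>w. expand_xy n (\<lambda>m k. a m (b k w)) 0" and ?R = "\<lambda>w k. expand_xy n (\<lambda>m k. b m (a k w)) k 0"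
  \<comment> \<open>At the residue index 0 the x-derivative carries the factor
    \<open>of_int 0\<close>: the residue of a derivative vanishes.\<close>
  have 1: "x = y - c *\<^sub>c z" if "x - y = - (of_int 0 *\<^sub>c u + c *\<^sub>c z)" for x y z u and c :: complex
    using that by (simp add: diff_eq_eq)
  have 2: "x = y - c *\<^sub>c z" if "x - y = - (c *\<^sub>c z + of_int 0 *\<^sub>c u)" for x y z u and c :: complex
    using that by (simp add: diff_eq_eq)
  have P: "T (?P w k) = ?P (T w) k - of_int k *\<^sub>c ?P w (k - 1)"
    by (rule 1[OF transl_cov_expand[OF assms, of n w 0 k]])
  have R: "T (?R w k) = ?R (T w) k - of_int k *\<^sub>c ?R w (k - 1)"
    by (rule 2[OF transl_cov_expand[OF assms(2,1,3,5,4), of n w k 0]])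
  show "T (nprod a b n k w) - nprod a b n k (T w) = - of_int k *\<^sub>c nprod a b n (k - 1) w"
    unfolding nprod_def borcherds_def expand_yx_def clin_diff[OF assms(3)] clin_scale[OF assms(3)] P R
    by (intro poly_mapping_eqI) (simp add: lookup_minus lookup_add right_diff_distrib)
qed

section \<open>Dong's lemma\<close>

text \<open>Three-variable versions of \<open>dlt\<close>: the factors x - y, x - z and y - z on
  distributions in x, y, z.\<close>

definition dxy3 :: "(int \<Rightarrow> int \<Rightarrow> int \<Rightarrow> 'v::ab_group_add) \<Rightarrow> int \<Rightarrow> int \<Rightarrow> int \<Rightarrow> 'v" where
  "dxy3 F m k l = F (m + 1) k l - F m (k + 1) l"

definition dxz3 :: "(int \<Rightarrow> int \<Rightarrow> int \<Rightarrow> 'v::ab_group_add) \<Rightarrow> int \<Rightarrow> int \<Rightarrow> int \<Rightarrow> 'v" where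
  "dxz3 F m k l = F (m + 1) k l - F m k (l + 1)"

definition dyz3 :: "(int \<Rightarrow> int \<Rightarrow> int \<Rightarrow> 'v::ab_group_add) \<Rightarrow> int \<Rightarrow> int \<Rightarrow> int \<Rightarrow> 'v" where
  "dyz3 F m k l = F m (k + 1) l - F m k (l + 1)"

lemmas d3_defs = dxy3_def dxz3_def dyz3_def

lemma funpow_commute_at:
  assumes "\<And>x. f (g x) = g (f x)"
  shows "(f ^^ n) ((g ^^ m) x) = (g ^^ m) ((f ^^ n) x)"
proof -
  have 1: "f ((g ^^ m) x) = (g ^^ m) (f x)" for x
    by (induction m arbitrary: x) (simp_all add: assms funpow_swap1)
  show ?thesis
    by (induction n arbitrary: x) (simp_all add: 1)
qed

lemma dxz3_dyz3: "dxz3 (dyz3 F) = dyz3 (dxz3 F)"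
  and dyz3_dxy3: "dyz3 (dxy3 F) = dxy3 (dyz3 F)"
  by (intro ext; simp add: d3_defs algebra_simps)+

lemma dxz3_zero [simp]: "dxz3 (\<lambda>m k l. 0) = (\<lambda>m k l. 0)"
  and dyz3_zero [simp]: "dyz3 (\<lambda>m k l. 0) = (\<lambda>m k l. 0)"
  and dxy3_zero [simp]: "dxy3 (\<lambda>m k l. 0) = (\<lambda>m k l. 0)"
  by (simp_all add: d3_defs fun_eq_iff)

lemma dxz3_funpow_zero [simp]: "(dxz3 ^^ N) (\<lambda>m k l. 0) = (\<lambda>m k l. 0)"
  and dyz3_funpow_zero [simp]: "(dyz3 ^^ N) (\<lambda>m k l. 0) = (\<lambda>m k l. 0)"
  by (induction N) simp_all

lemma dxz3_funpow_diff:
    "(dxz3 ^^ N) (\<lambda>m k l. F m k l - G m k l) = (\<lambda>m k l. (dxz3 ^^ N) F m k l - (dxz3 ^^ N) G m k l)"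
  and dyz3_funpow_diff:
    "(dyz3 ^^ N) (\<lambda>m k l. F m k l - G m k l) = (\<lambda>m k l. (dyz3 ^^ N) F m k l - (dyz3 ^^ N) G m k l)"
  by (induction N) (simp_all add: d3_defs fun_eq_iff)

lemma dyz3_funpow_eq: "(dyz3 ^^ N) F m = (dlt ^^ N) (F m)"
  by (induction N) (simp_all add: dyz3_def dlt_def fun_eq_iff)

lemma dxz3_funpow_eq: "(dxz3 ^^ N) F m k l = (dlt ^^ N) (\<lambda>m l. F m k l) m l"
  by (induction N arbitrary: m l) (simp_all add: dxz3_def dlt_def)

text \<open>If \<open>(y - z)\<^bsup>K\<^esup>\<close> kills \<open>F (n + 1) = (x - y) F n\<close>, then \<open>x\<close> may be replaced by \<open>y\<close> in
  factors of \<open>(y - z)\<^bsup>K\<^esup> F n\<close>, so \<open>(x - z)\<^bsup>N\<^esup> (y - z)\<^bsup>K + N\<^esup>\<close> acts on \<open>F n\<close> as \<open>(y - z)\<^bsup>K + 2N\<^esup>\<close>.\<close>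

lemma dong_descent:
  fixes F :: "int \<Rightarrow> int \<Rightarrow> int \<Rightarrow> int \<Rightarrow> 'v::ab_group_add"
  assumes step: "\<And>n. F (n + 1) = dxy3 (F n)"
    and zero: "F N0 = (\<lambda>m k l. 0)"
    and kill: "\<And>n. (dxz3 ^^ N) ((dyz3 ^^ N) (F n)) = (\<lambda>m k l. 0)"
  shows "(dyz3 ^^ (2 * N * j)) (F (N0 - int j)) = (\<lambda>m k l. 0)"
proof (induction j)
  case 0
  thus ?case using zero by simp
next
  case (Suc j)
  define n where "n = N0 - int (Suc j)"
  define K where "K = 2 * N * j"
  define G where "G = (dyz3 ^^ (K + N)) (F n)"
  have n1: "N0 - int j = n + 1" by (simp add: n_def)
  have "dxy3 G = (dyz3 ^^ N) ((dyz3 ^^ K) (dxy3 (F n)))"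
    using funpow_commute_at[of dyz3 dxy3 "K + N" 1 "F n", OF dyz3_dxy3]
    by (simp add: G_def add.commute[of K] funpow_add)
  also have "\<dots> = (\<lambda>m k l. 0)"
    using Suc unfolding n1 step K_def by simp
  finally have G: "dxy3 G = (\<lambda>m k l. 0)" .
  have eq: "(dxz3 ^^ i) G = (dyz3 ^^ i) G" for i
  proof (induction i)
    case (Suc i)
    have "dxy3 ((dyz3 ^^ i) G) = (\<lambda>m k l. 0)"
      using funpow_commute_at[of dyz3 dxy3 i 1 G, OF dyz3_dxy3] G by simp
    hence "(dyz3 ^^ i) G (m + 1) k l = (dyz3 ^^ i) G m (k + 1) l" for m k l
      by (simp add: dxy3_def fun_eq_iff)
    hence "dxz3 ((dyz3 ^^ i) G) = dyz3 ((dyz3 ^^ i) G)"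
      by (intro ext) (simp only: dxz3_def dyz3_def)
    thus ?case by (simp add: Suc)
  qed simp
  have "(dyz3 ^^ (2 * N * Suc j)) (F n) = (dyz3 ^^ N) G"
    by (simp add: G_def K_def funpow_add[symmetric, THEN fun_cong, unfolded comp_def] algebra_simps)
  also have "\<dots> = (dxz3 ^^ N) ((dyz3 ^^ K) ((dyz3 ^^ N) (F n)))"
    unfolding eq[symmetric] by (simp add: G_def funpow_add)
  also have "\<dots> = (dyz3 ^^ K) ((dxz3 ^^ N) ((dyz3 ^^ N) (F n)))"
    by (rule funpow_commute_at) (rule dxz3_dyz3)
  finally show ?case by (simp add: kill n_def)
qed

section \<open>Expansions of (x - y)^n in the presence of a third variable\<close>

definition pxy3 :: "int \<Rightarrow> (int \<Rightarrow> int \<Rightarrow> int \<Rightarrow> ('a \<Rightarrow>\<^sub>0 complex)) \<Rightarrow> int \<Rightarrow> int \<Rightarrow> int \<Rightarrow> ('a \<Rightarrow>\<^sub>0 complex)" where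
  "pxy3 n F m k l = expand_xy n (\<lambda>m k. F m k l) m k"

text \<open>K may depend on l: the bound for a(x) b(y) applied to c_l w depends on that
  vector.\<close>

definition below3 :: "(int \<Rightarrow> int \<Rightarrow> int \<Rightarrow> 'v::zero) \<Rightarrow> bool" where
  "below3 F \<longleftrightarrow> (\<forall>l. \<exists>K. below2 K (\<lambda>m k. F m k l))"

lemma expand_xy_shift:
  "expand_xy n f (m + 1) k = expand_xy n (\<lambda>m k. f (m + 1) k) m k"
  "expand_xy n f m (k + 1) = expand_xy n (\<lambda>m k. f m (k + 1)) m k"
  by (simp_all add: expand_xy_def algebra_simps)

lemma below3_shift:
  assumes "below3 F"
  shows "below3 (\<lambda>m k l. F (m + 1) k l)" "below3 (\<lambda>m k l. F m (k + 1) l)" "below3 (\<lambda>m k l. F m k (l + 1))"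
proof -
  show "below3 (\<lambda>m k l. F (m + 1) k l)" "below3 (\<lambda>m k l. F m k (l + 1))"
    using assms unfolding below3_def below2_def by metis+
  show "below3 (\<lambda>m k l. F m (k + 1) l)"
    unfolding below3_def
  proof
    fix l
    obtain K where "below2 K (\<lambda>m k. F m k l)" using assms by (auto simp: below3_def)
    thus "\<exists>K. below2 K (\<lambda>m k. F m (k + 1) l)" by (intro exI[of _ K]) (simp add: below2_def)
  qed
qed

lemma below3_diff:
  assumes "below3 F" "below3 (G :: int \<Rightarrow> int \<Rightarrow> int \<Rightarrow> 'v::ab_group_add)"
  shows "below3 (\<lambda>m k l. F m k l - G m k l)"
  unfolding below3_def
proof
  fix l
  obtain K where K: "below2 K (\<lambda>m k. F m k l)"
    using assms(1) by (auto simp: below3_def)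
  obtain L where L: "below2 L (\<lambda>m k. G m k l)"
    using assms(2) by (auto simp: below3_def)
  show "\<exists>K. below2 K (\<lambda>m k. F m k l - G m k l)"
    using K L by (intro exI[of _ "max K L"]) (simp add: below2_def)
qed

lemma below3_dxz3: "below3 F \<Longrightarrow> below3 (dxz3 F)"
  unfolding dxz3_def by (intro below3_diff below3_shift)

lemma below3_dyz3: "below3 F \<Longrightarrow> below3 (dyz3 F)"
  unfolding dyz3_def by (intro below3_diff below3_shift)

lemma pxy3_diff:
  assumes "below3 F" "below3 G"
  shows "pxy3 n (\<lambda>m k l. F m k l - G m k l) = (\<lambda>m k l. pxy3 n F m k l - pxy3 n G m k l)"
proof (intro ext)
  fix m k l
  obtain K where K: "below2 K (\<lambda>m k. F m k l)"
    using assms(1) by (auto simp: below3_def)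
  obtain L where L: "below2 L (\<lambda>m k. G m k l)"
    using assms(2) by (auto simp: below3_def)
  from expand_xy_diff[OF K L]
  show "pxy3 n (\<lambda>m k l. F m k l - G m k l) m k l = pxy3 n F m k l - pxy3 n G m k l"
    by (simp add: pxy3_def)
qed

lemma pxy3_dxz3: "below3 F \<Longrightarrow> dxz3 (pxy3 n F) = pxy3 n (dxz3 F)"
  unfolding dxz3_def
  by (subst pxy3_diff, (intro below3_shift; assumption)+) (simp add: pxy3_def expand_xy_shift)

lemma pxy3_dyz3: "below3 F \<Longrightarrow> dyz3 (pxy3 n F) = pxy3 n (dyz3 F)"
  unfolding dyz3_def
  by (subst pxy3_diff, (intro below3_shift; assumption)+) (simp add: pxy3_def expand_xy_shift)

lemma pxy3_dxz3_funpow: "below3 F \<Longrightarrow> (dxz3 ^^ N) (pxy3 n F) = pxy3 n ((dxz3 ^^ N) F)"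
  and below3_dxz3_funpow: "below3 F \<Longrightarrow> below3 ((dxz3 ^^ N) F)"
proof (induction N)
  case (Suc N)
  { case 1 thus ?case using Suc by (simp add: pxy3_dxz3) }
  { case 2 thus ?case using Suc by (simp add: below3_dxz3) }
qed simp_all

lemma pxy3_dyz3_funpow: "below3 F \<Longrightarrow> (dyz3 ^^ N) (pxy3 n F) = pxy3 n ((dyz3 ^^ N) F)"
  and below3_dyz3_funpow: "below3 F \<Longrightarrow> below3 ((dyz3 ^^ N) F)"
proof (induction N)
  case (Suc N)
  { case 1 thus ?case using Suc by (simp add: pxy3_dyz3) }
  { case 2 thus ?case using Suc by (simp add: below3_dyz3) }
qed simp_all

lemma pxy3_zero [simp]: "pxy3 n (\<lambda>m k l. 0) = (\<lambda>m k l. 0)"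
  by (simp add: pxy3_def expand_xy_def fun_eq_iff)

lemma pxy3_kill:
  assumes "below3 F" "(dxz3 ^^ N) ((dyz3 ^^ N) F) = (\<lambda>m k l. 0)"
  shows "(dxz3 ^^ N) ((dyz3 ^^ N) (pxy3 n F)) = (\<lambda>m k l. 0)"
  by (simp add: assms pxy3_dyz3_funpow pxy3_dxz3_funpow below3_dyz3_funpow)

lemma swap3_dxz3_funpow: "(dxz3 ^^ N) (\<lambda>m k l. F k m l) = (\<lambda>m k l. (dyz3 ^^ N) F k m l)"
  and swap3_dyz3_funpow: "(dyz3 ^^ N) (\<lambda>m k l. F k m l) = (\<lambda>m k l. (dxz3 ^^ N) F k m l)"
  by (induction N) (simp_all add: d3_defs fun_eq_iff)

text \<open>Exchanging x and y exchanges x - z and y - z. This serves the products in the order b(y)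
  a(x).\<close>

lemma swap3_kill:
  assumes "(dxz3 ^^ N) ((dyz3 ^^ N) F) = (\<lambda>m k l. 0)"
  shows "(dxz3 ^^ N) ((dyz3 ^^ N) (\<lambda>m k l. F k m l)) = (\<lambda>m k l. 0)"
  unfolding swap3_dyz3_funpow[of N F] swap3_dxz3_funpow[of N "(dxz3 ^^ N) F"]
    funpow_commute_at[of dxz3 dyz3 N N F, OF dxz3_dyz3, symmetric] assms ..

lemma dxz3_funpow_scale: "(dxz3 ^^ N) (\<lambda>m k l. c *\<^sub>c F m k l) = (\<lambda>m k l. c *\<^sub>c (dxz3 ^^ N) F m k l)"
  and dyz3_funpow_scale: "(dyz3 ^^ N) (\<lambda>m k l. c *\<^sub>c F m k l) = (\<lambda>m k l. c *\<^sub>c (dyz3 ^^ N) F m k l)"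
  by (induction N) (simp_all add: d3_defs fun_eq_iff cvec.scale_right_diff_distrib)

text \<open>[ab, c] = a [b, c] + [a, c] b, where (y - z)^N kills the first summand and (x - z)^N the
  second.\<close>

lemma commutator3_kill:
  assumes "field_on a" "field_on b"
    and "\<And>w. (dlt ^^ N) (\<lambda>m k. a m (c k w) - c k (a m w)) = (\<lambda>m k. 0)"
    and "\<And>w. (dlt ^^ N) (\<lambda>m k. b m (c k w) - c k (b m w)) = (\<lambda>m k. 0)"
  shows "(dxz3 ^^ N) ((dyz3 ^^ N) (\<lambda>m k l. a m (b k (c l w)) - c l (a m (b k w)))) = (\<lambda>m k l. 0)"
proof -
  let ?A = "\<lambda>m k l. a m (b k (c l w) - c l (b k w))"
  let ?B = "\<lambda>m k l. c l (a m (b k w)) - a m (c l (b k w))"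
  have A: "(dyz3 ^^ N) ?A = (\<lambda>m k l. 0)"
    using assms(4) by (intro ext) (simp add: dyz3_funpow_eq dlt_funpow_clin[OF field_clin[OF assms(1)]]
        clin_0[OF field_clin[OF assms(1)]])
  have "(dlt ^^ N) (\<lambda>m k. 0 - (a m (c k w) - c k (a m w))) = (\<lambda>m k. 0)" for w
    unfolding dlt_funpow_diff[of N "\<lambda>m k. 0"] assms(3) by simp
  hence B: "(dxz3 ^^ N) ?B = (\<lambda>m k l. 0)"
    by (intro ext) (simp add: dxz3_funpow_eq)
  have "(\<lambda>m k l. a m (b k (c l w)) - c l (a m (b k w))) = (\<lambda>m k l. ?A m k l - ?B m k l)"
    by (simp add: clin_diff[OF field_clin[OF assms(1)]])
  hence "(dxz3 ^^ N) ((dyz3 ^^ N) (\<lambda>m k l. a m (b k (c l w)) - c l (a m (b k w)))) =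
     (\<lambda>m k l. (dxz3 ^^ N) ((dyz3 ^^ N) ?A) m k l - (dxz3 ^^ N) ((dyz3 ^^ N) ?B) m k l)"
    by (simp only: dyz3_funpow_diff dxz3_funpow_diff)
  also have "(dxz3 ^^ N) ((dyz3 ^^ N) ?B) = (\<lambda>m k l. 0)"
    unfolding funpow_commute_at[of dxz3 dyz3, OF dxz3_dyz3] B by simp
  finally show ?thesis by (simp add: A)
qed

lemma below3_commutator:
  assumes "field_on a" "field_on b" "field_on c"
  shows "below3 (\<lambda>m k l. a m (b k (c l w)) - c l (a m (b k w)))"
proof (rule below3_diff)
  show "below3 (\<lambda>m k l. a m (b k (c l w)))"
    using field_below2_xy[OF assms(1,2)] unfolding below3_def by metis
  show "below3 (\<lambda>m k l. c l (a m (b k w)))"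
    using field_below2_xy[OF assms(1,2)] clin_0[OF field_clin[OF assms(3)]]
    unfolding below3_def below2_def by metis
qed

lemma pxy3_commutator:
  assumes "field_on a" "field_on b" "field_on c"
  shows "pxy3 n (\<lambda>m k l. a m (b k (c l w)) - c l (a m (b k w))) m k l =
     expand_xy n (\<lambda>m k. a m (b k (c l w))) m k - c l (expand_xy n (\<lambda>m k. a m (b k w)) m k)"
proof -
  obtain K where K: "below2 K (\<lambda>m k. a m (b k (c l w)))"
    using field_below2_xy assms by metis
  obtain L where L: "below2 L (\<lambda>m k. a m (b k w))"
    using field_below2_xy assms by metis
  hence L': "below2 L (\<lambda>m k. c l (a m (b k w)))"
    using clin_0[OF field_clin[OF assms(3)]] by (simp add: below2_def)
  show ?thesis
    unfolding pxy3_def expand_xy_diff[OF K L'] expand_xy_clin[OF L field_clin[OF assms(3)]] ..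
qed

text \<open>Dong's lemma. F w n is the commutator of (x - y)^n [a(x), b(y)] with c(z). It vanishes
  for large n by locality of a and b, and \<open>dong_descent\<close> carries this down to the given
  n at the price of a power of y - z, which commutes with the residue in x.\<close>

lemma local_pair_nprod:
  assumes f: "field_on a" "field_on b" "field_on c"
    and loc: "local_pair a b" "local_pair a c" "local_pair b c"
  shows "local_pair (nprod a b n) c"
proof -
  obtain N1 where N1: "\<And>w. (dlt ^^ N1) (\<lambda>m k. a m (c k w) - c k (a m w)) = (\<lambda>m k. 0)"
    using loc(2) by (auto simp: local_pair_def)
  obtain N2 where N2: "\<And>w. (dlt ^^ N2) (\<lambda>m k. b m (c k w) - c k (b m w)) = (\<lambda>m k. 0)"
    using loc(3) by (auto simp: local_pair_def)
  define N where "N = max N1 N2"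
  have N: "(dlt ^^ N) (\<lambda>m k. a m (c k w) - c k (a m w)) = (\<lambda>m k. 0)"
          "(dlt ^^ N) (\<lambda>m k. b m (c k w) - c k (b m w)) = (\<lambda>m k. 0)" for w
    by (rule dlt_funpow_zero_mono[OF N1] dlt_funpow_zero_mono[OF N2], simp add: N_def)+
  obtain N0 where N0: "\<And>n w m k. n \<ge> N0 \<Longrightarrow> borcherds a b n w m k = 0"
    using local_pair_borcherds[OF f(1,2) loc(1)] by blast
  define F where "F = (\<lambda>w n m k l. borcherds a b n (c l w) m k - c l (borcherds a b n w m k))"
  define G1 where "G1 = (\<lambda>w m k l. a m (b k (c l w)) - c l (a m (b k w)))"
  define G2 where "G2 = (\<lambda>w m k l. b m (a k (c l w)) - c l (b m (a k w)))"
  have FG: "F w n = (\<lambda>m k l. pxy3 n (G1 w) m k l - (- 1) powi n *\<^sub>c pxy3 n (G2 w) k m l)" for w n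
    unfolding F_def G1_def G2_def borcherds_def expand_yx_def
      pxy3_commutator[OF f(1,2,3)] pxy3_commutator[OF f(2,1,3)]
    by (intro ext) (simp add: clin_diff[OF field_clin[OF f(3)]] clin_scale[OF field_clin[OF f(3)]]
        cvec.scale_right_diff_distrib)
  have kill1: "(dxz3 ^^ N) ((dyz3 ^^ N) (pxy3 n (G1 w))) = (\<lambda>m k l. 0)" for n w
    unfolding G1_def by (intro pxy3_kill below3_commutator commutator3_kill f N)
  have "(dxz3 ^^ N) ((dyz3 ^^ N) (pxy3 n (G2 w))) = (\<lambda>m k l. 0)" for n w
    unfolding G2_def by (intro pxy3_kill below3_commutator commutator3_kill f N)
  hence kill2: "(dxz3 ^^ N) ((dyz3 ^^ N) (\<lambda>m k l. pxy3 n (G2 w) k m l)) = (\<lambda>m k l. 0)" for n w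
    by (rule swap3_kill)
  have kill: "(dxz3 ^^ N) ((dyz3 ^^ N) (F w n)) = (\<lambda>m k l. 0)" for w n
    unfolding FG dyz3_funpow_diff dxz3_funpow_diff dyz3_funpow_scale dxz3_funpow_scale kill1 kill2
    by simp
  have step: "F w (n + 1) = dxy3 (F w n)" for w n
    unfolding F_def borcherds_step[OF f(1,2)]
    by (intro ext) (simp add: dxy3_def dlt_def clin_diff[OF field_clin[OF f(3)]])
  \<comment> \<open>The number of steps down from an exponent n + j >= N0, where F vanishes.\<close>
  define j where "j = nat (N0 - n)"
  have zero: "F w (n + int j) = (\<lambda>m k l. 0)" for w
    unfolding F_def using N0 clin_0[OF field_clin[OF f(3)]] by (simp add: j_def)
  have "(dyz3 ^^ (2 * N * j)) (F w n) = (\<lambda>m k l. 0)" for w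
    using dong_descent[of "F w" "n + int j" N j, OF step zero kill] by simp
  hence "(dlt ^^ (2 * N * j)) (F w n 0) = (\<lambda>m k. 0)" for w
    using dyz3_funpow_eq[of "2 * N * j" "F w n" 0] by simp
  moreover have "F w n 0 = (\<lambda>m k. nprod a b n m (c k w) - c k (nprod a b n m w))" for w
    by (simp add: F_def nprod_def)
  ultimately show ?thesis
    unfolding local_pair_def by metis
qed

lemma local_pair_sym:
  assumes "local_pair a (b :: int \<Rightarrow> ('a \<Rightarrow>\<^sub>0 complex) \<Rightarrow> _)"
  shows "local_pair b a"
proof -
  obtain N where N: "\<And>w. (dlt ^^ N) (\<lambda>m k. a m (b k w) - b k (a m w)) = (\<lambda>m k. 0)"
    using assms by (auto simp: local_pair_def)
  have swap: "(dlt ^^ M) (\<lambda>m k. f k m) = (\<lambda>m k. (if even M then 1 else - 1) *\<^sub>c (dlt ^^ M) f k m)"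
    for M and f :: "int \<Rightarrow> int \<Rightarrow> ('a \<Rightarrow>\<^sub>0 complex)"
    by (induction M) (auto simp: dlt_def fun_eq_iff poly_mapping_eq_iff lookup_minus)
  have "(dlt ^^ N) (\<lambda>m k. b m (a k w) - a k (b m w)) = (\<lambda>m k. 0)" for w
  proof -
    have eq: "(\<lambda>m k. b m (a k w) - a k (b m w)) = (\<lambda>m k. 0 - (a k (b m w) - b m (a k w)))"
      by simp
    show ?thesis
      unfolding eq dlt_funpow_diff[of N "\<lambda>m k. 0"] swap[of N "\<lambda>m k. a m (b k w) - b k (a m w)"] N by simp
  qed
  thus ?thesis unfolding local_pair_def by blast
qed

lemma local_pair_lin_comb:
  assumes "field_on a" "field_on b" "field_on c" "local_pair a c" "local_pair b c"
  shows "local_pair (\<lambda>n w. s *\<^sub>c a n w + t *\<^sub>c b n w) c"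
proof -
  obtain N1 where N1: "\<And>w. (dlt ^^ N1) (\<lambda>m k. a m (c k w) - c k (a m w)) = (\<lambda>m k. 0)"
    using assms by (auto simp: local_pair_def)
  obtain N2 where N2: "\<And>w. (dlt ^^ N2) (\<lambda>m k. b m (c k w) - c k (b m w)) = (\<lambda>m k. 0)"
    using assms by (auto simp: local_pair_def)
  define N where "N = max N1 N2"
  have N: "(dlt ^^ N) (\<lambda>m k. a m (c k w) - c k (a m w)) = (\<lambda>m k. 0)"
          "(dlt ^^ N) (\<lambda>m k. b m (c k w) - c k (b m w)) = (\<lambda>m k. 0)" for w
    by (rule dlt_funpow_zero_mono[OF N1] dlt_funpow_zero_mono[OF N2], simp add: N_def)+
  have eq: "(\<lambda>m k. s *\<^sub>c a m (c k w) + t *\<^sub>c b m (c k w) - c k (s *\<^sub>c a m w + t *\<^sub>c b m w)) =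
    (\<lambda>m k. s *\<^sub>c (a m (c k w) - c k (a m w)) - (- t) *\<^sub>c (b m (c k w) - c k (b m w)))" for w
    by (intro ext) (simp add: clin_lin_comb[OF field_clin[OF assms(3)]] cvec.scale_right_diff_distrib)
  have "(dlt ^^ N) (\<lambda>m k. s *\<^sub>c a m (c k w) + t *\<^sub>c b m (c k w) - c k (s *\<^sub>c a m w + t *\<^sub>c b m w)) =
    (\<lambda>m k. 0)" for w
    unfolding eq dlt_funpow_diff
    by (simp add: dlt_funpow_clin[of "\<lambda>x. s *\<^sub>c x"] dlt_funpow_clin[of "\<lambda>x. t *\<^sub>c x"]
         dlt_funpow_clin[of "\<lambda>x. - (t *\<^sub>c x)"] clin_def N cvec.scale_right_distrib mult.commute)
  thus ?thesis unfolding local_pair_def by blast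
qed

section \<open>Uniqueness of fields and the Borcherds identity\<close>

text \<open>Without terms k >= 0 there is no negative power of y, so y = 0 may be substituted: (x -
  y)^N f = 0 becomes x^N f(x, 0) = 0. The index k = -1 is the power y^0.\<close>

lemma dlt_funpow_vanish:
  fixes f :: "int \<Rightarrow> int \<Rightarrow> 'v::ab_group_add"
  assumes "(dlt ^^ N) f = (\<lambda>m k. 0)" "\<And>m k. k \<ge> 0 \<Longrightarrow> f m k = 0"
  shows "f m (- 1) = 0"
  using assms
proof (induction N arbitrary: f m)
  case (Suc N)
  have 1: "(dlt ^^ N) (dlt f) = (\<lambda>m k. 0)"
    using Suc.prems(1) by (simp add: funpow_swap1)
  have 2: "dlt f m k = 0" if "k \<ge> 0" for m k
    using that by (simp add: dlt_def Suc.prems(2))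
  have "dlt f (m - 1) (- 1) = 0"
    by (rule Suc.IH[OF 1 2])
  thus ?case using Suc.prems(2)[of 0 "m - 1"] by (simp add: dlt_def)
qed simp

text \<open>Goddard's uniqueness argument: apply locality to the vacuum, then set the variable of
  \<open>c\<close> to \<open>0\<close>.\<close>

lemma goddard:
  assumes "field_on x" "field_on c" "local_pair x c"
    and "\<And>n. x n vac = 0" "\<And>n. n \<ge> 0 \<Longrightarrow> c n vac = 0"
  shows "x n (c (- 1) vac) = 0"
proof -
  obtain N where "(dlt ^^ N) (\<lambda>m k. x m (c k vac) - c k (x m vac)) = (\<lambda>m k. 0)"
    using assms(3) by (auto simp: local_pair_def)
  moreover have "(\<lambda>m k. x m (c k vac) - c k (x m vac)) = (\<lambda>m k. x m (c k vac))"
    using assms(4) clin_0[OF field_clin[OF assms(2)]] by simp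
  ultimately have "(dlt ^^ N) (\<lambda>m k. x m (c k vac)) = (\<lambda>m k. 0)" by simp
  thus ?thesis
    by (rule dlt_funpow_vanish) (simp add: assms(5) clin_0[OF field_clin[OF assms(1)]])
qed

text \<open>For \<open>g\<close> the difference of the two sides of the Borcherds identity, this reduces the
  identity to the case \<open>m = 0\<close>.\<close>

lemma determined_by_residue:
  fixes g :: "int \<Rightarrow> int \<Rightarrow> int \<Rightarrow> 'v::ab_group_add"
  assumes step: "\<And>n. g (n + 1) = dlt (g n)" and large: "g N = (\<lambda>m k. 0)"
    and res: "\<And>n k. g n 0 k = 0"
  shows "g (N - int j) m k = 0"
proof (induction j arbitrary: m k)
  case (Suc j)
  define n where "n = N - int (Suc j)"
  have "g (n + 1) m k = 0" for m k
    using Suc by (simp add: n_def)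
  hence *: "g n (m + 1) k = g n m (k + 1)" for m k
    unfolding step by (simp add: dlt_def)
  have "g n m k = 0"
  proof (induction m arbitrary: k rule: int_induct[of _ 0])
    case base thus ?case by (rule res)
  next
    case (step1 i) thus ?case using * by simp
  next
    case (step2 i) thus ?case using *[of "i - 1" "k - 1"] by simp
  qed
  thus ?case by (simp add: n_def)
qed (simp add: large)

definition creates where
  "creates vac a v \<longleftrightarrow> (\<forall>n\<ge>0. a n vac = 0) \<and> a (- 1) vac = v"

lemma createsD: "creates vac a v \<Longrightarrow> n \<ge> 0 \<Longrightarrow> a n vac = 0" "creates vac a v \<Longrightarrow> a (- 1) vac = v"
  by (simp_all add: creates_def)

text \<open>The modes a_i and b_i with i >= 0 kill the vacuum. So no negative power of y occurs, and
  at y = 0 the single term a_n b_{-1} 1 remains.\<close>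

lemma creates_nprod:
  assumes a: "field_on a" and b: "field_on b" and cr: "creates vac a u" "creates vac b v"
  shows "creates vac (nprod a b n) (a n v)"
  unfolding creates_def
proof (intro conjI allI impI)
  fix k :: int assume k: "k \<ge> 0"
  show "nprod a b n k vac = 0"
    unfolding nprod_def
    by (subst borcherds_eq_sum[OF a b, where I = 0]) (use k cr in \<open>auto simp: creates_def\<close>)
next
  show "nprod a b n (- 1) vac = a n v"
    unfolding nprod_def
    by (subst borcherds_eq_sum[OF a b, where I = 1])
       (use cr in \<open>auto simp: creates_def clin_0[OF field_clin[OF b]]\<close>)
qed

text \<open>Since T kills the vacuum, T x_n 1 = - n x_{n-1} 1. Hence x_{-1} 1 determines all x_n 1
  with n < 0; in other words x(z) 1 = e^{zT} x_{-1} 1.\<close>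

lemma transl_cov_vacuum:
  assumes "clin T" "transl_cov T x" "T vac = 0" "\<And>n. clin (x n)" "creates vac x 0"
  shows "x n vac = 0"
proof -
  have "x (- 1 - int j) vac = 0" for j
  proof (induction j)
    case 0 thus ?case using assms(5) by (simp add: creates_def)
  next
    case (Suc j)
    have "of_int (- 1 - int j) *\<^sub>c x (- 1 - int j - 1) vac = 0"
      using transl_covD[OF assms(2), of "- 1 - int j" vac] Suc
      by (simp add: assms(3) clin_0[OF assms(1)] clin_0[OF assms(4)])
    moreover have "(of_int (- 1 - int j) :: complex) \<noteq> 0"
      unfolding of_int_eq_0_iff by simp
    ultimately show ?case
      unfolding cvec.scale_eq_0_iff by (simp add: algebra_simps)
  qed
  from this[of "nat (- 1 - n)"] show ?thesis
    using createsD(1)[OF assms(5), of n] by (cases "n \<ge> 0") auto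
qed

lemma field_lin_comb:
  assumes "field_on a" "field_on b"
  shows "field_on (\<lambda>n w. s *\<^sub>c a n w + t *\<^sub>c b n w)"
  unfolding field_on_def
proof (intro conjI allI)
  fix n show "clin (\<lambda>w. s *\<^sub>c a n w + t *\<^sub>c b n w)"
    by (intro clin_plus clin_scale_fun field_clin assms)
next
  fix w
  obtain K L where "\<And>n. n \<ge> K \<Longrightarrow> a n w = 0" "\<And>n. n \<ge> L \<Longrightarrow> b n w = 0"
    using field_below[OF assms(1), of w] field_below[OF assms(2), of w] by metis
  thus "\<exists>N. \<forall>n\<ge>N. s *\<^sub>c a n w + t *\<^sub>c b n w = 0"
    by (intro exI[of _ "max K L"]) auto
qed

lemma transl_cov_lin_comb:
  assumes "clin T" "transl_cov T a" "transl_cov T b"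
  shows "transl_cov T (\<lambda>n w. s *\<^sub>c a n w + t *\<^sub>c b n w)"
  unfolding transl_cov_def
  by (intro allI poly_mapping_eqI)
     (simp add: clin_lin_comb[OF assms(1)] transl_covD[OF assms(2)] transl_covD[OF assms(3)]
       lookup_minus lookup_add algebra_simps)

lemma creates_lin_comb:
  "creates vac a u \<Longrightarrow> creates vac b v \<Longrightarrow> creates vac (\<lambda>n w. s *\<^sub>c a n w + t *\<^sub>c b n w) (s *\<^sub>c u + t *\<^sub>c v)"
  by (simp add: creates_def)

text \<open>The difference x of the two fields is covariant and creates 0, so it kills the vacuum.
  It is local with d by Dong's lemma, so by Goddard's argument it kills w, the vector that d
  creates.\<close>

lemma nprod_unique:
  assumes f: "field_on a" "field_on b" "field_on c" "field_on d"
    and T: "clin T" "T vac = 0" "transl_cov T a" "transl_cov T b" "transl_cov T c"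
    and cr: "creates vac a u" "creates vac b v" "creates vac c (a n v)" "creates vac d w"
    and loc: "local_pair a b" "local_pair a d" "local_pair b d" "local_pair c d"
  shows "c k w = nprod a b n k w"
proof -
  define x where "x = (\<lambda>k w. 1 *\<^sub>c c k w + (- 1) *\<^sub>c nprod a b n k w)"
  have x: "field_on x"
    unfolding x_def by (intro field_lin_comb field_nprod f)
  have "creates vac x (1 *\<^sub>c a n v + (- 1) *\<^sub>c a n v)"
    unfolding x_def by (rule creates_lin_comb[OF cr(3) creates_nprod[OF f(1,2) cr(1,2)]])
  hence "creates vac x 0"
    by simp
  moreover have "transl_cov T x"
    unfolding x_def by (intro transl_cov_lin_comb transl_cov_nprod T f)
  ultimately have "x k vac = 0" for k
    by (rule transl_cov_vacuum[OF T(1) _ T(2) field_clin[OF x], rotated])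
  moreover have "local_pair x d"
    unfolding x_def by (intro local_pair_lin_comb local_pair_nprod field_nprod f loc)
  ultimately have "x k (d (- 1) vac) = 0"
    using createsD(1)[OF cr(4)] by (intro goddard[OF x f(4)])
  thus ?thesis
    by (simp add: x_def createsD(2)[OF cr(4)])
qed

text \<open>Both sides satisfy g (n + 1) = dlt (g n), the left one by Pascal's rule in m, and vanish
  for large n. At m = 0 only i = 0 remains on the left, where c is the n-th product by
  hypothesis.\<close>

lemma borcherds_identity:
  assumes f: "field_on a" "field_on b" and loc: "local_pair a b"
    and c: "\<And>n k. c n k w = nprod a b n k w" "\<And>n k. n \<ge> N \<Longrightarrow> c n k w = 0"
  shows "Sum_any (\<lambda>i::nat. (of_int m gchoose i) *\<^sub>c c (n + int i) (m + k - int i) w) =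
    borcherds a b n w m k"
proof -
  define L where "L = (\<lambda>n m k. Sum_any (\<lambda>i::nat. (of_int m gchoose i) *\<^sub>c c (n + int i) (m + k - int i) w))"
  obtain M where M: "\<And>n m k. n \<ge> M \<Longrightarrow> borcherds a b n w m k = 0"
    using local_pair_borcherds[OF f loc] by metis
  define K where "K = max M N"
  have Leq: "L n m k = (\<Sum>i<I. (of_int m gchoose i) *\<^sub>c c (n + int i) (m + k - int i) w)"
    if "N - n \<le> int I" for n m k I
    unfolding L_def using that by (intro Sum_any_lessThan) (auto simp: c(2))
  have L: "L (n + 1) m k = L n (m + 1) k - L n m (k + 1)" for n m k
  proof -
    define I where "I = nat (N - n)"
    have I: "N - n \<le> int I" "N - n \<le> int (Suc I)" "N - (n + 1) \<le> int I"
      by (auto simp: I_def)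
    let ?g = "\<lambda>i. c (n + int i) (m + 1 + k - int i) w"
    let ?c = "\<lambda>i. (of_int m gchoose i) :: complex"
    have "L n (m + 1) k = (\<Sum>i<Suc I. (of_int (m + 1) gchoose i) *\<^sub>c ?g i)"
      by (rule Leq) (rule I(2))
    also have "\<dots> = ?g 0 + (\<Sum>i<I. (of_int (m + 1) gchoose Suc i) *\<^sub>c ?g (Suc i))"
      by (subst sum.lessThan_Suc_shift) simp
    also have "\<dots> = ?g 0 + (\<Sum>i<I. ?c (Suc i) *\<^sub>c ?g (Suc i)) + (\<Sum>i<I. ?c i *\<^sub>c ?g (Suc i))"
      unfolding gchoose_Suc_of_int cvec.scale_left_distrib sum.distrib by simp
    also have "?g 0 + (\<Sum>i<I. ?c (Suc i) *\<^sub>c ?g (Suc i)) = (\<Sum>i<Suc I. ?c i *\<^sub>c ?g i)"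
      by (subst sum.lessThan_Suc_shift) simp
    also have "\<dots> = L n m (k + 1)"
      by (subst Leq[OF I(2)]) (simp add: algebra_simps)
    also have "(\<Sum>i<I. ?c i *\<^sub>c ?g (Suc i)) = L (n + 1) m k"
      by (subst Leq[OF I(3)]) (simp add: algebra_simps)
    finally show ?thesis by simp
  qed
  define g where "g = (\<lambda>n m k. L n m k - borcherds a b n w m k)"
  have g: "g (n + 1) = dlt (g n)" for n
    unfolding g_def by (intro ext) (simp add: L dlt_def borcherds_step[OF f])
  have "L K m k = 0" for m k
    by (subst Leq[where I = 0]) (auto simp: K_def)
  hence gK: "g (K + int j) = (\<lambda>m k. 0)" for j
    using M by (induction j) (simp_all add: g_def K_def Leq[where I = 0])
  have res: "g n 0 k = 0" for n k
    by (simp add: g_def L_def gbinomial_0_left if_distrib[of "\<lambda>x. x *\<^sub>c y" for y] cong: if_cong)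
       (simp add: c(1) nprod_def)
  \<comment> \<open>One instance of \<open>determined_by_residue\<close> covers both n >= K and n <
    K.\<close>
  have "n = K + int (nat (n - K)) - int (nat (K - n))"
    by simp
  hence "g n m k = 0"
    using determined_by_residue[OF g gK res, of "nat (n - K)" "nat (K - n)" m k] by simp
  thus ?thesis by (simp add: g_def L_def)
qed

section \<open>Exponentials of commuting operators\<close>

text \<open>The coefficient of x^i in the l-th power of S = \<Sum>k\<ge>1. A k x^k, so that
  \<open>exp_coeff\<close> becomes a sum over l with the weights 1 / l!.\<close>

fun exp_power :: "(nat \<Rightarrow> fock \<Rightarrow> fock) \<Rightarrow> nat \<Rightarrow> nat \<Rightarrow> fock \<Rightarrow> fock" where
  "exp_power A 0 i w = (if i = 0 then w else 0)"
| "exp_power A (Suc l) i w = (\<Sum>k\<in>{1..i}. A k (exp_power A l (i - k) w))"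

lemma finite_compositions: "finite {ks. length ks = l \<and> 0 \<notin> set ks \<and> sum_list ks = (i::nat)}"
  by (rule finite_subset[OF _ finite_lists_length_eq[of "{..i}" l]]) (auto intro: member_le_sum_list)

lemma exp_power_eq:
  assumes "\<And>k. clin (A k)"
  shows "exp_power A l i w = (\<Sum>ks | length ks = l \<and> 0 \<notin> set ks \<and> sum_list ks = i. foldr A ks w)"
proof (induction l arbitrary: i)
  case 0
  have "{ks :: nat list. length ks = 0 \<and> 0 \<notin> set ks \<and> sum_list ks = i} = (if i = 0 then {[]} else {})"
    by auto
  thus ?case by simp
next
  case (Suc l)
  let ?S = "\<lambda>l i. {ks :: nat list. length ks = l \<and> 0 \<notin> set ks \<and> sum_list ks = i}"
  have eq: "?S (Suc l) i = (\<lambda>(k, ks). k # ks) ` (SIGMA k:{1..i}. ?S l (i - k))"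
    by (fastforce simp: length_Suc_conv image_iff)
  have "(\<Sum>ks\<in>?S (Suc l) i. foldr A ks w) = (\<Sum>(k, ks)\<in>(SIGMA k:{1..i}. ?S l (i - k)). A k (foldr A ks w))"
    unfolding eq by (subst sum.reindex) (auto simp: inj_on_def case_prod_unfold)
  also have "\<dots> = (\<Sum>k\<in>{1..i}. \<Sum>ks\<in>?S l (i - k). A k (foldr A ks w))"
    by (rule sum.Sigma[symmetric]) (auto intro: finite_compositions)
  also have "\<dots> = exp_power A (Suc l) i w"
    by (simp add: Suc clin_sum[OF assms])
  finally show ?case ..
qed

lemma length_le_sum_list: "0 \<notin> set ks \<Longrightarrow> length ks \<le> sum_list (ks :: nat list)"
  by (induction ks) auto

lemma exp_coeff_eq:
  assumes "\<And>k. clin (A k)" "i \<le> I"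
  shows "exp_coeff A i w = (\<Sum>l\<le>I. (1 / fact l) *\<^sub>c exp_power A l i w)"
proof -
  let ?S = "{ks :: nat list. 0 \<notin> set ks \<and> sum_list ks = i}"
  have fin: "finite ?S"
  proof (rule finite_subset)
    show "?S \<subseteq> (\<Union>l\<le>i. {ks. length ks = l \<and> 0 \<notin> set ks \<and> sum_list ks = i})"
      using length_le_sum_list by auto
  qed (auto intro: finite_compositions)
  have "exp_coeff A i w = (\<Sum>l\<le>I. \<Sum>ks\<in>{ks\<in>?S. length ks = l}. (1 / fact (length ks)) *\<^sub>c foldr A ks w)"
    unfolding exp_coeff_def
    using length_le_sum_list assms(2) order_trans fin
    by (intro sum.group[symmetric]) fastforce+
  also have "\<dots> = (\<Sum>l\<le>I. (1 / fact l) *\<^sub>c exp_power A l i w)"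
    by (intro sum.cong refl) (simp add: exp_power_eq[OF assms(1)] cvec.scale_sum_right conj_ac cong: conj_cong)
  finally show ?thesis .
qed

lemma sum_triangle_swap:
  fixes f :: "nat \<Rightarrow> nat \<Rightarrow> 'v::comm_monoid_add"
  shows "(\<Sum>k\<in>{1..i}. \<Sum>l\<in>{1..i - k}. f k l) = (\<Sum>l\<in>{1..i}. \<Sum>k\<in>{1..i - l}. f k l)"
proof -
  have "(\<Sum>k\<in>{1..i}. \<Sum>l\<in>{1..i - k}. f k l) = (\<Sum>k\<in>{1..i}. \<Sum>l\<in>{l\<in>{1..i}. k + l \<le> i}. f k l)"
    by (intro sum.cong refl) auto
  also have "\<dots> = (\<Sum>l\<in>{1..i}. \<Sum>k\<in>{k\<in>{1..i}. k + l \<le> i}. f k l)"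
    by (rule sum.swap_restrict) auto
  also have "\<dots> = (\<Sum>l\<in>{1..i}. \<Sum>k\<in>{1..i - l}. f k l)"
    by (intro sum.cong refl) auto
  finally show ?thesis .
qed

text \<open>For commuting coefficients, x d/dx S^{l+1} = (l + 1) (x S') S^l.\<close>

lemma exp_power_deriv:
  assumes lin: "\<And>k. clin (A k)" and comm: "\<And>k l x. A k (A l x) = A l (A k x)"
  shows "of_nat i *\<^sub>c exp_power A (Suc l) i w =
    of_nat (Suc l) *\<^sub>c (\<Sum>k\<in>{1..i}. of_nat k *\<^sub>c A k (exp_power A l (i - k) w))"
proof (induction l arbitrary: i)
  case 0
  show ?case
    by (auto simp: cvec.scale_sum_right clin_0[OF lin] intro!: sum.cong)
next
  case (Suc l)
  let ?c = "\<lambda>l i. exp_power A l i w"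
  have "of_nat i *\<^sub>c ?c (Suc (Suc l)) i = (\<Sum>k\<in>{1..i}. of_nat i *\<^sub>c A k (?c (Suc l) (i - k)))"
    by (simp add: cvec.scale_sum_right del: exp_power.simps(2)) (simp add: cvec.scale_sum_right)
  also have "\<dots> = (\<Sum>k\<in>{1..i}. of_nat k *\<^sub>c A k (?c (Suc l) (i - k)) + A k (of_nat (i - k) *\<^sub>c ?c (Suc l) (i - k)))"
    by (intro sum.cong refl)
       (simp add: clin_scale[OF lin] cvec.scale_left_distrib[symmetric] of_nat_diff)
  also have "\<dots> = (\<Sum>k\<in>{1..i}. of_nat k *\<^sub>c A k (?c (Suc l) (i - k))) +
      (\<Sum>k\<in>{1..i}. A k (of_nat (i - k) *\<^sub>c ?c (Suc l) (i - k)))"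
    by (rule sum.distrib)
  also have "(\<Sum>k\<in>{1..i}. A k (of_nat (i - k) *\<^sub>c ?c (Suc l) (i - k))) =
     of_nat (Suc l) *\<^sub>c (\<Sum>k\<in>{1..i}. \<Sum>k'\<in>{1..i - k}. of_nat k' *\<^sub>c A k (A k' (?c l (i - k - k'))))"
    unfolding Suc by (simp add: clin_scale[OF lin] clin_sum[OF lin] cvec.scale_sum_right)
  also have "(\<Sum>k\<in>{1..i}. \<Sum>k'\<in>{1..i - k}. of_nat k' *\<^sub>c A k (A k' (?c l (i - k - k')))) =
      (\<Sum>k'\<in>{1..i}. \<Sum>k\<in>{1..i - k'}. of_nat k' *\<^sub>c A k (A k' (?c l (i - k - k'))))"
    by (rule sum_triangle_swap)
  also have "\<dots> = (\<Sum>k'\<in>{1..i}. of_nat k' *\<^sub>c A k' (?c (Suc l) (i - k')))"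
  proof (intro sum.cong refl)
    fix k'
    have "(\<Sum>k\<in>{1..i - k'}. of_nat k' *\<^sub>c A k (A k' (?c l (i - k - k')))) =
        (\<Sum>k\<in>{1..i - k'}. of_nat k' *\<^sub>c A k' (A k (?c l (i - k' - k))))"
      by (intro sum.cong refl) (simp add: comm[of _ k'] diff_diff_eq add.commute)
    thus "(\<Sum>k\<in>{1..i - k'}. of_nat k' *\<^sub>c A k (A k' (?c l (i - k - k')))) =
        of_nat k' *\<^sub>c A k' (?c (Suc l) (i - k'))"
      by (simp add: clin_sum[OF lin] cvec.scale_sum_right)
  qed
  finally show ?case
    by (simp only: of_nat_Suc[of "Suc l"] cvec.scale_left_distrib cvec.scale_one add.commute)
qed

lemma exp_coeff_0: "(\<And>k. clin (A k)) \<Longrightarrow> exp_coeff A 0 w = w"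
  by (subst exp_coeff_eq[of _ _ 0]) auto

text \<open>The logarithmic derivative \<open>x E'(x) = (\<Sum>k. k A k x\<^sup>k) E(x)\<close> of the exponential; all
  further properties of \<open>exp_coeff\<close> follow from this recursion.\<close>

lemma exp_coeff_rec:
  assumes lin: "\<And>k. clin (A k)" and comm: "\<And>k l x. A k (A l x) = A l (A k x)"
  shows "of_nat i *\<^sub>c exp_coeff A i w = (\<Sum>k\<in>{1..i}. of_nat k *\<^sub>c A k (exp_coeff A (i - k) w))"
proof -
  have "of_nat i *\<^sub>c exp_coeff A i w = (\<Sum>l\<le>Suc i. (1 / fact l) *\<^sub>c (of_nat i *\<^sub>c exp_power A l i w))"
    by (subst exp_coeff_eq[OF lin, of i "Suc i"]) (simp_all add: cvec.scale_sum_right mult.commute del: exp_power.simps sum.atMost_Suc)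
  also have "\<dots> = (\<Sum>l\<le>i. (1 / fact (Suc l)) *\<^sub>c (of_nat i *\<^sub>c exp_power A (Suc l) i w))"
    by (subst sum.atMost_Suc_shift) (simp del: exp_power.simps(2))
  also have "\<dots> = (\<Sum>l\<le>i. (1 / fact l) *\<^sub>c (\<Sum>k\<in>{1..i}. of_nat k *\<^sub>c A k (exp_power A l (i - k) w)))"
  proof (intro sum.cong refl)
    fix l
    have "(1 / fact (Suc l) :: complex) * of_nat (Suc l) = 1 / fact l"
      by (simp add: field_simps del: of_nat_Suc)
    thus "(1 / fact (Suc l)) *\<^sub>c (of_nat i *\<^sub>c exp_power A (Suc l) i w) =
        (1 / fact l) *\<^sub>c (\<Sum>k\<in>{1..i}. of_nat k *\<^sub>c A k (exp_power A l (i - k) w))"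
      unfolding exp_power_deriv[OF lin comm] cvec.scale_scale by simp
  qed
  also have "\<dots> = (\<Sum>k\<in>{1..i}. of_nat k *\<^sub>c A k (\<Sum>l\<le>i. (1 / fact l) *\<^sub>c exp_power A l (i - k) w))"
    unfolding clin_sum[OF lin] clin_scale[OF lin] cvec.scale_sum_right
    by (subst sum.swap) (simp add: mult.commute)
  also have "\<dots> = (\<Sum>k\<in>{1..i}. of_nat k *\<^sub>c A k (exp_coeff A (i - k) w))"
    by (intro sum.cong refl) (simp add: exp_coeff_eq[OF lin, of _ i])
  finally show ?thesis .
qed

lemma exp_coeff_clin:
  assumes lin: "\<And>k. clin (A k)"
  shows "clin (exp_coeff A i)"
proof -
  have "clin (\<lambda>w. foldr A ks w)" for ks
    by (induction ks) (auto simp: intro: clin_comp[OF lin])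
  thus ?thesis
    unfolding exp_coeff_def by (intro clin_sum_fun clin_scale_fun)
qed

lemma cscale_nat_cancel: "of_nat i *\<^sub>c x = of_nat i *\<^sub>c y \<Longrightarrow> i > 0 \<Longrightarrow> x = y"
  by (simp add: cvec.scale_cancel_left)

text \<open>If B commutes with all A k except for [B, A l] = c, then [B, exp S] = c x^l exp S. The
  recursion for i E_i allows induction on i.\<close>

lemma exp_coeff_bracket:
  assumes lin: "\<And>k. clin (A k)" and comm: "\<And>k l x. A k (A l x) = A l (A k x)"
    and B: "clin B" "l > 0"
    and bracket: "\<And>k x. k > 0 \<Longrightarrow> B (A k x) = A k (B x) + (if k = l then c *\<^sub>c x else 0)"
  shows "B (exp_coeff A i w) = exp_coeff A i (B w) + (if l \<le> i then c *\<^sub>c exp_coeff A (i - l) w else 0)"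
proof (induction i rule: less_induct)
  case (less i)
  let ?E = "exp_coeff A"
  show ?case
  proof (cases "i = 0")
    case True thus ?thesis using B(2) by (simp add: exp_coeff_0[OF lin])
  next
    case False
    have "of_nat i *\<^sub>c B (?E i w) = (\<Sum>k\<in>{1..i}. of_nat k *\<^sub>c B (A k (?E (i - k) w)))"
      by (simp add: clin_scale[OF B(1), symmetric] exp_coeff_rec[OF lin comm])
         (simp add: clin_sum[OF B(1)] clin_scale[OF B(1)])
    also have "\<dots> = (\<Sum>k\<in>{1..i}. of_nat k *\<^sub>c A k (?E (i - k) (B w)) +
        (of_nat k *\<^sub>c A k (if l \<le> i - k then c *\<^sub>c ?E (i - k - l) w else 0) +
         of_nat k *\<^sub>c (if k = l then c *\<^sub>c ?E (i - k) w else 0)))"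
      by (intro sum.cong refl) (simp add: bracket less clin_add[OF lin] cvec.scale_right_distrib add.assoc)
    also have "\<dots> = of_nat i *\<^sub>c ?E i (B w) +
       ((\<Sum>k\<in>{1..i}. of_nat k *\<^sub>c A k (if l \<le> i - k then c *\<^sub>c ?E (i - k - l) w else 0)) +
        (\<Sum>k\<in>{1..i}. of_nat k *\<^sub>c (if k = l then c *\<^sub>c ?E (i - k) w else 0)))"
      by (simp only: sum.distrib exp_coeff_rec[OF lin comm])
    also have "(\<Sum>k\<in>{1..i}. of_nat k *\<^sub>c (if k = l then c *\<^sub>c ?E (i - k) w else 0)) =
        (if l \<le> i then of_nat l *\<^sub>c c *\<^sub>c ?E (i - l) w else 0)"
      using B(2) by (simp add: if_distrib[of "\<lambda>x. y *\<^sub>c x" for y] sum.delta' cong: if_cong)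
    also have "(\<Sum>k\<in>{1..i}. of_nat k *\<^sub>c A k (if l \<le> i - k then c *\<^sub>c ?E (i - k - l) w else 0)) =
        (if l \<le> i then of_nat (i - l) *\<^sub>c c *\<^sub>c ?E (i - l) w else 0)"
    proof (cases "l \<le> i")
      case True
      have "(\<Sum>k\<in>{1..i}. of_nat k *\<^sub>c A k (if l \<le> i - k then c *\<^sub>c ?E (i - k - l) w else 0)) =
         (\<Sum>k\<in>{1..i - l}. of_nat k *\<^sub>c A k (c *\<^sub>c ?E (i - l - k) w))"
        using True B(2)
        by (intro sum.mono_neutral_cong_right) (auto simp: clin_0[OF lin] add.commute)
      also have "\<dots> = c *\<^sub>c (\<Sum>k\<in>{1..i - l}. of_nat k *\<^sub>c A k (?E (i - l - k) w))"
        by (simp add: cvec.scale_sum_right clin_scale[OF lin] mult.commute)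
      finally show ?thesis
        using True unfolding exp_coeff_rec[OF lin comm, symmetric] by (simp add: mult.commute)
    qed (auto intro!: sum.neutral simp: clin_0[OF lin])
    \<comment> \<open>E_{i-l} occurs with the factor i - l from the induction hypothesis and with l
      from the bracket itself; together this is i.\<close>
    also have "of_nat i *\<^sub>c ?E i (B w) + ((if l \<le> i then of_nat (i - l) *\<^sub>c c *\<^sub>c ?E (i - l) w else 0) +
       (if l \<le> i then of_nat l *\<^sub>c c *\<^sub>c ?E (i - l) w else 0)) =
       of_nat i *\<^sub>c (?E i (B w) + (if l \<le> i then c *\<^sub>c ?E (i - l) w else 0))"
    proof (cases "l \<le> i")
      case True
      hence "of_nat (i - l) + of_nat l = (of_nat i :: complex)"
        by (simp add: of_nat_diff)
      thus ?thesis
        unfolding if_P[OF True] cvec.scale_left_distrib [symmetric] cvec.scale_right_distrib by (simp only:)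
    qed simp
    finally have eq: "of_nat i *\<^sub>c B (?E i w) = of_nat i *\<^sub>c (?E i (B w) + (if l \<le> i then c *\<^sub>c ?E (i - l) w else 0))" .
    show ?thesis
      by (rule cscale_nat_cancel[OF eq]) (use False in simp)
  qed
qed

lemma exp_coeff_comm:
  assumes lin: "\<And>k. clin (A k)" and comm: "\<And>k l x. A k (A l x) = A l (A k x)"
    and B: "clin B" and "\<And>k x. k > 0 \<Longrightarrow> B (A k x) = A k (B x)"
  shows "B (exp_coeff A i w) = exp_coeff A i (B w)"
  using exp_coeff_bracket[OF lin comm B, where l = 1 and c = 0 and w = w and i = i] assms(4) by simp

section \<open>Linear maps on Fock space\<close>

lemma keys_cscale: "keys (c *\<^sub>c x) \<subseteq> keys x"
  by (auto simp: in_keys_iff)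

lemma lin_ext_superset:
  assumes "finite A" "keys f \<subseteq> A"
  shows "lin_ext g f = (\<Sum>k\<in>A. lookup f k *\<^sub>c g k)"
  unfolding lin_ext_def using assms
  by (intro sum.mono_neutral_left) (auto simp: in_keys_iff)

lemma clin_lin_ext [simp]: "clin (lin_ext g)"
proof (rule clinI)
  fix x y :: "'a \<Rightarrow>\<^sub>0 complex"
  let ?A = "keys x \<union> keys y"
  have "finite ?A" by simp
  thus "lin_ext g (x + y) = lin_ext g x + lin_ext g y"
    using keys_add[of x y]
    by (simp add: lin_ext_superset[of ?A] lookup_add cvec.scale_left_distrib sum.distrib)
next
  fix c and x :: "'a \<Rightarrow>\<^sub>0 complex"
  show "lin_ext g (c *\<^sub>c x) = c *\<^sub>c lin_ext g x"
    using keys_cscale[of c x]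
    by (simp add: lin_ext_superset[of "keys x"] cvec.scale_sum_right)
qed

lemma lin_ext_single [simp]: "lin_ext g (single k c) = c *\<^sub>c g k"
  by (subst lin_ext_superset[of "{k}"]) auto

lemma expand_singles:
  "x = (\<Sum>k\<in>keys x. lookup x k *\<^sub>c single k 1)"
  by (rule poly_mapping_eqI)
     (simp add: lookup_sum lookup_single when_def if_distrib[of "\<lambda>x. y * x" for y] in_keys_iff
        sum.delta cong: if_cong)

lemma clin_expand:
  "clin f \<Longrightarrow> f x = (\<Sum>k\<in>keys x. lookup x k *\<^sub>c f (single k 1))"
  by (subst expand_singles[of x]) (simp add: clin_sum clin_scale)

lemma clin_eq_on_keys:
  assumes "clin f" "clin g" "\<And>k. k \<in> keys x \<Longrightarrow> f (single k 1) = g (single k 1)"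
  shows "f x = g x"
  unfolding clin_expand[OF assms(1), of x] clin_expand[OF assms(2), of x]
  by (intro sum.cong refl) (simp add: assms(3))

lemma clin_keys:
  assumes "clin f" "\<And>k. k \<in> keys x \<Longrightarrow> keys (f (single k 1)) \<subseteq> K"
  shows "keys (f x) \<subseteq> K"
proof
  fix l assume "l \<in> keys (f x)"
  hence "(\<Sum>k\<in>keys x. lookup x k * lookup (f (single k 1)) l) \<noteq> 0"
    by (subst (asm) clin_expand[OF assms(1)]) (simp add: in_keys_iff lookup_sum)
  then obtain k where k: "k \<in> keys x"
      "lookup x k * lookup (f (single k 1)) l \<noteq> 0"
    by (rule sum.not_neutral_contains_not_neutral)
  hence "l \<in> keys (f (single k 1))"
    by (simp add: in_keys_iff)
  thus "l \<in> K" using assms(2)[OF k(1)] by blast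
qed

lemma field_onI:
  assumes "\<And>n. clin (a n)" "\<And>k. \<exists>N. \<forall>n\<ge>N. a n (single k 1) = 0"
  shows "field_on a"
  unfolding field_on_def
proof (intro conjI allI)
  fix w
  obtain N where N: "\<And>k n. n \<ge> N k \<Longrightarrow> a n (single k 1) = 0"
    using choice[of "\<lambda>k N. \<forall>n\<ge>N. a n (single k 1) = 0"] assms(2) by blast
  have "a n w = 0" if "n \<ge> Max (insert 0 (N ` keys w))" for n
    using that by (subst clin_expand[OF assms(1)]) (auto intro!: sum.neutral N)
  thus "\<exists>N. \<forall>n\<ge>N. a n w = 0" by blast
qed (rule assms)

section \<open>The Heisenberg algebra\<close>

lemma clin_mult_left: "clin (\<lambda>x. y * x)" for y :: fock
proof (rule clinI)
  fix c x
  have single: "c *\<^sub>c x = single 0 c * x" for c and x :: fock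
  proof (rule poly_mapping_eqI)
    fix k
    have "single 0 c * x = (\<Sum>l\<in>keys x. single 0 c * (lookup x l *\<^sub>c single l 1))"
      by (subst expand_singles[of x]) (simp add: sum_distrib_left)
    also have "\<dots> = (\<Sum>l\<in>keys x. c *\<^sub>c (lookup x l *\<^sub>c single l 1))"
    proof (intro sum.cong refl)
      fix l
      have "lookup x l *\<^sub>c single l 1 = single l (lookup x l)"
        by (rule poly_mapping_eqI) (simp add: lookup_single when_def)
      thus "single 0 c * (lookup x l *\<^sub>c single l 1) =
          c *\<^sub>c (lookup x l *\<^sub>c single l 1)"
        by (simp add: mult_single) (rule poly_mapping_eqI, simp add: lookup_single when_def)
    qed
    also have "\<dots> = c *\<^sub>c x"
      unfolding cvec.scale_sum_right[symmetric] expand_singles[of x, symmetric] ..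
    finally show "lookup (c *\<^sub>c x) k = lookup (single 0 c * x) k"
      by simp
  qed
  show "y * (c *\<^sub>c x) = c *\<^sub>c (y * x)"
    unfolding single by (simp add: mult_ac)
qed (simp add: distrib_left)

lemma clin_heis [simp]: "clin (heis p k)"
  by (cases "k < 0"; cases "k = 0") (simp_all add: heis_def[abs_def] clin_mult_left)

lemma heis_neg_single:
  "j > 0 \<Longrightarrow> heis p (- int j) (single (r, M) 1) = single (r, add_mset j M) 1"
  by (simp add: heis_def mult_single plus_prod_def)

lemma heis_zero_single:
  "heis p 0 (single (r, M) 1) = (2 * of_nat p * of_rat r) *\<^sub>c single (r, M) 1"
  by (simp add: heis_def)

lemma heis_pos_single:
  "j > 0 \<Longrightarrow> heis p (int j) (single (r, M) 1) =
     (2 * of_nat p * of_nat j * of_nat (count M j)) *\<^sub>c single (r, M - {#j#}) 1"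
  by (simp add: heis_def)

lemma int_cases3:
  obtains j where "j > 0" "k = - int j" | "k = 0" | j where "j > 0" "k = int j"
  by (metis int_cases2 of_nat_0 neq0_conv minus_zero)

lemma heis_comm:
  "heis p j (heis p k x) = heis p k (heis p j x) + (if j + k = 0 then 2 * of_nat p * of_int j else 0) *\<^sub>c x"
proof (rule clin_eq_on_keys[where x = x and f = "\<lambda>x. heis p j (heis p k x)" and
      g = "\<lambda>x. heis p k (heis p j x) + (if j + k = 0 then 2 * of_nat p * of_int j else 0) *\<^sub>c x"])
  show "clin (\<lambda>x. heis p j (heis p k x))"
    by (rule clin_comp[OF clin_heis clin_heis])
  show "clin (\<lambda>x. heis p k (heis p j x) + (if j + k = 0 then 2 * of_nat p * of_int j else 0) *\<^sub>c x)"
    by (rule clin_plus[OF clin_comp[OF clin_heis clin_heis] clin_scale_fun[OF clin_id]])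
next
  fix key :: fock_key
  obtain r M where key: "key = (r, M)" by (cases key)
  note s = clin_scale[OF clin_heis] clin_0[OF clin_heis] heis_neg_single heis_zero_single heis_pos_single
  show "heis p j (heis p k (single key 1)) =
    heis p k (heis p j (single key 1)) +
    (if j + k = 0 then 2 * of_nat p * of_int j else 0) *\<^sub>c single key 1" (is "?goal")
  proof (cases j rule: int_cases3; cases k rule: int_cases3)
    fix a b assume *: "a > 0" "j = - int a" "b > 0" "k = - int b"
    thus ?goal unfolding key by (simp add: s add_mset_commute)
  next
    fix a b assume *: "a > 0" "j = - int a" "b > 0" "k = int b"
    show ?goal
    proof (cases "b \<in># M")
      case True
      then obtain N where "M = add_mset b N" by (meson multi_member_split)
      thus ?thesis unfolding key using * by (auto simp: s intro!: poly_mapping_eqI) (simp_all only: lookup_add lookup_minus lookup_cscale, simp_all add: algebra_simps)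
    next
      case False
      thus ?thesis unfolding key using * by (auto simp: s not_in_iff)
    qed
  next
    fix a b assume *: "a > 0" "j = int a" "b > 0" "k = - int b"
    show ?goal
    proof (cases "a \<in># M")
      case True
      then obtain N where "M = add_mset a N" by (meson multi_member_split)
      thus ?thesis unfolding key using * by (auto simp: s intro!: poly_mapping_eqI) (simp_all only: lookup_add lookup_minus lookup_cscale, simp_all add: algebra_simps)
    next
      case False
      thus ?thesis unfolding key using * by (auto simp: s not_in_iff)
    qed
  next
    fix a b assume *: "a > 0" "j = int a" "b > 0" "k = int b"
    have "M - {#a#} - {#b#} = M - {#b#} - {#a#}"
      by (simp add: diff_diff_eq add.commute)
    thus ?goal unfolding key using * by (cases "a = b") (auto simp: s mult_ac)
  qed (auto simp: key s mult_ac)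
qed

definition base_vector :: "rat \<Rightarrow> fock \<Rightarrow> bool" where
  "base_vector t x \<longleftrightarrow> (\<exists>M. set_mset M \<subseteq> {0} \<and> x = single (t, M) 1)"

lemma base_vector_exp_vec: "base_vector t (exp_vec t)"
  unfolding base_vector_def exp_vec_def by (intro exI[of _ "{#}"]) simp

text \<open>Keys containing \<open>0\<close> play no role for the vertex algebra, but every operator ignores these
  entries, so statements about all of \<open>fock\<close> need no side condition.\<close>

lemma fock_generated:
  fixes Z :: "'i \<Rightarrow> fock \<Rightarrow> fock"
  assumes "\<And>i. clin (Z i)" "\<And>i t x. base_vector t x \<Longrightarrow> Z i x = 0"
    and step: "\<And>i k x. k > 0 \<Longrightarrow> (\<And>i. Z i x = 0) \<Longrightarrow> Z i (heis p (- int k) x) = 0"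
  shows "Z i x = 0"
proof -
  have *: "Z i (single (t, N + M) 1) = 0" if "set_mset M \<subseteq> {0}" "0 \<notin># N" for t N M i
    using that(2)
  proof (induction N arbitrary: i)
    case empty
    have "base_vector t (single (t, M) 1)"
      unfolding base_vector_def using that(1) by blast
    thus ?case by (simp add: assms(2))
  next
    case (add k N)
    thus ?case using step[of k "single (t, N + M) 1"] by (simp add: heis_neg_single)
  qed
  have single: "Z i (single (t, M) 1) = 0" for t M i
    using *[of "filter_mset ((=) 0) M" "filter_mset (\<lambda>k. 0 \<noteq> k) M" i t]
    by (auto simp: add.commute[of "filter_mset (\<lambda>k. 0 \<noteq> k) M"] multiset_partition[of M "(=) 0", symmetric])
  show ?thesis
    by (rule clin_eq_on_keys[where f = "Z i" and g = "\<lambda>x. 0"]) (auto simp: assms(1) single)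
qed

lemma base_vector_heis:
  assumes "base_vector t x"
  shows "k > 0 \<Longrightarrow> heis p k x = 0" "heis p 0 x = (2 * of_nat p * of_rat t) *\<^sub>c x"
proof -
  obtain M where M: "set_mset M \<subseteq> {0}" "x = single (t, M) 1"
    using assms by (auto simp: base_vector_def)
  { assume "k > 0"
    moreover define j where "j = nat k"
    ultimately have j: "j > 0" "k = int j" by auto
    hence "count M j = 0" using M(1) by (auto simp: count_eq_zero_iff)
    thus "heis p k x = 0" by (simp add: M j heis_pos_single) }
  show "heis p 0 x = (2 * of_nat p * of_rat t) *\<^sub>c x"
    by (simp add: M heis_zero_single)
qed

section \<open>Charge and level\<close>

definition mset_level :: "nat multiset \<Rightarrow> rat" where
  "mset_level M = of_nat (sum_mset M)"

lemma mset_level_simps [simp]: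
  "mset_level {#} = 0" "mset_level (add_mset k M) = of_nat k + mset_level M"
  by (simp_all add: mset_level_def)

lemma mset_level_nonneg: "mset_level M \<ge> 0"
  unfolding mset_level_def by (rule of_nat_0_le_iff)

text \<open>The charge s fixes the exponent 2prs of z. The level q drops by k under
  \<open>heis p k\<close> and cannot be negative, which is the source of truncation for the
  Heisenberg and exponential modes.\<close>

definition charged :: "rat \<Rightarrow> rat \<Rightarrow> fock \<Rightarrow> bool" where
  "charged s q x \<longleftrightarrow> (\<forall>k\<in>keys x. fst k = s \<and> mset_level (snd k) = q)"

lemma charged_0 [simp]: "charged s q 0"
  by (simp add: charged_def)

lemma charged_add: "charged s q x \<Longrightarrow> charged s q y \<Longrightarrow> charged s q (x + y)"
  unfolding charged_def using keys_add[of x y] by blast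

lemma charged_scale: "charged s q x \<Longrightarrow> charged s q (c *\<^sub>c x)"
  unfolding charged_def using keys_cscale[of c x] by blast

lemma charged_sum: "(\<And>i. i \<in> A \<Longrightarrow> charged s q (f i)) \<Longrightarrow> charged s q (sum f A)"
  by (induction A rule: infinite_finite_induct) (auto intro: charged_add)

lemma charged_Sum_any: "(\<And>i. charged s q (f i)) \<Longrightarrow> charged s q (Sum_any f)"
  unfolding Sum_any.expand_set by (rule charged_sum)

lemma charged_negative: "charged s q x \<Longrightarrow> q < 0 \<Longrightarrow> x = 0"
proof (rule ccontr)
  assume *: "charged s q x" "q < 0" "x \<noteq> 0"
  then obtain k where "k \<in> keys x"
    by (metis keys_eq_empty all_not_in_conv)
  thus False using * mset_level_nonneg[of "snd k"] by (auto simp: charged_def)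
qed

lemma charged_single: "charged s q (single (s, M) c)" if "mset_level M = q"
  using that by (auto simp: charged_def)

lemma charged_clin:
  assumes "clin f" "charged s q x"
    and "\<And>M. mset_level M = q \<Longrightarrow> charged s' q' (f (single (s, M) 1))"
  shows "charged s' q' (f x)"
  unfolding clin_expand[OF assms(1), of x]
proof (intro charged_sum charged_scale)
  fix k assume "k \<in> keys x"
  with assms(2) have "k = (s, snd k)" "mset_level (snd k) = q"
    by (auto simp: charged_def prod_eq_iff)
  thus "charged s' q' (f (single k 1))"
    using assms(3)[of "snd k"] by simp
qed

lemma charged_heis:
  assumes "charged s q x"
  shows "charged s (q - of_int k) (heis p k x)"
proof (rule charged_clin[OF clin_heis assms])
  fix M assume q: "mset_level M = q"
  show "charged s (q - of_int k) (heis p k (single (s, M) 1))"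
  proof (cases k rule: int_cases3)
    case (1 j)
    thus ?thesis using q by (auto simp: heis_neg_single intro!: charged_single)
  next
    case 2
    thus ?thesis using q by (auto simp: heis_zero_single intro!: charged_single charged_scale)
  next
    case (3 j)
    show ?thesis
    proof (cases "j \<in># M")
      case True
      then obtain N where "M = add_mset j N" by (meson multi_member_split)
      thus ?thesis using q 3 by (auto simp: heis_pos_single intro!: charged_single charged_scale)
    next
      case False
      thus ?thesis using 3 by (simp add: heis_pos_single not_in_iff)
    qed
  qed
qed

lemma charged_exp_vec_mult:
  assumes "charged s q x"
  shows "charged (r + s) q (exp_vec r * x)"
  by (rule charged_clin[OF clin_mult_left assms])
     (auto simp: exp_vec_def mult_single plus_prod_def intro!: charged_single)

lemma charged_exp_coeff:
  assumes lin: "\<And>k. clin (A k)" and comm: "\<And>k l x. A k (A l x) = A l (A k x)"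
    and A: "\<And>k x q. charged s q x \<Longrightarrow> charged s (q + e * of_nat k) (A k x)"
    and x: "charged s q x"
  shows "charged s (q + e * of_nat i) (exp_coeff A i x)"
proof (induction i rule: less_induct)
  case (less i)
  show ?case
  proof (cases "i = 0")
    case True thus ?thesis using x by (simp add: exp_coeff_0[OF lin])
  next
    case False
    have "charged s (q + e * of_nat i) (of_nat i *\<^sub>c exp_coeff A i x)"
      unfolding exp_coeff_rec[OF lin comm]
    proof (intro charged_sum charged_scale)
      fix k assume "k \<in> {1..i}"
      thus "charged s (q + e * of_nat i) (A k (exp_coeff A (i - k) x))"
        using A[OF less[of "i - k"], of k] by (simp add: algebra_simps of_nat_diff)
    qed
    from charged_scale[OF this, of "1 / of_nat i"] show ?thesis
      using False by simp
  qed
qed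

section \<open>Exponential vertex operators\<close>

text \<open>The creation half of the exponential. It is extended by 0 to negative indices, so that
  shifts i - j need no case distinction.\<close>

definition exp_neg :: "nat \<Rightarrow> rat \<Rightarrow> int \<Rightarrow> fock \<Rightarrow> fock" where
  "exp_neg p r i x = (if i < 0 then 0 else
     exp_coeff (\<lambda>k x. (of_rat r / of_nat k) *\<^sub>c heis p (- int k) x) (nat i) x)"

definition exp_pos :: "nat \<Rightarrow> rat \<Rightarrow> nat \<Rightarrow> fock \<Rightarrow> fock" where
  "exp_pos p r i = exp_coeff (\<lambda>k x. (- of_rat r / of_nat k) *\<^sub>c heis p (int k) x) i"

text \<open>The coefficient of z^N in Y(e^{r\<alpha>}, z) without the factor z^{r\<alpha>(0)}. On
  charge s that factor only shifts the index by 2prs, as in \<open>exp_mode_charged\<close>.\<close>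

definition exp_op :: "nat \<Rightarrow> rat \<Rightarrow> int \<Rightarrow> fock \<Rightarrow> fock" where
  "exp_op p r N x = Sum_any (\<lambda>j::nat. exp_vec r * exp_neg p r (N + int j) (exp_pos p r j x))"

lemma heis_family_clin:
  "clin (\<lambda>x. c *\<^sub>c heis p k x)"
  by (rule clin_scale_fun[OF clin_heis])

lemma heis_family_comm:
  "(of_rat r / of_nat k) *\<^sub>c heis p (- int k) ((of_rat r / of_nat l) *\<^sub>c heis p (- int l) x) =
   (of_rat r / of_nat l) *\<^sub>c heis p (- int l) ((of_rat r / of_nat k) *\<^sub>c heis p (- int k) x)"
  "(- of_rat r / of_nat k) *\<^sub>c heis p (int k) ((- of_rat r / of_nat l) *\<^sub>c heis p (int l) x) =
   (- of_rat r / of_nat l) *\<^sub>c heis p (int l) ((- of_rat r / of_nat k) *\<^sub>c heis p (int k) x)"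
  by (simp_all add: clin_scale[OF clin_heis] clin_minus[OF clin_heis] heis_comm[of p "- int k"] heis_comm[of p "int k"] mult.commute)

lemma clin_exp_neg: "clin (exp_neg p r i)"
  using exp_coeff_clin[OF heis_family_clin]
  by (cases "i < 0") (auto simp: exp_neg_def[abs_def])

lemma clin_exp_pos: "clin (exp_pos p r i)"
  unfolding exp_pos_def by (rule exp_coeff_clin[OF heis_family_clin])

lemma exp_neg_0: "exp_neg p r 0 x = x"
  using exp_coeff_0[OF heis_family_clin] by (simp add: exp_neg_def)

lemma exp_pos_0: "exp_pos p r 0 x = x"
  unfolding exp_pos_def by (rule exp_coeff_0[OF heis_family_clin])

lemma exp_neg_rec:
  "of_nat i *\<^sub>c exp_neg p r (int i) x = (\<Sum>k\<in>{1..i}. of_rat r *\<^sub>c heis p (- int k) (exp_neg p r (int i - int k) x))"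
proof -
  let ?E = "exp_coeff (\<lambda>k x. (of_rat r / of_nat k) *\<^sub>c heis p (- int k) x)"
  have "of_nat i *\<^sub>c exp_neg p r (int i) x = of_nat i *\<^sub>c ?E i x"
    by (simp add: exp_neg_def)
  also have "\<dots> = (\<Sum>k\<in>{1..i}. of_nat k *\<^sub>c (of_rat r / of_nat k) *\<^sub>c heis p (- int k) (?E (i - k) x))"
    by (rule exp_coeff_rec[OF heis_family_clin heis_family_comm(1)])
  also have "\<dots> = (\<Sum>k\<in>{1..i}. of_rat r *\<^sub>c heis p (- int k) (exp_neg p r (int i - int k) x))"
    by (intro sum.cong refl) (simp add: exp_neg_def nat_diff_distrib')
  finally show ?thesis .
qed

lemma exp_pos_rec:
  "of_nat i *\<^sub>c exp_pos p r i x = (\<Sum>k\<in>{1..i}. (- of_rat r) *\<^sub>c heis p (int k) (exp_pos p r (i - k) x))"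
proof -
  let ?E = "exp_coeff (\<lambda>k x. (- of_rat r / of_nat k) *\<^sub>c heis p (int k) x)"
  have "of_nat i *\<^sub>c ?E i x = (\<Sum>k\<in>{1..i}. of_nat k *\<^sub>c (- of_rat r / of_nat k) *\<^sub>c heis p (int k) (?E (i - k) x))"
    by (rule exp_coeff_rec[OF heis_family_clin heis_family_comm(2)])
  also have "\<dots> = (\<Sum>k\<in>{1..i}. (- of_rat r) *\<^sub>c heis p (int k) (?E (i - k) x))"
    by (intro sum.cong refl) simp
  finally show ?thesis unfolding exp_pos_def .
qed

text \<open>[\<alpha>(j), r\<alpha>(-j)/j] = 2pr is a scalar, so \<open>exp_coeff_bracket\<close>
  applies.\<close>

lemma heis_exp_neg:
  assumes "j > 0"
  shows "heis p j (exp_neg p r i x) = exp_neg p r i (heis p j x) + (2 * of_nat p * of_rat r) *\<^sub>c exp_neg p r (i - j) x"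
proof (cases "i < 0")
  case True
  thus ?thesis using assms by (simp add: exp_neg_def clin_0[OF clin_heis])
next
  case False
  define l where "l = nat j"
  have l: "l > 0" "j = int l" using assms by (auto simp: l_def)
  have "heis p j ((of_rat r / of_nat k) *\<^sub>c heis p (- int k) x) =
      (of_rat r / of_nat k) *\<^sub>c heis p (- int k) (heis p j x) +
      (if k = l then (2 * of_nat p * of_rat r) *\<^sub>c x else 0)" if "k > 0" for k x
    using that l
    by (simp add: clin_scale[OF clin_heis] heis_comm[of p "int l"] cvec.scale_right_distrib)
  from exp_coeff_bracket[OF heis_family_clin heis_family_comm(1) clin_heis l(1) this, where i = "nat i" and w = x]
  show ?thesis
    using False l by (auto simp: exp_neg_def nat_diff_distrib')
qed

lemma heis_exp_neg_nonpos:
  assumes "j \<le> 0"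
  shows "heis p j (exp_neg p r i x) = exp_neg p r i (heis p j x)"
proof (cases "i < 0")
  case False
  have "heis p j ((of_rat r / of_nat k) *\<^sub>c heis p (- int k) x) =
      (of_rat r / of_nat k) *\<^sub>c heis p (- int k) (heis p j x)" if "k > 0" for k x
    using that assms by (simp add: clin_scale[OF clin_heis] heis_comm[of p j])
  from exp_coeff_comm[OF heis_family_clin heis_family_comm(1) clin_heis this, where i = "nat i" and w = x]
  show ?thesis
    using False by (simp add: exp_neg_def)
qed (simp add: exp_neg_def clin_0[OF clin_heis])

lemma heis_exp_pos:
  assumes "j > 0"
  shows "heis p (- int j) (exp_pos p r i x) = exp_pos p r i (heis p (- int j) x) +
    (if j \<le> i then (2 * of_nat p * of_rat r) *\<^sub>c exp_pos p r (i - j) x else 0)"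
proof -
  have "heis p (- int j) ((- of_rat r / of_nat k) *\<^sub>c heis p (int k) x) =
      (- of_rat r / of_nat k) *\<^sub>c heis p (int k) (heis p (- int j) x) +
      (if k = j then (2 * of_nat p * of_rat r) *\<^sub>c x else 0)" if "k > 0" for k x
    using that assms
    by (simp add: clin_scale[OF clin_heis] clin_minus[OF clin_heis] heis_comm[of p "- int j"] cvec.scale_right_distrib)
  from exp_coeff_bracket[OF heis_family_clin heis_family_comm(2) clin_heis assms this, where i = i and w = x]
  show ?thesis unfolding exp_pos_def .
qed

lemma heis_exp_pos_nonneg:
  assumes "j \<ge> 0"
  shows "heis p j (exp_pos p r i x) = exp_pos p r i (heis p j x)"
proof -
  have "heis p j ((- of_rat r / of_nat k) *\<^sub>c heis p (int k) x) =
      (- of_rat r / of_nat k) *\<^sub>c heis p (int k) (heis p j x)" if "k > 0" for k x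
    using that assms by (simp add: clin_scale[OF clin_heis] clin_minus[OF clin_heis] heis_comm[of p j])
  from exp_coeff_comm[OF heis_family_clin heis_family_comm(2) clin_heis this, where i = i and w = x]
  show ?thesis unfolding exp_pos_def .
qed

lemma heis_exp_vec:
  "heis p j (exp_vec r * x) = exp_vec r * heis p j x +
     (if j = 0 then (2 * of_nat p * of_rat r) *\<^sub>c (exp_vec r * x) else 0)"
proof (rule clin_eq_on_keys[where x = x and f = "\<lambda>x. heis p j (exp_vec r * x)" and
     g = "\<lambda>x. exp_vec r * heis p j x + (if j = 0 then (2 * of_nat p * of_rat r) *\<^sub>c (exp_vec r * x) else 0)"])
  show "clin (\<lambda>x. heis p j (exp_vec r * x))"
    by (rule clin_comp[OF clin_heis clin_mult_left])
  have "clin (\<lambda>x. if j = 0 then (2 * of_nat p * of_rat r) *\<^sub>c (exp_vec r * x) else 0)"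
    by (cases "j = 0") (simp_all add: clin_scale_fun[OF clin_mult_left])
  thus "clin (\<lambda>x. exp_vec r * heis p j x + (if j = 0 then (2 * of_nat p * of_rat r) *\<^sub>c (exp_vec r * x) else 0))"
    by (rule clin_plus[OF clin_comp[OF clin_mult_left clin_heis]])
next
  fix key :: fock_key
  obtain s M where key: "key = (s, M)" by (cases key)
  have mult: "exp_vec r * single (s, M) 1 = single (r + s, M) 1" for M
    by (simp add: exp_vec_def mult_single plus_prod_def)
  show "heis p j (exp_vec r * single key 1) = exp_vec r * heis p j (single key 1) +
     (if j = 0 then (2 * of_nat p * of_rat r) *\<^sub>c (exp_vec r * single key 1) else 0)"
    unfolding key mult
    by (cases j rule: int_cases3)
       (simp_all add: heis_neg_single heis_zero_single heis_pos_single mult clin_scale[OF clin_mult_left]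
          of_rat_add cvec.scale_left_distrib distrib_left)
qed

lemma charged_exp_neg:
  assumes "charged s q x"
  shows "charged s (q + of_int i) (exp_neg p r i x)"
proof (cases "i < 0")
  case False
  have "charged s (q + 1 * of_nat k) ((of_rat r / of_nat k) *\<^sub>c heis p (- int k) x)"
    if "charged s q x" for q k x
    using charged_heis[OF that, of "- int k" p] by (intro charged_scale) simp
  from charged_exp_coeff[OF heis_family_clin heis_family_comm(1) this assms, where i = "nat i"]
  show ?thesis using False by (simp add: exp_neg_def)
qed (simp add: exp_neg_def)

lemma charged_exp_pos:
  assumes "charged s q x"
  shows "charged s (q - of_nat i) (exp_pos p r i x)"
proof -
  have "charged s (q + (- 1) * of_nat k) ((- of_rat r / of_nat k) *\<^sub>c heis p (int k) x)"
    if "charged s q x" for q k x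
    using charged_heis[OF that, of "int k" p] by (intro charged_scale) simp
  from charged_exp_coeff[OF heis_family_clin heis_family_comm(2) this assms, where i = i]
  show ?thesis by (simp add: exp_pos_def)
qed

lemma exp_pos_large: "charged s q x \<Longrightarrow> of_nat i > q \<Longrightarrow> exp_pos p r i x = 0"
  by (rule charged_negative[OF charged_exp_pos]) auto

lemma exp_pos_eventually: "\<exists>J. \<forall>j\<ge>J. exp_pos p r j x = 0"
proof -
  have "field_on (\<lambda>n. exp_pos p r (nat n))"
  proof (rule field_onI)
    fix k :: fock_key
    obtain s M where k: "k = (s, M)" by (cases k)
    have ch: "charged s (mset_level M) (single k 1)"
      unfolding k by (rule charged_single) simp
    have "exp_pos p r (nat n) (single k 1) = 0" if "n \<ge> 1 + int (sum_mset M)" for n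
    proof -
      have "nat n > sum_mset M" using that by linarith
      thus ?thesis by (intro exp_pos_large[OF ch]) (simp only: mset_level_def of_nat_less_iff)
    qed
    thus "\<exists>N. \<forall>n\<ge>N. exp_pos p r (nat n) (single k 1) = 0" by blast
  qed (rule clin_exp_pos)
  from field_below[OF this, of x] obtain K where K: "\<And>n. n \<ge> K \<Longrightarrow> exp_pos p r (nat n) x = 0"
    by blast
  have "exp_pos p r j x = 0" if "j \<ge> nat K" for j
    using K[of "int j"] that by simp
  thus ?thesis by blast
qed

lemma clin_exp_term: "clin (\<lambda>x. exp_vec r * exp_neg p r N (exp_pos p r j x))"
  by (rule clin_comp[OF clin_mult_left clin_comp[OF clin_exp_neg clin_exp_pos]])

lemma exp_term_eventually:
  "\<exists>J. \<forall>j\<ge>J. exp_vec r * exp_neg p r (N + int j) (exp_pos p r j x) = 0"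
proof -
  obtain J where "\<forall>j\<ge>J. exp_pos p r j x = 0" using exp_pos_eventually by blast
  thus ?thesis by (intro exI[of _ J]) (simp add: clin_0[OF clin_exp_neg])
qed

lemma clin_exp_op: "clin (exp_op p r N)"
  unfolding exp_op_def[abs_def] by (rule clin_Sum_any_fun[OF clin_exp_term exp_term_eventually])

lemma Sum_any_shift:
  fixes f :: "nat \<Rightarrow> 'v::comm_monoid_add"
  assumes "\<And>j. j \<ge> K \<Longrightarrow> f j = 0"
  shows "Sum_any (\<lambda>j. if l \<le> j then f (j - l) else 0) = Sum_any f"
proof -
  have "Sum_any (\<lambda>j. if l \<le> j then f (j - l) else 0) = (\<Sum>j<K + l. if l \<le> j then f (j - l) else 0)"
    using assms by (intro Sum_any_lessThan) auto
  also have "\<dots> = (\<Sum>j\<in>{l..<K + l}. f (j - l))"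
    by (intro sum.mono_neutral_cong_right) auto
  also have "\<dots> = (\<Sum>j<K. f j)"
    by (rule sum.reindex_bij_witness[of _ "\<lambda>j. j + l" "\<lambda>j. j - l"]) auto
  also have "\<dots> = Sum_any f"
    using assms by (intro Sum_any_lessThan[symmetric]) auto
  finally show ?thesis .
qed

text \<open>[\<alpha>(l), E(z)] = 2pr z^l E(z) for the exponential E without its zero mode factor.
  The scalar comes from the creation half for l > 0, from e^{r\<alpha>} for l = 0 and from the
  annihilation half for l < 0.\<close>

lemma heis_exp_op:
  "heis p l (exp_op p r N x) = exp_op p r N (heis p l x) + (2 * of_nat p * of_rat r) *\<^sub>c exp_op p r (N - l) x"
proof -
  let ?c = "2 * of_nat p * of_rat r :: complex"
  let ?t = "\<lambda>N j x. exp_vec r * exp_neg p r (N + int j) (exp_pos p r j x)"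
  obtain J where J: "\<And>j. j \<ge> J \<Longrightarrow> exp_pos p r j x = 0" using exp_pos_eventually by blast
  obtain J' where J': "\<And>j. j \<ge> J' \<Longrightarrow> exp_pos p r j (heis p l x) = 0" using exp_pos_eventually by blast
  have t: "?t N j x = 0" if "j \<ge> J" for N j using J[OF that] by (simp add: clin_0[OF clin_exp_neg])
  have t': "?t N j (heis p l x) = 0" if "j \<ge> J'" for N j using J'[OF that] by (simp add: clin_0[OF clin_exp_neg])
  have *: "heis p l (exp_op p r N x) = Sum_any (\<lambda>j. heis p l (?t N j x))"
    unfolding exp_op_def by (rule clin_Sum_any_nat[OF clin_heis t])
  have c: "Sum_any (\<lambda>j. ?c *\<^sub>c ?t M j x) = ?c *\<^sub>c exp_op p r M x" for M
    unfolding exp_op_def by (rule clin_Sum_any_nat[OF clin_scale_fun[OF clin_id] t, symmetric])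
  note s = clin_add[OF clin_mult_left] clin_scale[OF clin_mult_left]
    clin_add[OF clin_exp_neg] clin_scale[OF clin_exp_neg]
  show ?thesis
  proof (cases "l \<ge> 0")
    case True
    have "heis p l (?t N j x) = ?t N j (heis p l x) + ?c *\<^sub>c ?t (N - l) j x" for j
      using True
      by (cases "l = 0") (simp_all add: heis_exp_vec heis_exp_neg heis_exp_neg_nonpos heis_exp_pos_nonneg s algebra_simps)
    hence "heis p l (exp_op p r N x) = Sum_any (\<lambda>j. ?t N j (heis p l x) + ?c *\<^sub>c ?t (N - l) j x)"
      unfolding * by (rule arg_cong[where f = Sum_any, OF ext])
    also have "\<dots> = Sum_any (\<lambda>j. ?t N j (heis p l x)) + Sum_any (\<lambda>j. ?c *\<^sub>c ?t (N - l) j x)"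
      by (rule Sum_any_add_nat[of J' _ J]) (use t t' in auto)
    finally show ?thesis unfolding c exp_op_def .
  next
    case False
    define m where "m = nat (- l)"
    have m: "m > 0" "l = - int m" using False by (auto simp: m_def)
    \<comment> \<open>N + j = (N - l) + (j - m), so lowering the annihilation index by m leaves the
      creation index alone.\<close>
    have "heis p l (?t N j x) = ?t N j (heis p l x) + (if m \<le> j then ?c *\<^sub>c ?t (N - l) (j - m) x else 0)" for j
      using m by (simp add: heis_exp_vec heis_exp_neg_nonpos heis_exp_pos s of_nat_diff clin_0[OF clin_exp_neg])
    hence "heis p l (exp_op p r N x) =
       Sum_any (\<lambda>j. ?t N j (heis p l x) + (if m \<le> j then ?c *\<^sub>c ?t (N - l) (j - m) x else 0))"
      unfolding * by (rule arg_cong[where f = Sum_any, OF ext])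
    also have "\<dots> = Sum_any (\<lambda>j. ?t N j (heis p l x)) + Sum_any (\<lambda>j. if m \<le> j then ?c *\<^sub>c ?t (N - l) (j - m) x else 0)"
    proof (rule Sum_any_add_nat[of J' _ "J + m"])
      fix j assume "j \<ge> J + m"
      hence "?t (N - l) (j - m) x = 0" by (intro t) simp
      thus "(if m \<le> j then ?c *\<^sub>c ?t (N - l) (j - m) x else 0) = 0"
        by (simp only: cvec.scale_zero_right if_cancel)
    qed (rule t')
    also have "Sum_any (\<lambda>j. if m \<le> j then ?c *\<^sub>c ?t (N - l) (j - m) x else 0) = Sum_any (\<lambda>j. ?c *\<^sub>c ?t (N - l) j x)"
      by (rule Sum_any_shift[of J]) (simp only: t cvec.scale_zero_right)
    finally show ?thesis unfolding c exp_op_def .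
  qed
qed

text \<open>All exponents of z differ from 2prs by integers, so a nonintegral 2prs leaves no
  integral power. Otherwise n and j determine i.\<close>

lemma exp_mode_single:
  "exp_mode p r n (single (s, M) 1) = (if 2 * of_nat p * r * s \<in> \<int>
     then exp_op p r (- n - 1 - \<lfloor>2 * of_nat p * r * s\<rfloor>) (single (s, M) 1) else 0)"
proof -
  let ?x = "single (s, M) (1::complex)"
  let ?g = "\<lambda>i j. exp_vec r *
         exp_coeff (\<lambda>k x. (of_rat r / of_nat k) *\<^sub>c heis p (- int k) x) i (exp_pos p r j ?x)"
  have eq: "exp_mode p r n ?x = Sum_any (\<lambda>j::nat. Sum_any (\<lambda>i::nat.
       if 2 * of_nat p * r * s + of_nat i - of_nat j = - of_int n - 1 then ?g i j else 0))"
    unfolding exp_mode_def exp_pos_def by simp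
  show ?thesis
  proof (cases "2 * of_nat p * r * s \<in> \<int>")
    case True
    then obtain \<nu> where \<nu>: "2 * of_nat p * r * s = of_int \<nu>" by (auto elim: Ints_cases)
    have "Sum_any (\<lambda>i::nat. if 2 * of_nat p * r * s + of_nat i - of_nat j = - of_int n - 1 then ?g i j else 0) =
       exp_vec r * exp_neg p r (- n - 1 - \<nu> + int j) (exp_pos p r j ?x)" for j
    proof -
      have iff: "2 * of_nat p * r * s + of_nat i - of_nat j = - of_int n - 1 \<longleftrightarrow> int i = - n - 1 - \<nu> + int j" for i
      proof -
        have "2 * of_nat p * r * s + of_nat i - of_nat j = - of_int n - 1 \<longleftrightarrow>
          (of_int (\<nu> + int i - int j) :: rat) = of_int (- n - 1)"
          unfolding \<nu> by simp
        thus ?thesis unfolding of_int_eq_iff by linarith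
      qed
      show ?thesis
      proof (cases "- n - 1 - \<nu> + int j < 0")
        case True
        hence "int i \<noteq> - n - 1 - \<nu> + int j" for i by linarith
        thus ?thesis unfolding iff using True by (simp add: exp_neg_def)
      next
        case False
        hence "int i = - n - 1 - \<nu> + int j \<longleftrightarrow> i = nat (- n - 1 - \<nu> + int j)" for i by linarith
        thus ?thesis unfolding iff using False by (simp add: exp_neg_def)
      qed
    qed
    thus ?thesis using True unfolding eq exp_op_def by (simp add: \<nu>)
  next
    case False
    have "2 * of_nat p * r * s + of_nat i - of_nat j \<noteq> - of_int n - 1" for i j
    proof
      assume "2 * of_nat p * r * s + of_nat i - of_nat j = - of_int n - 1"
      hence "2 * of_nat p * r * s = of_int (- n - 1 - int i + int j)" by simp
      thus False using False by simp
    qed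
    thus ?thesis using False unfolding eq by simp
  qed
qed

lemma clin_exp_mode [simp]: "clin (exp_mode p r n)"
  unfolding exp_mode_def by simp

lemma exp_mode_charged:
  assumes "charged s q x"
  shows "exp_mode p r n x = (if 2 * of_nat p * r * s \<in> \<int>
     then exp_op p r (- n - 1 - \<lfloor>2 * of_nat p * r * s\<rfloor>) x else 0)"
proof (cases "2 * of_nat p * r * s \<in> \<int>")
  case True
  have "exp_mode p r n x = exp_op p r (- n - 1 - \<lfloor>2 * of_nat p * r * s\<rfloor>) x"
  proof (rule clin_eq_on_keys[OF clin_exp_mode clin_exp_op])
    fix k assume "k \<in> keys x"
    hence "k = (s, snd k)" using assms by (auto simp: charged_def prod_eq_iff)
    thus "exp_mode p r n (single k 1) =
      exp_op p r (- n - 1 - \<lfloor>2 * of_nat p * r * s\<rfloor>) (single k 1)"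
      using exp_mode_single[of p r n s "snd k"] True by simp
  qed
  thus ?thesis using True by simp
next
  case False
  have "exp_mode p r n x = (\<lambda>x. 0) x"
  proof (rule clin_eq_on_keys[OF clin_exp_mode clin_zero])
    fix k assume "k \<in> keys x"
    hence "k = (s, snd k)" using assms by (auto simp: charged_def prod_eq_iff)
    thus "exp_mode p r n (single k 1) = 0"
      using exp_mode_single[of p r n s "snd k"] False by simp
  qed
  thus ?thesis using False by simp
qed

lemma charged_exp_mode:
  assumes "charged s q x"
  shows "charged (r + s) (q - of_int n - 1 - 2 * of_nat p * r * s) (exp_mode p r n x)"
proof (cases "2 * of_nat p * r * s \<in> \<int>")
  case True
  then obtain \<nu> where \<nu>: "2 * of_nat p * r * s = of_int \<nu>" by (auto elim: Ints_cases)
  have "charged (r + s) (q - of_int n - 1 - of_int \<nu>)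
     (exp_vec r * exp_neg p r (- n - 1 - \<nu> + int j) (exp_pos p r j x))" for j
    using charged_exp_vec_mult[where r = r, OF charged_exp_neg[where i = "- n - 1 - \<nu> + int j" and p = p and r = r,
        OF charged_exp_pos[where i = j and p = p and r = r, OF assms]]]
    by (simp add: algebra_simps)
  thus ?thesis
    using True unfolding exp_mode_charged[OF assms] exp_op_def by (auto simp: \<nu> intro!: charged_Sum_any)
qed (simp add: exp_mode_charged[OF assms])

lemma field_exp_mode: "field_on (exp_mode p r)"
proof (rule field_onI)
  fix k :: fock_key
  obtain s M where k: "k = (s, M)" by (cases k)
  let ?q = "mset_level M" and ?x = "single k (1::complex)"
  have ch: "charged s ?q ?x" unfolding k by (rule charged_single) simp
  have "exp_mode p r n ?x = 0" if "n \<ge> \<lceil>?q - 2 * of_nat p * r * s\<rceil>" for n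
  proof -
    have "?q - 2 * of_nat p * r * s \<le> of_int n" using that by linarith
    thus ?thesis by (intro charged_negative[OF charged_exp_mode[OF ch]]) linarith
  qed
  thus "\<exists>N. \<forall>n\<ge>N. exp_mode p r n ?x = 0" by blast
qed simp

lemma heis_exp_mode:
  "heis p l (exp_mode p r n x) = exp_mode p r n (heis p l x) + (2 * of_nat p * of_rat r) *\<^sub>c exp_mode p r (n + l) x"
proof (rule clin_eq_on_keys[where x = x and f = "\<lambda>x. heis p l (exp_mode p r n x)" and
     g = "\<lambda>x. exp_mode p r n (heis p l x) + (2 * of_nat p * of_rat r) *\<^sub>c exp_mode p r (n + l) x"])
  show "clin (\<lambda>x. heis p l (exp_mode p r n x))"
    by (rule clin_comp[OF clin_heis clin_exp_mode])
  show "clin (\<lambda>x. exp_mode p r n (heis p l x) + (2 * of_nat p * of_rat r) *\<^sub>c exp_mode p r (n + l) x)"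
    by (rule clin_plus[OF clin_comp[OF clin_exp_mode clin_heis] clin_scale_fun[OF clin_exp_mode]])
next
  fix k :: fock_key
  obtain s M where k: "k = (s, M)" by (cases k)
  let ?x = "single k (1::complex)"
  have ch: "charged s (mset_level M) ?x" unfolding k by (rule charged_single) simp
  show "heis p l (exp_mode p r n ?x) =
    exp_mode p r n (heis p l ?x) + (2 * of_nat p * of_rat r) *\<^sub>c exp_mode p r (n + l) ?x"
  proof (cases "2 * of_nat p * r * s \<in> \<int>")
    case True
    have "- n - 1 - \<nu> - l = - (n + l) - 1 - \<nu>" for \<nu> by simp
    thus ?thesis
      unfolding exp_mode_charged[OF ch] exp_mode_charged[OF charged_heis[OF ch]] if_P[OF True] heis_exp_op
      by (simp only:)
  qed (simp add: exp_mode_charged[OF ch] exp_mode_charged[OF charged_heis[OF ch]] clin_0[OF clin_heis])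
qed

lemma exp_pos_base: "base_vector t x \<Longrightarrow> j > 0 \<Longrightarrow> exp_pos p r j x = 0"
proof (induction j rule: less_induct)
  case (less j)
  have "of_nat j *\<^sub>c exp_pos p r j x = 0"
    unfolding exp_pos_rec
  proof (intro sum.neutral ballI)
    fix k assume k: "k \<in> {1..j}"
    have "heis p (int k) (exp_pos p r (j - k) x) = 0"
    proof (cases "k = j")
      case True
      thus ?thesis using base_vector_heis(1)[OF less.prems(1)] k by (simp add: exp_pos_0)
    next
      case False
      thus ?thesis using less k by (simp add: clin_0[OF clin_heis])
    qed
    thus "(- of_rat r) *\<^sub>c heis p (int k) (exp_pos p r (j - k) x) = 0" by simp
  qed
  thus ?case using less.prems(2) by simp
qed

lemma base_vector_charged: "base_vector t x \<Longrightarrow> charged t 0 x"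
proof -
  assume "base_vector t x"
  then obtain M where M: "set_mset M \<subseteq> {0}" "x = single (t, M) 1"
    by (auto simp: base_vector_def)
  from M(1) have "mset_level M = 0"
    by (induction M) auto
  thus ?thesis unfolding M(2) by (rule charged_single)
qed

text \<open>The annihilation half fixes a base vector, so only j = 0 survives.\<close>

lemma exp_mode_base:
  assumes "base_vector t x" "2 * of_nat p * r * t = of_int \<nu>"
  shows "exp_mode p r n x = exp_vec r * exp_neg p r (- n - 1 - \<nu>) x"
proof -
  have "exp_op p r N x = exp_vec r * exp_neg p r N x" for N
    unfolding exp_op_def
    by (subst Sum_any_lessThan[of 1])
       (auto simp: exp_pos_base[OF assms(1)] exp_pos_0 clin_0[OF clin_exp_neg])
  thus ?thesis
    by (simp add: exp_mode_charged[OF base_vector_charged[OF assms(1)]] assms(2))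
qed

lemma exp_mode_creates: "creates (exp_vec 0) (exp_mode p r) (exp_vec r)"
proof -
  have "exp_mode p r n (exp_vec 0) = exp_vec r * exp_neg p r (- n - 1) (exp_vec 0)" for n
    using exp_mode_base[OF base_vector_exp_vec, of p r 0 0 n] by simp
  moreover have "exp_vec r * exp_vec 0 = exp_vec r"
    by (simp add: exp_vec_def mult_single plus_prod_def)
  ultimately show ?thesis
    unfolding creates_def by (simp add: exp_neg_0) (simp add: exp_neg_def)
qed

section \<open>Translation operator\<close>

lemma field_heis: "field_on (heis p)"
proof (rule field_onI)
  fix k :: fock_key
  obtain s M where k: "k = (s, M)" by (cases k)
  have ch: "charged s (mset_level M) (single k 1)" unfolding k by (rule charged_single) simp
  have "heis p n (single k 1) = 0" if "n \<ge> 1 + \<lceil>mset_level M\<rceil>" for n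
  proof -
    have "mset_level M < of_int n" using that by linarith
    thus ?thesis by (intro charged_negative[OF charged_heis[OF ch]]) simp
  qed
  thus "\<exists>N. \<forall>n\<ge>N. heis p n (single k 1) = 0" by blast
qed simp

lemma heis_creates: "creates (exp_vec 0) (heis p) (heis p (- 1) (exp_vec 0))"
  unfolding creates_def
proof (intro conjI allI impI refl)
  fix n :: int assume "n \<ge> 0"
  thus "heis p n (exp_vec 0) = 0"
    using base_vector_heis(1)[OF base_vector_exp_vec[of 0], of n p] base_vector_heis(2)[OF base_vector_exp_vec[of 0], of p]
    by (cases "n = 0") auto
qed

text \<open>This is \<open>L(-1)\<close>, to which the summand \<open>\<alpha>(-2)1\<close> of the conformal vector does not
  contribute.\<close>

definition transl :: "nat \<Rightarrow> fock \<Rightarrow> fock" where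
  "transl p x = (1 / (2 * of_nat p)) *\<^sub>c Sum_any (\<lambda>k::nat. heis p (- int k - 1) (heis p (int k) x))"

lemma heis_eventually:
  obtains K where "\<And>k. k \<ge> K \<Longrightarrow> heis p (int k) x = 0"
proof -
  obtain L where "\<And>n. n \<ge> L \<Longrightarrow> heis p n x = 0" using field_below[OF field_heis] by blast
  thus ?thesis by (intro that[of "nat L"]) simp
qed

lemma clin_transl: "clin (transl p)"
  unfolding transl_def[abs_def]
proof (intro clin_scale_fun clin_Sum_any_fun)
  fix x
  obtain K where "\<And>k. k \<ge> K \<Longrightarrow> heis p (int k) x = 0" using heis_eventually by blast
  thus "\<exists>N. \<forall>i\<ge>N. heis p (- int i - 1) (heis p (int i) x) = 0"
    by (intro exI[of _ K]) (simp add: clin_0[OF clin_heis])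
qed (rule clin_comp[OF clin_heis clin_heis])

lemma transl_cov_heis:
  assumes "p > 0"
  shows "transl_cov (transl p) (heis p)"
  unfolding transl_cov_def
proof (intro allI)
  fix j x
  obtain K where K: "\<And>k. k \<ge> K \<Longrightarrow> heis p (int k) x = 0" using heis_eventually by blast
  obtain L where L: "\<And>k. k \<ge> L \<Longrightarrow> heis p (int k) (heis p j x) = 0" using heis_eventually by blast
  let ?f = "\<lambda>k x. heis p (- int k - 1) (heis p (int k) x)"
  \<comment> \<open>The only summand of \<open>transl\<close> that can fail to commute with
    \<alpha>(j): for j <= 0 through its inner factor \<alpha>(-j), for j > 0 through its creator
    \<alpha>(-j).\<close>
  define a where "a = nat (if j \<le> 0 then - j else j - 1)"
  have "?f k (heis p j x) - heis p j (?f k x) = (if k = a then (- (2 * of_nat p * of_int j)) *\<^sub>c heis p (j - 1) x else 0)" for k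
  proof -
    have 1: "?f k (heis p j x) = heis p j (?f k x) +
        (if - int k - 1 + j = 0 then 2 * of_nat p * of_int (- int k - 1) else 0) *\<^sub>c heis p (int k) x +
        (if int k + j = 0 then 2 * of_nat p * of_int (int k) else 0) *\<^sub>c heis p (- int k - 1) x"
      unfolding heis_comm[of p "int k" j] clin_add[OF clin_heis] clin_scale[OF clin_heis]
        heis_comm[of p "- int k - 1" j] ..
    show ?thesis
    proof (cases "j \<le> 0")
      case True
      show ?thesis
      proof (cases "k = a")
        case True
        hence "int k = - j" using \<open>j \<le> 0\<close> by (simp add: a_def)
        thus ?thesis unfolding 1 using True \<open>j \<le> 0\<close> by simp
      next
        case False
        hence "int k + j \<noteq> 0" using True by (auto simp: a_def)
        thus ?thesis unfolding 1 using False True by simp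
      qed
    next
      case j: False
      show ?thesis
      proof (cases "k = a")
        case True
        hence "int k = j - 1" using j by (simp add: a_def)
        thus ?thesis unfolding 1 using True j by simp
      next
        case False
        hence "- int k - 1 + j \<noteq> 0" using j by (auto simp: a_def)
        thus ?thesis unfolding 1 using False j by simp
      qed
    qed
  qed
  hence *: "Sum_any (\<lambda>k. ?f k (heis p j x) - heis p j (?f k x)) = (- (2 * of_nat p * of_int j)) *\<^sub>c heis p (j - 1) x"
    by simp
  have "Sum_any (\<lambda>k. ?f k (heis p j x) - heis p j (?f k x)) =
      Sum_any (\<lambda>k. ?f k (heis p j x)) - Sum_any (\<lambda>k. heis p j (?f k x))"
    by (rule Sum_any_diff_nat[of L _ K]) (simp_all add: K L clin_0[OF clin_heis])
  also have "Sum_any (\<lambda>k. heis p j (?f k x)) = heis p j (Sum_any (\<lambda>k. ?f k x))"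
    by (rule clin_Sum_any_nat[of _ K, symmetric]) (simp_all add: K clin_0[OF clin_heis])
  finally have "transl p (heis p j x) - heis p j (transl p x) =
     (1 / (2 * of_nat p)) *\<^sub>c ((- (2 * of_nat p * of_int j)) *\<^sub>c heis p (j - 1) x)"
    unfolding transl_def clin_scale[OF clin_heis] cvec.scale_right_diff_distrib[symmetric] * by simp
  also have "\<dots> = - of_int j *\<^sub>c heis p (j - 1) x"
    using assms by (simp add: mult.commute)
  finally show "transl p (heis p j x) - heis p j (transl p x) = - of_int j *\<^sub>c heis p (j - 1) x" .
qed

lemma transl_base:
  assumes "p > 0" "base_vector t x"
  shows "transl p x = of_rat t *\<^sub>c heis p (- 1) x"
proof -
  have "Sum_any (\<lambda>k::nat. heis p (- int k - 1) (heis p (int k) x)) = (2 * of_nat p * of_rat t) *\<^sub>c heis p (- 1) x"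
    by (subst Sum_any_lessThan[of 1])
       (simp_all add: base_vector_heis[OF assms(2)] clin_0[OF clin_heis] clin_scale[OF clin_heis])
  thus ?thesis using assms(1) by (simp add: transl_def)
qed

lemma transl_vacuum: "p > 0 \<Longrightarrow> transl p (exp_vec 0) = 0"
  using transl_base[OF _ base_vector_exp_vec, of p 0] by simp

lemma exp_neg_Suc_rec:
  "of_nat (Suc i) *\<^sub>c exp_neg p r (int (Suc i)) x = of_rat r *\<^sub>c heis p (- 1) (exp_neg p r (int i) x) +
     (\<Sum>k\<in>{1..i}. of_rat r *\<^sub>c heis p (- int k - 1) (exp_neg p r (int (i - k)) x))"
proof -
  have "of_nat (Suc i) *\<^sub>c exp_neg p r (int (Suc i)) x =
     (\<Sum>k\<in>{Suc 0..Suc i}. of_rat r *\<^sub>c heis p (- int k) (exp_neg p r (int (Suc i) - int k) x))"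
    unfolding exp_neg_rec One_nat_def ..
  also have "\<dots> = (\<Sum>k\<in>{0..i}. of_rat r *\<^sub>c heis p (- int (Suc k)) (exp_neg p r (int (Suc i) - int (Suc k)) x))"
    by (rule sum.shift_bounds_cl_Suc_ivl)
  also have "\<dots> = (\<Sum>k\<in>{0..i}. of_rat r *\<^sub>c heis p (- int k - 1) (exp_neg p r (int (i - k)) x))"
  proof (rule sum.cong[OF refl])
    fix k assume "k \<in> {0..i}"
    hence "- int (Suc k) = - int k - 1" "int (Suc i) - int (Suc k) = int (i - k)" by auto
    thus "of_rat r *\<^sub>c heis p (- int (Suc k)) (exp_neg p r (int (Suc i) - int (Suc k)) x) =
       of_rat r *\<^sub>c heis p (- int k - 1) (exp_neg p r (int (i - k)) x)" by (simp only:)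
  qed
  also have "\<dots> = of_rat r *\<^sub>c heis p (- 1) (exp_neg p r (int i) x) +
     (\<Sum>k\<in>{1..i}. of_rat r *\<^sub>c heis p (- int k - 1) (exp_neg p r (int (i - k)) x))"
    by (subst sum.atLeast_Suc_atMost) simp_all
  finally show ?thesis .
qed

lemma exp_neg_rec':
  "of_nat i *\<^sub>c exp_neg p r (int i) x = (\<Sum>k\<in>{1..i}. of_rat r *\<^sub>c heis p (- int k) (exp_neg p r (int (i - k)) x))"
  unfolding exp_neg_rec by (intro sum.cong refl) (simp add: of_nat_diff)

text \<open>T y = s\<alpha>(-1) y, and [T, r\<alpha>(-k)/k] = r\<alpha>(-k-1), so commuting T with
  the exponential multiplies it by \<Sum>k\<ge>1. r\<alpha>(-k-1) x^k.\<close>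

lemma transl_exp_neg_sum:
  assumes p: "p > 0" and y: "base_vector s y"
  shows "transl p (exp_neg p r (int i) y) = of_rat s *\<^sub>c heis p (- 1) (exp_neg p r (int i) y) +
     (\<Sum>k\<in>{1..i}. of_rat r *\<^sub>c heis p (- int k - 1) (exp_neg p r (int (i - k)) y))"
proof (induction i rule: less_induct)
  case (less i)
  let ?E = "\<lambda>i. exp_neg p r (int i) y" and ?\<alpha> = "heis p"
  note T = transl_covD[OF transl_cov_heis[OF p]]
  note lin = clin_add[OF clin_heis] clin_scale[OF clin_heis] clin_sum[OF clin_heis]
  show ?case
  proof (cases "i = 0")
    case True
    thus ?thesis using transl_base[OF p y] by (simp add: exp_neg_0)
  next
    case False
    have "of_nat i *\<^sub>c transl p (?E i) = (\<Sum>k\<in>{1..i}. of_rat r *\<^sub>c transl p (?\<alpha> (- int k) (?E (i - k))))"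
      unfolding clin_scale[OF clin_transl, symmetric] exp_neg_rec' clin_sum[OF clin_transl] ..
    also have "\<dots> = (\<Sum>k\<in>{1..i}. of_rat s *\<^sub>c ?\<alpha> (- 1) (of_rat r *\<^sub>c ?\<alpha> (- int k) (?E (i - k))) +
        (\<Sum>l\<in>{1..i - k}. of_rat r *\<^sub>c ?\<alpha> (- int l - 1) (of_rat r *\<^sub>c ?\<alpha> (- int k) (?E (i - k - l)))) +
        of_nat k *\<^sub>c of_rat r *\<^sub>c ?\<alpha> (- int k - 1) (?E (i - k)))"
    proof (rule sum.cong[OF refl])
      fix k assume k: "k \<in> {1..i}"
      have c: "?\<alpha> (- int k) (?\<alpha> (- int l - 1) z) = ?\<alpha> (- int l - 1) (?\<alpha> (- int k) z)" for l z
        by (subst heis_comm) simp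
      have c1: "?\<alpha> (- int k) (?\<alpha> (- 1) z) = ?\<alpha> (- 1) (?\<alpha> (- int k) z)" for z
        using c[of 0 z] by simp
      have "transl p (?\<alpha> (- int k) (?E (i - k))) =
          ?\<alpha> (- int k) (transl p (?E (i - k))) + of_nat k *\<^sub>c ?\<alpha> (- int k - 1) (?E (i - k))"
        unfolding T by simp
      also have "transl p (?E (i - k)) = of_rat s *\<^sub>c ?\<alpha> (- 1) (?E (i - k)) +
          (\<Sum>l\<in>{1..i - k}. of_rat r *\<^sub>c ?\<alpha> (- int l - 1) (?E (i - k - l)))"
        using k by (intro less) auto
      finally show "of_rat r *\<^sub>c transl p (?\<alpha> (- int k) (?E (i - k))) =
          of_rat s *\<^sub>c ?\<alpha> (- 1) (of_rat r *\<^sub>c ?\<alpha> (- int k) (?E (i - k))) +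
          (\<Sum>l\<in>{1..i - k}. of_rat r *\<^sub>c ?\<alpha> (- int l - 1) (of_rat r *\<^sub>c ?\<alpha> (- int k) (?E (i - k - l)))) +
          of_nat k *\<^sub>c of_rat r *\<^sub>c ?\<alpha> (- int k - 1) (?E (i - k))"
        by (simp add: lin c c1 cvec.scale_right_distrib cvec.scale_sum_right mult.commute mult.left_commute)
    qed
    also have "\<dots> = of_rat s *\<^sub>c ?\<alpha> (- 1) (of_nat i *\<^sub>c ?E i) +
        ((\<Sum>k\<in>{1..i}. \<Sum>l\<in>{1..i - k}. of_rat r *\<^sub>c ?\<alpha> (- int l - 1) (of_rat r *\<^sub>c ?\<alpha> (- int k) (?E (i - k - l)))) +
         (\<Sum>k\<in>{1..i}. of_nat k *\<^sub>c of_rat r *\<^sub>c ?\<alpha> (- int k - 1) (?E (i - k))))"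
      unfolding sum.distrib exp_neg_rec' clin_sum[OF clin_heis] cvec.scale_sum_right add.assoc ..
    also have "(\<Sum>k\<in>{1..i}. \<Sum>l\<in>{1..i - k}. of_rat r *\<^sub>c ?\<alpha> (- int l - 1) (of_rat r *\<^sub>c ?\<alpha> (- int k) (?E (i - k - l)))) =
        (\<Sum>l\<in>{1..i}. \<Sum>k\<in>{1..i - l}. of_rat r *\<^sub>c ?\<alpha> (- int l - 1) (of_rat r *\<^sub>c ?\<alpha> (- int k) (?E (i - k - l))))"
      by (rule sum_triangle_swap)
    also have "\<dots> = (\<Sum>l\<in>{1..i}. of_nat (i - l) *\<^sub>c of_rat r *\<^sub>c ?\<alpha> (- int l - 1) (?E (i - l)))"
    proof (rule sum.cong[OF refl])
      fix l
      have "(\<Sum>k\<in>{1..i - l}. of_rat r *\<^sub>c ?\<alpha> (- int l - 1) (of_rat r *\<^sub>c ?\<alpha> (- int k) (?E (i - k - l)))) =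
          of_rat r *\<^sub>c ?\<alpha> (- int l - 1) (\<Sum>k\<in>{1..i - l}. of_rat r *\<^sub>c ?\<alpha> (- int k) (?E (i - l - k)))"
        unfolding clin_sum[OF clin_heis] cvec.scale_sum_right by (simp add: diff_diff_eq add.commute)
      also have "\<dots> = of_rat r *\<^sub>c ?\<alpha> (- int l - 1) (of_nat (i - l) *\<^sub>c ?E (i - l))"
        unfolding exp_neg_rec' ..
      finally show "(\<Sum>k\<in>{1..i - l}. of_rat r *\<^sub>c ?\<alpha> (- int l - 1) (of_rat r *\<^sub>c ?\<alpha> (- int k) (?E (i - k - l)))) =
          of_nat (i - l) *\<^sub>c of_rat r *\<^sub>c ?\<alpha> (- int l - 1) (?E (i - l))"
        by (simp add: lin mult.commute)
    qed
    also have "(\<Sum>l\<in>{1..i}. of_nat (i - l) *\<^sub>c of_rat r *\<^sub>c ?\<alpha> (- int l - 1) (?E (i - l))) +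
         (\<Sum>k\<in>{1..i}. of_nat k *\<^sub>c of_rat r *\<^sub>c ?\<alpha> (- int k - 1) (?E (i - k))) =
         of_nat i *\<^sub>c (\<Sum>k\<in>{1..i}. of_rat r *\<^sub>c ?\<alpha> (- int k - 1) (?E (i - k)))"
      unfolding sum.distrib[symmetric] cvec.scale_left_distrib[symmetric] cvec.scale_sum_right
      by (intro sum.cong refl) (simp add: of_nat_diff)
    finally have eq: "of_nat i *\<^sub>c transl p (?E i) = of_nat i *\<^sub>c (of_rat s *\<^sub>c ?\<alpha> (- 1) (?E i) +
        (\<Sum>k\<in>{1..i}. of_rat r *\<^sub>c ?\<alpha> (- int k - 1) (?E (i - k))))"
      by (simp only: lin cvec.scale_right_distrib cvec.scale_scale mult.commute)
    show ?thesis
      by (rule cscale_nat_cancel[OF eq]) (use False in simp)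
  qed
qed

text \<open>With s = r + t the part r\<alpha>(-1) supplies the missing summand k = 0, and the
  completed sum times the exponential is its x-derivative.\<close>

lemma transl_exp_neg:
  assumes p: "p > 0" and y: "base_vector (r + t) y"
  shows "transl p (exp_neg p r i y) = of_rat t *\<^sub>c heis p (- 1) (exp_neg p r i y) +
     of_int (i + 1) *\<^sub>c exp_neg p r (i + 1) y"
proof (cases "i \<ge> 0")
  case True
  then obtain n where n: "i = int n" using nonneg_int_cases by blast
  have "of_int (i + 1) *\<^sub>c exp_neg p r (i + 1) y = of_nat (Suc n) *\<^sub>c exp_neg p r (int (Suc n)) y"
    by (simp add: n add.commute)
  thus ?thesis
    unfolding n transl_exp_neg_sum[OF p y] exp_neg_Suc_rec of_rat_add cvec.scale_left_distrib
    by (simp add: algebra_simps)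
next
  case False
  hence "i = - 1 \<or> exp_neg p r (i + 1) y = 0" by (auto simp: exp_neg_def)
  hence "of_int (i + 1) = (0 :: complex) \<or> exp_neg p r (i + 1) y = 0" by auto
  hence "of_int (i + 1) *\<^sub>c exp_neg p r (i + 1) y = 0" unfolding cvec.scale_eq_0_iff .
  moreover have "exp_neg p r i y = 0" using False by (simp add: exp_neg_def)
  ultimately show ?thesis by (simp only: clin_0[OF clin_heis] clin_0[OF clin_transl] cvec.scale_zero_right add_0_left)
qed

lemma exp_vec_exp_neg: "exp_vec s * exp_neg p r i x = exp_neg p r i (exp_vec s * x)"
proof (cases "i < 0")
  case False
  have "exp_vec s * ((of_rat r / of_nat k) *\<^sub>c heis p (- int k) x) =
     (of_rat r / of_nat k) *\<^sub>c heis p (- int k) (exp_vec s * x)" if "k > 0" for k x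
    using that by (simp add: heis_exp_vec clin_scale[OF clin_mult_left])
  from exp_coeff_comm[OF heis_family_clin heis_family_comm(1) clin_mult_left this, where i = "nat i" and w = x]
  show ?thesis using False by (simp add: exp_neg_def)
qed (simp add: exp_neg_def)

lemma exp_neg_comm: "exp_neg p s j (exp_neg p r i x) = exp_neg p r i (exp_neg p s j x)"
proof (cases "i < 0")
  case False
  have "exp_neg p s j ((of_rat r / of_nat k) *\<^sub>c heis p (- int k) x) =
     (of_rat r / of_nat k) *\<^sub>c heis p (- int k) (exp_neg p s j x)" if "k > 0" for k x
    using that by (simp add: heis_exp_neg_nonpos clin_scale[OF clin_exp_neg])
  from exp_coeff_comm[OF heis_family_clin heis_family_comm(1) clin_exp_neg this, where i = "nat i" and w = x]
  show ?thesis using False by (simp add: exp_neg_def[of p r])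
qed (simp add: exp_neg_def[of p r] clin_0[OF clin_exp_neg])

lemma base_vector_exp_vec_mult: "base_vector t x \<Longrightarrow> base_vector (r + t) (exp_vec r * x)"
  unfolding base_vector_def by (auto simp: exp_vec_def mult_single plus_prod_def)

lemma exp_mode_heis:
  "exp_mode p r n (heis p l x) = heis p l (exp_mode p r n x) - (2 * of_nat p * of_rat r) *\<^sub>c exp_mode p r (n + l) x"
  by (simp add: heis_exp_mode)

lemma transl_cov_exp_mode:
  assumes p: "p > 0"
  shows "transl_cov (transl p) (exp_mode p r)"
proof -
  define Z where "Z = (\<lambda>n x. transl p (exp_mode p r n x) - exp_mode p r n (transl p x) + of_int n *\<^sub>c exp_mode p r (n - 1) x)"
  note lin = clin_add[OF clin_heis] clin_scale[OF clin_heis] clin_diff[OF clin_heis]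
    clin_add[OF clin_exp_mode] clin_scale[OF clin_exp_mode] clin_diff[OF clin_exp_mode]
    clin_add[OF clin_transl] clin_scale[OF clin_transl] clin_diff[OF clin_transl]
  have "Z n x = 0" for n x
  proof (rule fock_generated[where Z = Z])
    fix n show "clin (Z n)"
      unfolding Z_def
      by (rule clin_plus[OF clin_minus_fun[OF clin_comp[OF clin_transl clin_exp_mode] clin_comp[OF clin_exp_mode clin_transl]]
            clin_scale_fun[OF clin_exp_mode]])
  next
    fix n t x assume x: "base_vector t x"
    show "Z n x = 0"
    proof (cases "2 * of_nat p * r * t \<in> \<int>")
      case True
      then obtain \<nu> where \<nu>: "2 * of_nat p * r * t = of_int \<nu>" by (auto elim: Ints_cases)
      have \<nu>': "2 * of_nat p * of_rat r * of_rat t = (of_int \<nu> :: complex)"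
        using arg_cong[OF \<nu>, of "of_rat :: rat \<Rightarrow> complex"] by (simp add: of_rat_mult)
      define y where "y = exp_vec r * x"
      have y: "base_vector (r + t) y" unfolding y_def by (rule base_vector_exp_vec_mult[OF x])
      define i where "i = - n - 1 - \<nu>"
      have "- (n - 1) - 1 - \<nu> = i + 1" by (simp add: i_def)
      hence e: "exp_mode p r n x = exp_neg p r i y" "exp_mode p r (n - 1) x = exp_neg p r (i + 1) y"
        unfolding exp_mode_base[OF x \<nu>] y_def exp_vec_exp_neg by (simp_all only: i_def)
      \<comment> \<open>Moving \<alpha>(-1) through the mode costs 2pr, and 2prt = \<nu>. The total
        coefficient (i + 1) + \<nu> + n is 0 by the choice of i.\<close>
      have "exp_mode p r n (transl p x) = of_rat t *\<^sub>c heis p (- 1) (exp_neg p r i y) -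
         (of_rat t * (2 * of_nat p * of_rat r)) *\<^sub>c exp_neg p r (i + 1) y"
        unfolding transl_base[OF p x] lin exp_mode_heis by (simp add: e cvec.scale_right_diff_distrib)
      also have "of_rat t * (2 * of_nat p * of_rat r) = (of_int \<nu> :: complex)"
        using \<nu>' by (simp add: mult_ac)
      finally have "Z n x = of_int (i + 1) *\<^sub>c exp_neg p r (i + 1) y + of_int \<nu> *\<^sub>c exp_neg p r (i + 1) y +
         of_int n *\<^sub>c exp_neg p r (i + 1) y"
        unfolding Z_def e transl_exp_neg[OF p y] by simp
      also have "\<dots> = of_int (i + 1 + \<nu> + n) *\<^sub>c exp_neg p r (i + 1) y"
        by (simp only: of_int_add cvec.scale_left_distrib)
      finally show ?thesis by (simp add: i_def)
    next
      case False
      have ch: "charged t 0 x" by (rule base_vector_charged[OF x])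
      show ?thesis using False
        unfolding Z_def transl_base[OF p x] lin exp_mode_charged[OF ch] exp_mode_charged[OF charged_heis[OF ch]]
        by (simp add: clin_0[OF clin_transl])
    qed
  next
    fix n and k :: nat and x :: fock assume k: "k > 0" and IH: "\<And>n. Z n x = 0"
    let ?c = "2 * of_nat p * of_rat r :: complex"
    have i: "n + - int k = n - int k" "n - 1 + - int k = n - int k - 1" "n + (- int k - 1) = n - int k - 1"
      by simp_all
    \<comment> \<open>Z has the same commutator with \<alpha>(-k) as the modes. It shifts n by -k,
      so the induction must cover all n at once.\<close>
    have "Z n (heis p (- int k) x) = heis p (- int k) (Z n x) - ?c *\<^sub>c Z (n - int k) x"
      unfolding Z_def exp_mode_heis transl_covD[OF transl_cov_heis[OF p]] lin i
      by (intro poly_mapping_eqI) (simp add: lookup_add lookup_minus algebra_simps)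
    thus "Z n (heis p (- int k) x) = 0"
      by (simp add: IH clin_0[OF clin_heis])
  qed
  hence "transl p (exp_mode p r n x) - exp_mode p r n (transl p x) = - of_int n *\<^sub>c exp_mode p r (n - 1) x" for n x
    unfolding Z_def by (simp add: eq_neg_iff_add_eq_0)
  thus ?thesis unfolding transl_cov_def by blast
qed

section \<open>Locality\<close>

text \<open>The commutator is 2p times a derivative of the delta distribution, hence of order
  2.\<close>

lemma local_heis_heis: "local_pair (heis p) (heis p)"
  unfolding local_pair_def
proof (intro exI[of _ 2] allI ext)
  fix w and m k :: int
  define f where "f = (\<lambda>m k. heis p m (heis p k w) - heis p k (heis p m w))"
  have f: "f m k = (if m + k = 0 then 2 * of_nat p * of_int m else 0) *\<^sub>c w" for m k
    unfolding f_def by (subst heis_comm) simp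
  have d: "dlt f m k = (if m + k + 1 = 0 then 2 * of_nat p else 0) *\<^sub>c w" for m k
  proof (cases "m + k + 1 = 0")
    case True
    hence "m + 1 + k = 0" "m + (k + 1) = 0" by simp_all
    thus ?thesis
      unfolding dlt_def f using True by (simp add: distrib_left cvec.scale_left_distrib)
  next
    case False
    hence "m + 1 + k \<noteq> 0" "m + (k + 1) \<noteq> 0" by simp_all
    thus ?thesis unfolding dlt_def f using False by simp
  qed
  have "m + 1 + k + 1 = m + (k + 1) + 1" by simp
  hence "dlt (dlt f) m k = 0" unfolding dlt_def[of "dlt f"] d by (simp only: diff_self)
  thus "(dlt ^^ 2) (\<lambda>m k. heis p m (heis p k w) - heis p k (heis p m w)) m k = 0"
    by (simp add: numeral_2_eq_2 f_def)
qed

text \<open>The commutator is 2pr times the exponential times the delta distribution, hence of order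
  1.\<close>

lemma local_heis_exp: "local_pair (heis p) (exp_mode p r)"
  unfolding local_pair_def
proof (intro exI[of _ 1] allI ext)
  fix w m k
  have "(\<lambda>m k. heis p m (exp_mode p r k w) - exp_mode p r k (heis p m w)) =
     (\<lambda>m k. (2 * of_nat p * of_rat r) *\<^sub>c exp_mode p r (k + m) w)"
    by (intro ext) (simp add: heis_exp_mode)
  thus "(dlt ^^ 1) (\<lambda>m k. heis p m (exp_mode p r k w) - exp_mode p r k (heis p m w)) m k = 0"
    by (simp add: dlt_def algebra_simps)
qed

text \<open>Moving the annihilation half in x past the creation half in z yields the factor (1 -
  z/x)^c with c = 2prs, and on a base vector the annihilation half then disappears. The recursion
  for \<open>exp_pos\<close> reduces this to a partial alternating sum of binomials.\<close>

lemma exp_pos_exp_neg: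
  assumes y: "base_vector t y" and c: "2 * of_nat p * r * s = of_int c"
  shows "exp_pos p r j (exp_neg p s i y) = ((- 1) ^ j * (of_int c gchoose j)) *\<^sub>c exp_neg p s (i - int j) y"
proof (induction j rule: less_induct)
  case (less j)
  show ?case
  proof (cases j)
    case 0 thus ?thesis by (simp add: exp_pos_0)
  next
    case (Suc l)
    have c': "of_rat r * (2 * of_nat p * of_rat s) = (of_int c :: complex)"
      using arg_cong[OF c, of "of_rat :: rat \<Rightarrow> complex"]
      by (simp add: of_rat_mult mult_ac)
    have \<alpha>: "heis p (int k) (exp_neg p s i y) = (2 * of_nat p * of_rat s) *\<^sub>c exp_neg p s (i - int k) y"
      if "k > 0" for k i
      using that by (simp add: heis_exp_neg base_vector_heis(1)[OF y] clin_0[OF clin_exp_neg])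
    let ?b = "\<lambda>j. (- 1) ^ j * (of_int c gchoose j) :: complex"
    have "of_nat j *\<^sub>c exp_pos p r j (exp_neg p s i y) =
       (\<Sum>k\<in>{1..j}. (- of_int c * ?b (j - k)) *\<^sub>c exp_neg p s (i - int j) y)"
      unfolding exp_pos_rec
    proof (rule sum.cong[OF refl])
      fix k assume k: "k \<in> {1..j}"
      have "i - int (j - k) - int k = i - int j" using k by (simp add: of_nat_diff)
      thus "(- of_rat r) *\<^sub>c heis p (int k) (exp_pos p r (j - k) (exp_neg p s i y)) =
          (- of_int c * ?b (j - k)) *\<^sub>c exp_neg p s (i - int j) y"
        using k by (subst less) (simp_all add: clin_scale[OF clin_heis] \<alpha> c'[symmetric] mult_ac)
    qed
    also have "\<dots> = (- of_int c * (\<Sum>k\<in>{1..j}. ?b (j - k))) *\<^sub>c exp_neg p s (i - int j) y"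
      by (simp add: cvec.scale_sum_left sum_distrib_left)
    also have "(\<Sum>k\<in>{1..j}. ?b (j - k)) = (\<Sum>k\<le>l. (of_int c gchoose k) * (- 1) ^ k)"
      by (rule sum.reindex_bij_witness[of _ "\<lambda>k. j - k" "\<lambda>k. j - k"]) (auto simp: Suc mult.commute)
    also have "\<dots> = (- 1) ^ l * (of_int c - 1 gchoose l)"
      by (rule gbinomial_sum_lower_neg)
    also have "- of_int c * ((- 1) ^ l * (of_int c - 1 gchoose l)) = of_nat j * ?b j"
      using gbinomial_absorption[of l "of_int c :: complex"] by (simp add: Suc del: of_nat_Suc)
    finally have eq: "of_nat j *\<^sub>c exp_pos p r j (exp_neg p s i y) = of_nat j *\<^sub>c ?b j *\<^sub>c exp_neg p s (i - int j) y"
      by simp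
    show ?thesis by (rule cscale_nat_cancel[OF eq]) (simp add: Suc)
  qed
qed

text \<open>Coefficients of the normally ordered product of \<open>e\<^bsup>r\<alpha>\<^esup>\<close> and \<open>e\<^bsup>s\<alpha>\<^esup>\<close>. The operator products in
  the two orders are its multiples by \<open>(x - y)\<^bsup>2prs\<^esup>\<close>, expanded in the two regions.\<close>

definition normal_exp :: "nat \<Rightarrow> rat \<Rightarrow> rat \<Rightarrow> int \<Rightarrow> int \<Rightarrow> fock \<Rightarrow> int \<Rightarrow> int \<Rightarrow> fock" where
  "normal_exp p r s \<nu> \<mu> x m k = exp_vec r * exp_neg p r (- m - 1 - \<nu>) (exp_vec s * exp_neg p s (- k - 1 - \<mu>) x)"

lemma normal_exp_sym: "normal_exp p r s \<nu> \<mu> x m k = normal_exp p s r \<mu> \<nu> x k m"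
  unfolding normal_exp_def exp_vec_exp_neg by (simp add: exp_neg_comm[of p s] mult_ac)

lemma normal_exp_below2: "below2 (- \<mu>) (normal_exp p r s \<nu> \<mu> x)"
proof -
  have "exp_neg p s (- k - 1 - \<mu>) x = 0" if "k \<ge> - \<mu>" for k
    using that by (simp add: exp_neg_def)
  thus ?thesis by (simp add: below2_def normal_exp_def clin_0[OF clin_exp_neg])
qed

lemma exp_mode_exp_mode_base:
  assumes x: "base_vector t x" and c: "2 * of_nat p * r * s = of_int c"
    and \<nu>: "2 * of_nat p * r * t = of_int \<nu>" and \<mu>: "2 * of_nat p * s * t = of_int \<mu>"
  shows "exp_mode p r m (exp_mode p s k x) = expand_xy c (normal_exp p r s \<nu> \<mu> x) m k"
proof -
  define y where "y = exp_vec s * x"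
  have y: "base_vector (s + t) y" unfolding y_def by (rule base_vector_exp_vec_mult[OF x])
  have e: "exp_mode p s k x = exp_neg p s (- k - 1 - \<mu>) y"
    unfolding exp_mode_base[OF x \<mu>] y_def exp_vec_exp_neg ..
  have ch: "charged (s + t) (0 + of_int (- k - 1 - \<mu>)) (exp_neg p s (- k - 1 - \<mu>) y)"
    by (rule charged_exp_neg[OF base_vector_charged[OF y]])
  have int: "2 * of_nat p * r * (s + t) = of_int (c + \<nu>)"
    by (simp add: distrib_left c \<nu>)
  have "exp_mode p r m (exp_mode p s k x) = exp_op p r (- m - 1 - (c + \<nu>)) (exp_neg p s (- k - 1 - \<mu>) y)"
    unfolding e exp_mode_charged[OF ch] int by simp
  also have "\<dots> = expand_xy c (normal_exp p r s \<nu> \<mu> x) m k"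
    unfolding exp_op_def expand_xy_def normal_exp_def exp_pos_exp_neg[OF y c] clin_scale[OF clin_exp_neg]
      clin_scale[OF clin_mult_left] exp_vec_exp_neg[of s p s] y_def[symmetric]
    by (simp add: algebra_simps)
  finally show ?thesis .
qed

lemma dlt_funpow_shift:
  "(dlt ^^ N) (\<lambda>m k. f (m + a) (k + b)) = (\<lambda>m k. (dlt ^^ N) f (m + a) (k + b))"
  by (induction N) (simp_all add: dlt_def fun_eq_iff algebra_simps)

lemma local_exp_exp:
  assumes c: "2 * of_nat p * r * s = of_int c" and ev: "even c"
  shows "local_pair (exp_mode p r) (exp_mode p s)"
proof -
  \<comment> \<open>(x - y)^N clears a possible pole of (x - y)^c, after which both expansions are
    the same polynomial.\<close>
  define N where "N = nat (- c)"
  define C where "C = (\<lambda>x m k. exp_mode p r m (exp_mode p s k x) - exp_mode p s k (exp_mode p r m x))"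
  have Clin: "clin (\<lambda>x. C x m k)" for m k
    unfolding C_def by (rule clin_minus_fun[OF clin_comp[OF clin_exp_mode clin_exp_mode] clin_comp[OF clin_exp_mode clin_exp_mode]])
  have "(\<lambda>(m, k) x. (dlt ^^ N) (C x) m k) mk x = 0" for mk x
  proof (rule fock_generated[where Z = "\<lambda>(m, k) x. (dlt ^^ N) (C x) m k"])
    fix mk :: "int \<times> int"
    have "clin (\<lambda>x. (dlt ^^ M) (C x) m k)" for M m k
    proof (induction M arbitrary: m k)
      case 0 thus ?case using Clin by simp
    next
      case (Suc M) thus ?case by (simp add: dlt_def clin_minus_fun)
    qed
    thus "clin ((\<lambda>(m, k) x. (dlt ^^ N) (C x) m k) mk)" by (cases mk) simp
  next
    fix mk t x assume x: "base_vector t x"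
    have "(dlt ^^ N) (C x) = (\<lambda>m k. 0)"
    proof (cases "2 * of_nat p * r * t \<in> \<int> \<and> 2 * of_nat p * s * t \<in> \<int>")
      case True
      then obtain \<nu> \<mu> where \<nu>: "2 * of_nat p * r * t = of_int \<nu>" and \<mu>: "2 * of_nat p * s * t = of_int \<mu>"
        by (auto elim!: Ints_cases)
      let ?\<Phi> = "normal_exp p r s \<nu> \<mu> x"
      have c': "2 * of_nat p * s * r = of_int c" using c by (simp add: mult_ac)
      \<comment> \<open>(x - y)^c = (y - x)^c for even c; an odd c would give locality of
        anticommutators instead.\<close>
      have pw: "(- 1 :: complex) powi c = 1" using ev by (auto elim!: evenE simp: power_int_mult)
      have b: "below2 (- \<mu>) ?\<Phi>" "below2 (- \<nu>) (\<lambda>a b. ?\<Phi> b a)"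
        using normal_exp_below2[of \<mu> p r s \<nu> x] normal_exp_below2[of \<nu> p s r \<mu> x]
        by (simp_all add: normal_exp_sym[of p r s \<nu> \<mu> x])
      have "C x = (\<lambda>m k. expand_xy c ?\<Phi> m k - expand_yx c ?\<Phi> m k)"
        unfolding C_def exp_mode_exp_mode_base[OF x c \<nu> \<mu>] exp_mode_exp_mode_base[OF x c' \<mu> \<nu>]
          expand_yx_def pw
        by (intro ext) (simp add: normal_exp_sym[of p r s \<nu> \<mu> x, abs_def])
      hence "(dlt ^^ N) (C x) = (\<lambda>m k. expand_xy (c + int N) ?\<Phi> m k - expand_yx (c + int N) ?\<Phi> m k)"
        by (simp add: dlt_funpow_diff expand_xy_funpow[OF b(1)] expand_yx_funpow[OF b(2)])
      moreover have "c + int N = 0 + int (nat c)" by (simp add: N_def)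
      moreover have "expand_xy (0 + int M) ?\<Phi> = expand_yx (0 + int M) ?\<Phi>" for M
        unfolding expand_xy_funpow[OF b(1), symmetric] expand_yx_funpow[OF b(2), symmetric] by simp
      ultimately show ?thesis by (simp only: diff_self)
    next
      case False
      have ch: "charged t 0 x" by (rule base_vector_charged[OF x])
      \<comment> \<open>Acting with one exponential adds the integer c to the exponent of the other,
        so a nonintegral exponent stays nonintegral and both products are 0.\<close>
      have nonint: "a + of_int c \<notin> \<int>" if "a \<notin> \<int>" for a :: rat
        using that Ints_diff[of "a + of_int c" "of_int c"] by auto
      have "exp_mode p r m (exp_mode p s k x) = 0" "exp_mode p s k (exp_mode p r m x) = 0" for m k
      proof -
        show "exp_mode p r m (exp_mode p s k x) = 0"
        proof (cases "2 * of_nat p * s * t \<in> \<int>")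
          case True
          hence "2 * of_nat p * r * t + of_int c \<notin> \<int>" using False nonint by blast
          moreover have "2 * of_nat p * r * t + of_int c = 2 * of_nat p * r * (s + t)"
            by (simp add: distrib_left c)
          ultimately show ?thesis
            unfolding exp_mode_charged[OF charged_exp_mode[OF ch]] by simp
        qed (simp add: exp_mode_charged[OF ch] clin_0[OF clin_exp_mode])
        show "exp_mode p s k (exp_mode p r m x) = 0"
        proof (cases "2 * of_nat p * r * t \<in> \<int>")
          case True
          hence "2 * of_nat p * s * t + of_int c \<notin> \<int>" using False nonint by blast
          moreover have "2 * of_nat p * s * t + of_int c = 2 * of_nat p * s * (r + t)"
            by (simp add: distrib_left c[symmetric] mult_ac)
          ultimately show ?thesis
            unfolding exp_mode_charged[OF charged_exp_mode[OF ch]] by simp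
        qed (simp add: exp_mode_charged[OF ch] clin_0[OF clin_exp_mode])
      qed
      hence "C x = (\<lambda>m k. 0)" by (simp add: C_def)
      thus ?thesis by simp
    qed
    thus "(\<lambda>(m, k) x. (dlt ^^ N) (C x) m k) mk x = 0" by (cases mk) simp
  next
    fix mk :: "int \<times> int" and l :: nat and x :: fock
    assume l: "l > 0" and IH: "\<And>mk. (\<lambda>(m, k) x. (dlt ^^ N) (C x) m k) mk x = 0"
    have IH': "(dlt ^^ N) (C x) = (\<lambda>m k. 0)" using IH by (auto simp: fun_eq_iff)
    let ?cr = "2 * of_nat p * of_rat r :: complex" and ?cs = "2 * of_nat p * of_rat s :: complex"
    \<comment> \<open>Up to index shifts, which commute with \<open>dlt\<close>, C on \<alpha>(-l) x
      is expressed through C on x.\<close>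
    have "C (heis p (- int l) x) = (\<lambda>m k. heis p (- int l) (C x m k) - ?cr *\<^sub>c C x (m + - int l) (k + 0) -
        ?cs *\<^sub>c C x (m + 0) (k + - int l))"
      unfolding C_def exp_mode_heis clin_diff[OF clin_exp_mode] clin_scale[OF clin_exp_mode] clin_diff[OF clin_heis]
      by (intro ext poly_mapping_eqI) (simp add: lookup_minus algebra_simps)
    hence "(dlt ^^ N) (C (heis p (- int l) x)) = (\<lambda>m k. 0)"
      by (simp only: dlt_funpow_diff dlt_funpow_clin[OF clin_heis] dlt_funpow_clin[OF clin_scale_fun[OF clin_id]]
           dlt_funpow_shift IH' clin_0[OF clin_heis] cvec.scale_zero_right diff_self)
    thus "(\<lambda>(m, k) x. (dlt ^^ N) (C x) m k) mk (heis p (- int l) x) = 0" by (cases mk) simp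
  qed
  hence "(dlt ^^ N) (C x) = (\<lambda>m k. 0)" for x
    by (auto simp: fun_eq_iff)
  thus ?thesis unfolding local_pair_def C_def by blast
qed

section \<open>Lattice vertex operators\<close>

lemma gchoose_neg:
  assumes "m > 0"
  shows "(- 1) ^ i * (of_int (- int m) gchoose i) = (of_nat ((m + i - 1) choose i) :: complex)"
proof -
  have "of_nat m + of_nat i - 1 = (of_nat (m + i - 1) :: complex)" using assms by simp
  hence "(- of_nat m :: complex) gchoose i = (- 1) ^ i * of_nat ((m + i - 1) choose i)"
    unfolding gbinomial_minus binomial_gbinomial by simp
  thus ?thesis by simp
qed

lemma gchoose_creation:
  assumes "m > 0"
  shows "of_int (- (- int m - int i) - 1) gchoose (m - 1) = (of_nat ((m + i - 1) choose i) :: complex)"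
proof -
  have "of_int (- (- int m - int i) - 1) = (of_nat (m + i - 1) :: complex)" using assms by simp
  moreover have "(m + i - 1) choose (m - 1) = (m + i - 1) choose i"
    using binomial_symmetric[of i "m + i - 1"] assms by simp
  ultimately show ?thesis by (simp only: binomial_gbinomial[symmetric])
qed

lemma gchoose_annihilation:
  assumes "m > 0"
  shows "of_int (- int i - 1) gchoose (m - 1) = - ((- 1) powi (- int m)) * (of_nat ((m + i - 1) choose i) :: complex)"
proof -
  have 1: "of_int (- int i - 1) = - (of_nat (Suc i) :: complex)" by simp
  have 2: "of_nat (Suc i) + of_nat (m - 1) - 1 = (of_nat (m + i - 1) :: complex)" using assms by simp
  have 3: "(m + i - 1) choose (m - 1) = (m + i - 1) choose i"
    using binomial_symmetric[of i "m + i - 1"] assms by simp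
  have 4: "(- 1 :: complex) ^ (m - 1) = - ((- 1) powi (- int m))"
  proof -
    have "(- 1 :: complex) powi (- int m) = (- 1) ^ m"
      by (simp add: power_int_minus power_inverse[symmetric])
    thus ?thesis using assms by (cases m) simp_all
  qed
  show ?thesis
    unfolding 1 gbinomial_minus 2 binomial_gbinomial[symmetric] 3 4 ..
qed

text \<open>The divided derivative of order m - 1 kills the powers of z with exponent from 0 to m -
  2.\<close>

lemma gchoose_gap:
  assumes "k < 0" "- int m < k"
  shows "(of_int (- k - 1) :: complex) gchoose (m - 1) = 0"
proof -
  define j where "j = nat (- k - 1)"
  have "(of_int (- k - 1) :: complex) = of_nat j" "j < m - 1"
    using assms by (auto simp: j_def)
  thus ?thesis by (simp add: binomial_gbinomial[symmetric])
qed

text \<open>The normally ordered product with the divided derivative of order m - 1 is the (-m)-th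
  product: expanding (x - y)^{-m} for |x| > |y| gives the terms k <= -m, the other expansion those
  with k >= 0, and the coefficients in between vanish.\<close>

lemma monomial_mode_Cons:
  assumes m: "m > 0" and b: "field_on (monomial_mode p r ms)"
  shows "monomial_mode p r (m # ms) = nprod (heis p) (monomial_mode p r ms) (- int m)"
proof (intro ext)
  fix n w
  let ?b = "monomial_mode p r ms"
  obtain K where K: "\<And>n. n \<ge> K \<Longrightarrow> heis p n w = 0" using field_below[OF field_heis] by blast
  obtain L where L: "\<And>n. n \<ge> L \<Longrightarrow> ?b n w = 0" using field_below[OF b] by blast
  define I where "I = nat (max K (L - n))"
  have I: "\<And>k. k \<ge> int I \<Longrightarrow> heis p k w = 0" "\<And>k. k \<ge> n + int I \<Longrightarrow> ?b k w = 0"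
    by (rule K L, simp add: I_def split: if_splits)+
  let ?f = "\<lambda>k. (of_int (- k - 1) gchoose (m - 1)) *\<^sub>c
       (if k < 0 then heis p k (?b (n - k - int m) w) else ?b (n - k - int m) (heis p k w))"
  let ?N = "(\<lambda>i. - int m - int i) ` {..<I}" and ?P = "int ` {..<I}"
  have "monomial_mode p r (m # ms) n w = Sum_any ?f" by simp
  also have "\<dots> = sum ?f (?N \<union> ?P)"
  proof (rule Sum_any.expand_superset)
    have "?f k = 0" if "k \<notin> ?N \<union> ?P" for k
    proof -
      consider "k \<ge> int I" | "k < 0" "- int m < k" | "k \<le> - int m - int I"
      proof -
        have "k \<in> ?P" if "0 \<le> k" "k < int I"
          using that by (auto simp: image_iff intro!: bexI[of _ "nat k"])
        moreover have "k \<in> ?N" if "k \<le> - int m" "k > - int m - int I"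
          using that by (auto simp: image_iff intro!: bexI[of _ "nat (- int m - k)"])
        ultimately show thesis using \<open>k \<notin> ?N \<union> ?P\<close> that by fastforce
      qed
      thus ?thesis
      proof cases
        case 1 thus ?thesis using I(1)[of k] by (simp add: clin_0[OF field_clin[OF b]])
      next
        case 2 thus ?thesis using gchoose_gap[of k m] by simp
      next
        case 3
        moreover have "k < 0" using 3 m by linarith
        ultimately show ?thesis using I(2)[of "n - k - int m"] by (simp add: clin_0[OF clin_heis])
      qed
    qed
    thus "{k. ?f k \<noteq> 0} \<subseteq> ?N \<union> ?P" by blast
  qed simp
  also have "\<dots> = sum ?f ?N + sum ?f ?P"
    using m by (intro sum.union_disjoint) auto
  also have "sum ?f ?N = (\<Sum>i<I. ?f (- int m - int i))"
    by (subst sum.reindex) (auto simp: inj_on_def)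
  also have "sum ?f ?P = (\<Sum>i<I. ?f (int i))"
    by (subst sum.reindex) auto
  also have "(\<Sum>i<I. ?f (- int m - int i)) + (\<Sum>i<I. ?f (int i)) =
     (\<Sum>i<I. ((- 1) ^ i * (of_int (- int m) gchoose i)) *\<^sub>c
     (heis p (0 + - int m - int i) (?b (n + int i) w) - (- 1) powi (- int m) *\<^sub>c ?b (- int m + n - int i) (heis p (0 + int i) w)))"
    unfolding sum.distrib[symmetric]
  proof (rule sum.cong[OF refl])
    fix i
    let ?B = "of_nat ((m + i - 1) choose i) :: complex"
    have neg: "- int m - int i < 0" "\<not> int i < 0" using m by auto
    have idx: "n - (- int m - int i) - int m = n + int i" "n - int i - int m = - int m + n - int i" by simp_all
    show "?f (- int m - int i) + ?f (int i) = ((- 1) ^ i * (of_int (- int m) gchoose i)) *\<^sub>c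
     (heis p (0 + - int m - int i) (?b (n + int i) w) - (- 1) powi (- int m) *\<^sub>c ?b (- int m + n - int i) (heis p (0 + int i) w))"
      unfolding if_P[OF neg(1)] if_not_P[OF neg(2)] gchoose_neg[OF m] gchoose_creation[OF m]
        gchoose_annihilation[OF m] idx add_0_left
      by (intro poly_mapping_eqI) (simp add: lookup_add lookup_minus algebra_simps)
  qed
  also have "\<dots> = borcherds (heis p) ?b (- int m) w 0 n"
    by (rule borcherds_eq_sum[OF field_heis b, symmetric]) (use I in auto)
  finally show "monomial_mode p r (m # ms) n w = nprod (heis p) ?b (- int m) n w"
    by (simp add: nprod_def)
qed

lemma monomial_mode_Nil: "monomial_mode p r [] = exp_mode p r"
  by (intro ext) simp

lemma field_monomial: "0 \<notin> set ms \<Longrightarrow> field_on (monomial_mode p r ms)"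
proof (induction ms)
  case (Cons m ms)
  thus ?case by (simp add: monomial_mode_Cons field_nprod[OF field_heis] del: monomial_mode.simps)
qed (simp add: monomial_mode_Nil field_exp_mode)

text \<open>Dong's lemma along the list. Locality with \<alpha>(z) comes first, since each
  application for c requires it.\<close>

lemma local_monomial:
  assumes "0 \<notin> set ms" "field_on c" "local_pair (heis p) c" "local_pair (exp_mode p r) c"
  shows "local_pair (monomial_mode p r ms) c"
proof -
  have heis: "local_pair (heis p) (monomial_mode p r ms)" if "0 \<notin> set ms" for ms
    using that
  proof (induction ms)
    case (Cons m ms)
    have "local_pair (nprod (heis p) (monomial_mode p r ms) (- int m)) (heis p)"
      by (rule local_pair_nprod[OF field_heis field_monomial field_heis _ local_heis_heis local_pair_sym])
         (use Cons in auto)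
    thus ?case using Cons.prems by (simp add: monomial_mode_Cons field_monomial local_pair_sym del: monomial_mode.simps)
  qed (simp add: monomial_mode_Nil local_heis_exp)
  show ?thesis using assms(1)
  proof (induction ms)
    case (Cons m ms)
    have "local_pair (nprod (heis p) (monomial_mode p r ms) (- int m)) c"
      by (rule local_pair_nprod[OF field_heis field_monomial assms(2) heis assms(3)])
         (use Cons in auto)
    thus ?case using Cons.prems by (simp add: monomial_mode_Cons field_monomial del: monomial_mode.simps)
  qed (simp add: monomial_mode_Nil assms)
qed

lemma local_monomial_monomial:
  assumes ms: "0 \<notin> set ms" "0 \<notin> set ns" and c: "2 * of_nat p * r * s = of_int c" "even c"
  shows "local_pair (monomial_mode p r ms) (monomial_mode p s ns)"
proof (rule local_monomial[OF ms(1) field_monomial[OF ms(2)]])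
  show "local_pair (heis p) (monomial_mode p s ns)"
    by (rule local_pair_sym[OF local_monomial[OF ms(2) field_heis local_heis_heis local_pair_sym[OF local_heis_exp]]])
  show "local_pair (exp_mode p r) (monomial_mode p s ns)"
    by (rule local_pair_sym[OF local_monomial[OF ms(2) field_exp_mode local_heis_exp
          local_pair_sym[OF local_exp_exp[OF c]]]])
qed

lemma transl_cov_monomial:
  "p > 0 \<Longrightarrow> 0 \<notin> set ms \<Longrightarrow> transl_cov (transl p) (monomial_mode p r ms)"
proof (induction ms)
  case (Cons m ms)
  have "transl_cov (transl p) (nprod (heis p) (monomial_mode p r ms) (- int m))"
    by (rule transl_cov_nprod[OF field_heis field_monomial clin_transl transl_cov_heis]) (use Cons in auto)
  thus ?case using Cons.prems by (simp add: monomial_mode_Cons field_monomial del: monomial_mode.simps)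
qed (simp add: monomial_mode_Nil transl_cov_exp_mode)

lemma monomial_creates:
  "0 \<notin> set ms \<Longrightarrow> creates (exp_vec 0) (monomial_mode p r ms) (single (r, mset ms) 1)"
proof (induction ms)
  case Nil
  thus ?case using exp_mode_creates by (simp add: monomial_mode_Nil exp_vec_def)
next
  case (Cons m ms)
  have "creates (exp_vec 0) (nprod (heis p) (monomial_mode p r ms) (- int m))
     (heis p (- int m) (single (r, mset ms) 1))"
    by (rule creates_nprod[OF field_heis field_monomial heis_creates]) (use Cons in auto)
  thus ?case using Cons.prems by (simp add: monomial_mode_Cons field_monomial heis_neg_single del: monomial_mode.simps)
qed

lemma charged_monomial:
  "charged s q w \<Longrightarrow>
     charged (r + s) (q + of_nat (sum_list ms) - of_int n - 1 - 2 * of_nat p * r * s) (monomial_mode p r ms n w)"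
proof (induction ms arbitrary: n w q)
  case Nil
  thus ?case using charged_exp_mode[of s q w r n p] by simp
next
  case (Cons m ms)
  show ?case
    unfolding monomial_mode.simps
  proof (intro charged_Sum_any charged_scale)
    fix k
    show "charged (r + s) (q + of_nat (sum_list (m # ms)) - of_int n - 1 - 2 * of_nat p * r * s)
       (if k < 0 then heis p k (monomial_mode p r ms (n - k - int m) w)
        else monomial_mode p r ms (n - k - int m) (heis p k w))"
      using charged_heis[OF Cons.IH[OF Cons.prems, of "n - k - int m"], of k p]
        Cons.IH[OF charged_heis[OF Cons.prems, of k p], of "n - k - int m"]
      by (simp add: algebra_simps)
  qed
qed

section \<open>Fock spaces with prescribed charges\<close>

lemma fock_space_iff: "x \<in> fock_space A \<longleftrightarrow> (\<forall>k\<in>keys x. fst k \<in> A \<and> 0 \<notin># snd k)"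
  by (auto simp: fock_space_def case_prod_unfold)

lemma fock_space_0 [simp]: "0 \<in> fock_space A"
  by (simp add: fock_space_iff)

lemma fock_space_add: "x \<in> fock_space A \<Longrightarrow> y \<in> fock_space A \<Longrightarrow> x + y \<in> fock_space A"
  unfolding fock_space_iff using keys_add[of x y] by blast

lemma fock_space_scale: "x \<in> fock_space A \<Longrightarrow> c *\<^sub>c x \<in> fock_space A"
  unfolding fock_space_iff using keys_cscale[of c x] by blast

lemma fock_space_sum: "(\<And>i. i \<in> I \<Longrightarrow> f i \<in> fock_space A) \<Longrightarrow> sum f I \<in> fock_space A"
  by (induction I rule: infinite_finite_induct) (auto intro: fock_space_add)

lemma fock_space_Sum_any: "(\<And>i. f i \<in> fock_space A) \<Longrightarrow> Sum_any f \<in> fock_space A"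
  unfolding Sum_any.expand_set by (rule fock_space_sum)

lemma fock_space_single: "r \<in> A \<Longrightarrow> 0 \<notin># M \<Longrightarrow> single (r, M) c \<in> fock_space A"
  by (auto simp: fock_space_iff)

lemma fock_space_mono: "x \<in> fock_space A \<Longrightarrow> A \<subseteq> B \<Longrightarrow> x \<in> fock_space B"
  by (auto simp: fock_space_iff)

lemma fock_space_clin:
  assumes "clin f" "x \<in> fock_space A"
    and "\<And>s M. s \<in> A \<Longrightarrow> 0 \<notin># M \<Longrightarrow> f (single (s, M) 1) \<in> fock_space B"
  shows "f x \<in> fock_space B"
  unfolding clin_expand[OF assms(1), of x]
proof (intro fock_space_sum fock_space_scale)
  fix k assume "k \<in> keys x"
  thus "f (single k 1) \<in> fock_space B"
    using assms(2) assms(3)[of "fst k" "snd k"] by (auto simp: fock_space_iff)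
qed

lemma fock_space_heis:
  assumes "x \<in> fock_space A"
  shows "heis p k x \<in> fock_space A"
proof (rule fock_space_clin[OF clin_heis assms])
  fix s and M :: "nat multiset" assume sM: "s \<in> A" "0 \<notin># M"
  show "heis p k (single (s, M) 1) \<in> fock_space A"
  proof (cases k rule: int_cases3)
    case (1 j)
    thus ?thesis using sM by (simp add: heis_neg_single fock_space_single)
  next
    case 2
    thus ?thesis using sM by (simp add: heis_zero_single fock_space_single fock_space_scale)
  next
    case (3 j)
    have "0 \<notin># M - {#j#}" using sM(2) by (meson in_diffD)
    thus ?thesis using sM 3 by (simp add: heis_pos_single fock_space_single fock_space_scale)
  qed
qed

lemma fock_space_exp_coeff:
  assumes "\<And>k x. x \<in> fock_space A \<Longrightarrow> f k x \<in> fock_space A" "x \<in> fock_space A"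
  shows "exp_coeff f i x \<in> fock_space A"
proof -
  have "foldr f ks x \<in> fock_space A" for ks
    by (induction ks) (auto intro: assms)
  thus ?thesis unfolding exp_coeff_def by (intro fock_space_sum fock_space_scale)
qed

lemma fock_space_exp_mode:
  assumes "s \<in> A" "0 \<notin># M"
  shows "exp_mode p r n (single (s, M) 1) \<in> fock_space ((+) r ` A)"
proof -
  let ?x = "single (s, M) (1 :: complex)"
  have x: "?x \<in> fock_space A" by (rule fock_space_single[OF assms])
  have mult: "exp_vec r * y \<in> fock_space ((+) r ` A)" if "y \<in> fock_space A" for y
    by (rule fock_space_clin[OF clin_mult_left that])
       (auto simp: exp_vec_def mult_single plus_prod_def intro!: fock_space_single)
  have "exp_pos p r j ?x \<in> fock_space A" for j
    unfolding exp_pos_def by (intro fock_space_exp_coeff fock_space_scale fock_space_heis x)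
  hence "exp_neg p r i (exp_pos p r j ?x) \<in> fock_space A" for i j
    unfolding exp_neg_def by (auto intro!: fock_space_exp_coeff fock_space_scale fock_space_heis)
  hence "exp_op p r N ?x \<in> fock_space ((+) r ` A)" for N
    unfolding exp_op_def by (intro fock_space_Sum_any mult)
  thus ?thesis unfolding exp_mode_single by simp
qed

lemma fock_space_monomial:
  assumes "s \<in> A" "0 \<notin># M" "0 \<notin> set ms"
  shows "monomial_mode p r ms n (single (s, M) 1) \<in> fock_space ((+) r ` A)"
proof -
  have "w \<in> fock_space A \<Longrightarrow> monomial_mode p r ms n w \<in> fock_space ((+) r ` A)" for w
  proof (induction ms arbitrary: n w)
    case Nil
    show ?case unfolding monomial_mode.simps
      by (rule fock_space_clin[OF clin_exp_mode Nil]) (rule fock_space_exp_mode)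
  next
    case (Cons m ms)
    show ?case unfolding monomial_mode.simps
      by (intro fock_space_Sum_any fock_space_scale) (auto intro: fock_space_heis Cons)
  qed
  thus ?thesis using fock_space_single[OF assms(1,2)] by blast
qed

section \<open>Vertex operators of arbitrary vectors\<close>

lemma field_zero: "field_on (\<lambda>n w. 0)"
  by (simp add: field_on_def)

lemma field_sum: "(\<And>k. k \<in> A \<Longrightarrow> field_on (f k)) \<Longrightarrow> field_on (\<lambda>n w. \<Sum>k\<in>A. c k *\<^sub>c f k n w)"
proof (induction A rule: infinite_finite_induct)
  case (insert k A)
  have "field_on (\<lambda>n w. c k *\<^sub>c f k n w + 1 *\<^sub>c (\<Sum>k\<in>A. c k *\<^sub>c f k n w))"
    by (rule field_lin_comb) (use insert in auto)
  thus ?case using insert by simp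
qed (simp_all add: field_zero)

lemma local_pair_sum:
  "(\<And>k. k \<in> A \<Longrightarrow> field_on (f k) \<and> local_pair (f k) d) \<Longrightarrow> field_on d \<Longrightarrow>
     local_pair (\<lambda>n w. \<Sum>k\<in>A. c k *\<^sub>c f k n w) d"
proof (induction A rule: infinite_finite_induct)
  case (insert k A)
  have "local_pair (\<lambda>n w. c k *\<^sub>c f k n w + 1 *\<^sub>c (\<Sum>k\<in>A. c k *\<^sub>c f k n w)) d"
    by (rule local_pair_lin_comb) (use insert in \<open>auto intro: field_sum\<close>)
  thus ?case using insert by simp
qed (auto simp: local_pair_def clin_0[OF field_clin] intro!: exI[of _ 0])

lemma transl_cov_sum:
  assumes T: "clin T"
  shows "(\<And>k. k \<in> A \<Longrightarrow> transl_cov T (f k)) \<Longrightarrow> transl_cov T (\<lambda>n w. \<Sum>k\<in>A. c k *\<^sub>c f k n w)"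
proof (induction A rule: infinite_finite_induct)
  case (insert k A)
  have "transl_cov T (\<lambda>n w. c k *\<^sub>c f k n w + 1 *\<^sub>c (\<Sum>k\<in>A. c k *\<^sub>c f k n w))"
    by (rule transl_cov_lin_comb[OF T]) (use insert in auto)
  thus ?case using insert by simp
qed (simp_all add: transl_cov_def clin_0[OF T])

lemma creates_sum:
  "(\<And>k. k \<in> A \<Longrightarrow> creates vac (f k) (v k)) \<Longrightarrow>
     creates vac (\<lambda>n w. \<Sum>k\<in>A. c k *\<^sub>c f k n w) (\<Sum>k\<in>A. c k *\<^sub>c v k)"
  by (simp add: creates_def)

abbreviation key_mode :: "nat \<Rightarrow> fock_key \<Rightarrow> int \<Rightarrow> fock \<Rightarrow> fock" where
  "key_mode p k \<equiv> monomial_mode p (fst k) (sorted_list_of_multiset (snd k))"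

lemma lattice_mode_eq:
  "lattice_mode p v = (\<lambda>n w. \<Sum>k\<in>keys v. lookup v k *\<^sub>c key_mode p k n w)"
  by (intro ext) (simp add: lattice_mode_def lin_ext_def case_prod_unfold)

lemma lattice_mode_single: "lattice_mode p (single k 1) n w = key_mode p k n w"
  by (simp add: lattice_mode_def case_prod_unfold)

lemma clin_lattice_mode_left: "clin (\<lambda>v. lattice_mode p v n w)"
  unfolding lattice_mode_def by simp

lemma field_lattice: "v \<in> fock_space A \<Longrightarrow> field_on (lattice_mode p v)"
  unfolding lattice_mode_eq by (intro field_sum field_monomial) (auto simp: fock_space_iff)

lemma transl_cov_lattice: "p > 0 \<Longrightarrow> v \<in> fock_space A \<Longrightarrow> transl_cov (transl p) (lattice_mode p v)"
  unfolding lattice_mode_eq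
  by (intro transl_cov_sum clin_transl transl_cov_monomial) (auto simp: fock_space_iff)

lemma lattice_creates: "v \<in> fock_space A \<Longrightarrow> creates (exp_vec 0) (lattice_mode p v) v"
proof -
  assume v: "v \<in> fock_space A"
  have "creates (exp_vec 0) (key_mode p k) (single k 1)" if "k \<in> keys v" for k
    using monomial_creates[of "sorted_list_of_multiset (snd k)" p "fst k"] that v
    by (auto simp: fock_space_iff)
  hence "creates (exp_vec 0) (lattice_mode p v)
      (\<Sum>k\<in>keys v. lookup v k *\<^sub>c single k 1)"
    unfolding lattice_mode_eq by (rule creates_sum)
  thus ?thesis by (simp only: expand_singles[of v, symmetric])
qed

text \<open>Charges \<open>r\<close> for which \<open>e\<^bsup>r\<alpha>\<^esup>\<close> is local with the lattice vertex algebra: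
  \<open>(r\<alpha>, s\<alpha>) = 2prs\<close> is an even integer for all integers \<open>s\<close>.\<close>

definition charges :: "nat \<Rightarrow> rat set" where
  "charges p = {r. of_nat p * r \<in> \<int>}"

lemma Ints_subset_charges: "\<int> \<subseteq> charges p"
  by (auto simp: charges_def)

lemma charges_add: "r \<in> charges p \<Longrightarrow> s \<in> \<int> \<Longrightarrow> r + s \<in> charges p"
  by (auto simp: charges_def distrib_left)

lemma local_lattice:
  assumes u: "u \<in> fock_space (charges p)" and v: "v \<in> fock_space \<int>"
  shows "local_pair (lattice_mode p u) (lattice_mode p v)"
proof -
  have "local_pair (key_mode p k) (key_mode p l)"
    if k: "k \<in> keys u" and l: "l \<in> keys v" for k l
  proof -
    have "of_nat p * fst k \<in> \<int>" "fst l \<in> \<int>" using u v k l by (auto simp: fock_space_iff charges_def)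
    then obtain a b where ab: "of_nat p * fst k = of_int a" "fst l = of_int b" by (auto elim!: Ints_cases)
    have "2 * of_nat p * fst k * fst l = 2 * (of_nat p * fst k) * fst l" by (simp add: mult_ac)
    also have "\<dots> = of_int (2 * a * b)" unfolding ab by simp
    finally have "2 * of_nat p * fst k * fst l = of_int (2 * a * b)" .
    thus ?thesis
      using u v k l by (intro local_monomial_monomial[where c = "2 * a * b"]) (auto simp: fock_space_iff simp del: of_int_mult)
  qed
  moreover have fu: "field_on (key_mode p k)" if "k \<in> keys u" for k
    using that u by (intro field_monomial) (auto simp: fock_space_iff)
  moreover have "field_on (key_mode p l)" if "l \<in> keys v" for l
    using that v by (intro field_monomial) (auto simp: fock_space_iff)
  ultimately have loc: "local_pair (key_mode p k) (lattice_mode p v)" if "k \<in> keys u" for k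
    using that unfolding lattice_mode_eq[of p v]
    by (intro local_pair_sym[OF local_pair_sum]) (auto intro: local_pair_sym)
  show ?thesis
    unfolding lattice_mode_eq[of p u]
    by (rule local_pair_sum[OF conjI[OF fu loc] field_lattice[OF v]])
qed

lemma lattice_mode_closed:
  assumes u: "u \<in> fock_space A" and w: "w \<in> fock_space B" and AB: "\<And>r s. r \<in> A \<Longrightarrow> s \<in> B \<Longrightarrow> r + s \<in> C"
  shows "lattice_mode p u n w \<in> fock_space C"
proof (rule fock_space_clin[OF field_clin[OF field_lattice[OF u]] w])
  fix s and M :: "nat multiset" assume sM: "s \<in> B" "0 \<notin># M"
  show "lattice_mode p u n (single (s, M) 1) \<in> fock_space C"
    unfolding lattice_mode_eq
  proof (intro fock_space_sum fock_space_scale)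
    fix k assume "k \<in> keys u"
    hence k: "fst k \<in> A" "0 \<notin># snd k" using u by (auto simp: fock_space_iff)
    have "key_mode p k n (single (s, M) 1) \<in> fock_space ((+) (fst k) ` {s})"
      using sM(2) k(2) by (intro fock_space_monomial) auto
    thus "key_mode p k n (single (s, M) 1) \<in> fock_space C"
      by (rule fock_space_mono) (use AB[OF k(1) sM(1)] in auto)
  qed
qed

lemma lattice_mode_charges:
  "u \<in> fock_space (charges p) \<Longrightarrow> v \<in> fock_space \<int> \<Longrightarrow> lattice_mode p u n v \<in> fock_space (charges p)"
  by (rule lattice_mode_closed[OF _ _ charges_add])

lemma lattice_mode_Ints:
  "u \<in> fock_space \<int> \<Longrightarrow> v \<in> fock_space \<int> \<Longrightarrow> lattice_mode p u n v \<in> fock_space \<int>"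
  by (rule lattice_mode_closed[OF _ _ Ints_add])

text \<open>Each vertex operator creates its own vector, so \<open>nprod_unique\<close> applies with
  d the vertex operator of w. For u = e^{-\<alpha>/p} and n = 0 this is the commutator formula for
  Q.\<close>

lemma lattice_iterate:
  assumes p: "p > 0" and u: "u \<in> fock_space (charges p)" and v: "v \<in> fock_space \<int>" and w: "w \<in> fock_space \<int>"
  shows "lattice_mode p (lattice_mode p u n v) k w = nprod (lattice_mode p u) (lattice_mode p v) n k w"
proof -
  note uv = lattice_mode_charges[OF u v, of n]
  show ?thesis
    by (rule nprod_unique[OF field_lattice[OF u] field_lattice[OF v] field_lattice[OF uv] field_lattice[OF w]
          clin_transl transl_vacuum[OF p] transl_cov_lattice[OF p u] transl_cov_lattice[OF p v]
          transl_cov_lattice[OF p uv] lattice_creates[OF u] lattice_creates[OF v] lattice_creates[OF uv]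
          lattice_creates[OF w] local_lattice[OF u v] local_lattice[OF u w]
          local_lattice[OF fock_space_mono[OF v Ints_subset_charges] w] local_lattice[OF uv w]])
qed

lemma lattice_borcherds:
  assumes p: "p > 0" and u: "u \<in> fock_space (charges p)" and v: "v \<in> fock_space \<int>" and w: "w \<in> fock_space \<int>"
  shows "Sum_any (\<lambda>i::nat. (of_int m gchoose i) *\<^sub>c lattice_mode p (lattice_mode p u (n + int i) v) (m + k - int i) w) =
      borcherds (lattice_mode p u) (lattice_mode p v) n w m k"
proof -
  obtain N where N: "\<And>n. n \<ge> N \<Longrightarrow> lattice_mode p u n v = 0"
    using field_below[OF field_lattice[OF u]] by blast
  show ?thesis
    by (rule borcherds_identity[where N = N and c = "\<lambda>n. lattice_mode p (lattice_mode p u n v)",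
          OF field_lattice[OF u] field_lattice[OF v] local_lattice[OF u v] lattice_iterate[OF p u v w]])
       (simp add: N clin_0[OF clin_lattice_mode_left])
qed

section \<open>Weights\<close>

text \<open>The eigenvalue of \<open>L(0)\<close> on the basis vector with the given key.\<close>

definition weight :: "nat \<Rightarrow> fock_key \<Rightarrow> rat" where
  "weight p k = of_nat p * fst k * fst k - (of_nat p - 1) * fst k + mset_level (snd k)"

lemma mset_level_eq: "mset_level M = of_nat (sum_list (sorted_list_of_multiset M))"
  by (simp only: mset_level_def sum_mset_sum_list[symmetric] mset_sorted_list_of_multiset)

text \<open>The weight is quadratic in the charge; for charges r and s its cross term 2prs cancels
  the shift of the level by 2prs.\<close>

lemma key_mode_keys:
  assumes "k' \<in> keys (key_mode p k n (single l 1))"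
  shows "fst k' = fst k + fst l" "weight p k' = weight p k + weight p l - of_int n - 1"
proof -
  have "charged (fst l) (mset_level (snd l)) (single l 1)"
    by (cases l) (auto intro: charged_single)
  from charged_monomial[OF this, of "fst k" "sorted_list_of_multiset (snd k)" n p]
  have *: "fst k' = fst k + fst l"
     "mset_level (snd k') = mset_level (snd l) + mset_level (snd k) - of_int n - 1 - 2 * of_nat p * fst k * fst l"
    using assms by (simp_all add: charged_def mset_level_eq)
  show "fst k' = fst k + fst l" by (rule *)
  show "weight p k' = weight p k + weight p l - of_int n - 1"
    unfolding weight_def * by (simp add: algebra_simps)
qed

definition homog :: "nat \<Rightarrow> rat \<Rightarrow> fock \<Rightarrow> bool" where
  "homog p h x \<longleftrightarrow> (\<forall>k\<in>keys x. weight p k = h)"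

lemma homog_lattice_mode:
  assumes "homog p h v" "v \<in> fock_space A" "homog p g w"
  shows "homog p (h + g - of_int n - 1) (lattice_mode p v n w)"
  unfolding homog_def
proof
  fix k' assume "k' \<in> keys (lattice_mode p v n w)"
  moreover have "keys (lattice_mode p v n w) \<subseteq> {k'. weight p k' = h + g - of_int n - 1}"
  proof (rule clin_keys[OF field_clin[OF field_lattice[OF assms(2)]]])
    fix l assume l: "l \<in> keys w"
    show "keys (lattice_mode p v n (single l 1)) \<subseteq> {k'. weight p k' = h + g - of_int n - 1}"
    proof (rule clin_keys[OF clin_lattice_mode_left])
      fix k assume k: "k \<in> keys v"
      show "keys (lattice_mode p (single k 1) n (single l 1))
          \<subseteq> {k'. weight p k' = h + g - of_int n - 1}"
        using key_mode_keys(2)[of _ p k n l] assms(1,3) k l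
        by (auto simp: lattice_mode_single homog_def)
    qed
  qed
  ultimately show "weight p k' = h + g - of_int n - 1" by blast
qed

lemma homog_single: "homog p (weight p k) (single k c)"
  by (auto simp: homog_def)

text \<open>The right side is r + p r (r - 1), the least weight in charge r, and r (r - 1) >= 0 for
  integers. So the charge is controlled by the weight.\<close>

lemma integral_charge_bound:
  fixes r :: rat
  assumes p: "p > 0" and "r \<in> \<int>"
  shows "\<bar>r\<bar> \<le> of_nat p * r * r - (of_nat p - 1) * r"
proof -
  obtain a where a: "r = of_int a" using assms(2) by (auto elim: Ints_cases)
  have "\<bar>a\<bar> \<le> int p * a * a - (int p - 1) * a"
  proof (cases "a \<le> 0")
    case True
    have "1 * ((- a) * (1 - a)) \<le> int p * ((- a) * (1 - a))"
      using True p by (intro mult_right_mono mult_nonneg_nonneg) auto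
    moreover have "0 \<le> (- a) * (- a - 1)"
      using True by (cases "a = 0") (simp, intro mult_nonneg_nonneg, linarith+)
    ultimately show ?thesis using True by (simp add: algebra_simps)
  next
    case False
    have "0 \<le> int p * (a * (a - 1))" using False by (intro mult_nonneg_nonneg) auto
    thus ?thesis using False by (simp add: algebra_simps)
  qed
  hence "(of_int \<bar>a\<bar> :: rat) \<le> of_int (int p * a * a - (int p - 1) * a)"
    by (simp only: of_int_le_iff)
  thus ?thesis by (simp add: a)
qed

lemma weight_integral: "fst k \<in> \<int> \<Longrightarrow> weight p k \<in> \<int>"
  unfolding weight_def mset_level_def by (intro Ints_add Ints_diff Ints_mult Ints_of_nat Ints_1)

lemma mset_level_eq_0: "mset_level M = 0 \<Longrightarrow> 0 \<notin># M \<Longrightarrow> M = {#}"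
  by (cases M) (auto simp: mset_level_def simp del: of_nat_sum_mset)

text \<open>Weights in charge a are at least |a|, which leaves a = -1, 0, 1; charge -1 starts at 2p
  - 1 >= 3 because p >= 2.\<close>

lemma weight_less_2:
  assumes p: "p \<ge> 2" and k: "fst k \<in> \<int>" "0 \<notin># snd k" and w: "weight p k < 2"
  shows "k = (0, {#}) \<or> k = (0, {#1#}) \<or> k = (1, {#})"
proof -
  obtain a where a: "fst k = of_int a" using k(1) by (auto elim: Ints_cases)
  have lev: "mset_level (snd k) \<ge> 0" by (rule mset_level_nonneg)
  have "\<bar>fst k\<bar> < 2"
    using integral_charge_bound[OF _ k(1), of p] p w lev by (simp add: weight_def)
  hence "\<bar>a\<bar> < 2" unfolding a by simp
  hence "a = -1 \<or> a = 0 \<or> a = 1" by linarith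
  moreover have "a \<noteq> -1"
  proof
    assume "a = -1"
    hence "weight p k \<ge> 2 * of_nat p - 1" using lev by (simp add: weight_def a)
    moreover have "(of_nat p :: rat) \<ge> 2" using p by (metis of_nat_le_iff of_nat_numeral)
    ultimately show False using w by linarith
  qed
  moreover have ?thesis if "a = 1"
  proof -
    have "mset_level (snd k) < 1" using w that by (simp add: weight_def a)
    hence "mset_level (snd k) = 0" by (simp add: mset_level_def del: of_nat_sum_mset)
    hence "snd k = {#}" using k(2) by (rule mset_level_eq_0)
    thus ?thesis using that a by (simp add: prod_eq_iff)
  qed
  moreover have ?thesis if "a = 0"
  proof -
    have lt: "mset_level (snd k) < 2" using w that by (simp add: weight_def a)
    show ?thesis
    proof (cases "snd k")
      case empty thus ?thesis using that a by (simp add: prod_eq_iff)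
    next
      case (add j N)
      have "j \<noteq> 0" "0 \<notin># N" using k(2) add by auto
      have "of_nat j + mset_level N < 2" using lt add by simp
      moreover have "(of_nat j :: rat) \<ge> 1" using \<open>j \<noteq> 0\<close> by (simp add: Suc_leI)
      ultimately have "mset_level N < 1" by linarith
      hence "mset_level N = 0" by (simp add: mset_level_def del: of_nat_sum_mset)
      hence "N = {#}" using \<open>0 \<notin># N\<close> by (rule mset_level_eq_0)
      moreover have "(of_nat j :: rat) < 2" using lt add mset_level_nonneg[of N] by simp
      hence "j < 2" by (metis of_nat_less_iff of_nat_numeral)
      ultimately show ?thesis using that a add \<open>j \<noteq> 0\<close> by (auto simp: prod_eq_iff)
    qed
  qed
  ultimately show ?thesis by blast
qed

text \<open>|charge| + level <= weight, so the charge and the entries and size of the multiset are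
  all bounded.\<close>

lemma finite_small_weight:
  assumes p: "p > 0"
  shows "finite {k. fst k \<in> \<int> \<and> 0 \<notin># snd k \<and> weight p k \<le> c}"
proof -
  define C where "C = nat \<lceil>c\<rceil>"
  let ?R = "(of_int :: int \<Rightarrow> rat) ` {- int C..int C}"
  let ?M = "mset ` {xs :: nat list. set xs \<subseteq> {..C} \<and> length xs \<le> C}"
  have "{k. fst k \<in> \<int> \<and> 0 \<notin># snd k \<and> weight p k \<le> c} \<subseteq> ?R \<times> ?M"
  proof
    fix k assume "k \<in> {k. fst k \<in> \<int> \<and> 0 \<notin># snd k \<and> weight p k \<le> c}"
    hence k: "fst k \<in> \<int>" "0 \<notin># snd k" "weight p k \<le> c" by auto
    obtain a where a: "fst k = of_int a" using k(1) by (auto elim: Ints_cases)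
    have b: "\<bar>fst k\<bar> + mset_level (snd k) \<le> c"
      using integral_charge_bound[OF p k(1)] k(3) by (simp add: weight_def)
    hence c: "0 \<le> c" using mset_level_nonneg[of "snd k"] by linarith
    hence cC: "c \<le> of_nat C" unfolding C_def by (simp add: of_nat_nat)
    have "\<bar>of_int a :: rat\<bar> \<le> of_nat C" using b cC mset_level_nonneg[of "snd k"] unfolding a by linarith
    hence "\<bar>a\<bar> \<le> int C"
      by (metis of_int_abs of_int_le_iff of_int_of_nat_eq)
    hence "fst k \<in> ?R" unfolding a by (intro imageI) auto
    moreover have "snd k \<in> ?M"
    proof -
      let ?xs = "sorted_list_of_multiset (snd k)"
      have "mset_level (snd k) \<le> of_nat C" using b cC by linarith
      hence s: "sum_list ?xs \<le> C" unfolding mset_level_eq by (simp only: of_nat_le_iff)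
      moreover have "length ?xs \<le> sum_list ?xs" using k(2) by (intro length_le_sum_list) simp
      moreover have "x \<le> sum_list ?xs" if "x \<in> set ?xs" for x using that by (intro member_le_sum_list) auto
      ultimately have "set ?xs \<subseteq> {..C}" "length ?xs \<le> C" by fastforce+
      thus ?thesis by (intro image_eqI[of _ _ ?xs]) auto
    qed
    ultimately show "k \<in> ?R \<times> ?M" by (cases k) auto
  qed
  moreover have "finite (?R \<times> ?M)"
    by (intro finite_cartesian_product finite_imageI finite_lists_length_le) auto
  ultimately show ?thesis by (rule finite_subset)
qed

section \<open>The conformal vector\<close>

lemma exp_vec_0: "exp_vec 0 = 1"
  by (simp add: exp_vec_def zero_prod_def[symmetric] single_one)

lemma exp_mode_0: "exp_mode p 0 n w = (if n = - 1 then w else 0)"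
proof -
  have neg: "exp_neg p 0 (int i) x = 0" if "i > 0" for i x
    using exp_neg_rec[of i p 0 x] that by simp
  have pos: "exp_pos p 0 i x = 0" if "i > 0" for i x
    using exp_pos_rec[of i p 0 x] that by simp
  have op: "exp_op p 0 N x = (if N = 0 then x else 0)" for N x
  proof -
    have "exp_op p 0 N x = exp_neg p 0 N x"
      unfolding exp_op_def
      by (subst Sum_any_lessThan[of 1]) (auto simp: pos exp_pos_0 exp_vec_0 clin_0[OF clin_exp_neg])
    also have "\<dots> = (if N = 0 then x else 0)"
      using neg[of "nat N" x] by (auto simp: exp_neg_0) (auto simp: exp_neg_def)
    finally show ?thesis .
  qed
  show ?thesis
  proof (rule clin_eq_on_keys[where f = "exp_mode p 0 n" and g = "\<lambda>w. if n = - 1 then w else 0" and x = w])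
    fix k :: fock_key
    show "exp_mode p 0 n (single k 1) = (if n = - 1 then single k 1 else 0)"
      by (cases k) (auto simp: exp_mode_single op)
    show "clin (\<lambda>w. if n = - 1 then w else 0)" by (cases "n = - 1") simp_all
  qed (rule clin_exp_mode)
qed

lemma lattice_mode_vacuum: "lattice_mode p (exp_vec 0) n w = (if n = - 1 then w else 0)"
  unfolding exp_vec_def lattice_mode_single by (simp add: exp_mode_0)

lemma monomial_mode_1: "monomial_mode p 0 [1] n w = heis p n w"
proof -
  have "monomial_mode p 0 [1] n w = Sum_any (\<lambda>k. if k = n then heis p n w else 0)"
    unfolding monomial_mode.simps exp_mode_0
    by (rule arg_cong[where f = Sum_any]) (auto simp: fun_eq_iff clin_0[OF clin_heis])
  thus ?thesis by simp
qed

lemma monomial_mode_2: "monomial_mode p 0 [2] n w = (- of_int n) *\<^sub>c heis p (n - 1) w"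
proof -
  have "monomial_mode p 0 [2] n w = Sum_any (\<lambda>k. if k = n - 1 then (- of_int n) *\<^sub>c heis p (n - 1) w else 0)"
    unfolding monomial_mode.simps exp_mode_0
    by (rule arg_cong[where f = Sum_any]) (auto simp: fun_eq_iff clin_0[OF clin_heis])
  thus ?thesis by simp
qed

lemma monomial_mode_11:
  "monomial_mode p 0 [1, 1] n w =
     Sum_any (\<lambda>k. if k < 0 then heis p k (heis p (n - k - 1) w) else heis p (n - k - 1) (heis p k w))"
proof -
  have "monomial_mode p 0 [1, 1] n w = Sum_any (\<lambda>k. (of_int (- k - 1) gchoose (1 - 1)) *\<^sub>c
       (if k < 0 then heis p k (monomial_mode p 0 [1] (n - k - int 1) w)
        else monomial_mode p 0 [1] (n - k - int 1) (heis p k w)))"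
    by (rule monomial_mode.simps)
  thus ?thesis
    unfolding monomial_mode_1 by (simp del: monomial_mode.simps cong: if_cong)
qed

definition conf :: "nat \<Rightarrow> fock" where
  "conf p = (1 / (4 * of_nat p)) *\<^sub>c single (0, {#1, 1#}) 1
       + ((of_nat p - 1) / (2 * of_nat p)) *\<^sub>c single (0, {#2#}) 1"

lemma lattice_mode_conf:
  "lattice_mode p (conf p) n w = (1 / (4 * of_nat p)) *\<^sub>c monomial_mode p 0 [1, 1] n w
       + ((of_nat p - 1) / (2 * of_nat p)) *\<^sub>c monomial_mode p 0 [2] n w"
proof -
  have "sorted_list_of_multiset {#1, 1#} = [1, 1::nat]" by simp
  thus ?thesis
    unfolding conf_def clin_lin_comb[OF clin_lattice_mode_left] lattice_mode_single fst_conv snd_conv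
    by (simp only: sorted_list_of_multiset_singleton)
qed

lemma sum_mset_count:
  "finite A \<Longrightarrow> set_mset M \<subseteq> A \<Longrightarrow> (\<Sum>j\<in>A. j * count M j) = sum_mset M" for M :: "nat multiset"
proof (induction M)
  case (add x M)
  have "(\<Sum>j\<in>A. j * count (add_mset x M) j) = (\<Sum>j\<in>A. j * count M j + (if j = x then j else 0))"
    by (intro sum.cong refl) simp
  also have "\<dots> = sum_mset M + x"
    using add by (simp add: sum.distrib sum.delta)
  finally show ?case by simp
qed simp

text \<open>L(0) = (\<alpha>(0)^2 + 2 \<Sum>j\<ge>1. \<alpha>(-j) \<alpha>(j)) / (4p) - (p - 1)
  \<alpha>(0) / (2p), and \<alpha>(-j) \<alpha>(j) multiplies a monomial by 2pj times the
  multiplicity of j.\<close>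

lemma virasoro_zero_mode:
  assumes p: "p > 0"
  shows "lattice_mode p (conf p) 1 (single k 1) = of_rat (weight p k) *\<^sub>c single k 1"
proof -
  obtain r M where k: "k = (r, M)" by (cases k)
  let ?x = "single (r, M) (1 :: complex)"
  define g :: "nat \<Rightarrow> complex" where "g = (\<lambda>j. 2 * of_nat p * of_nat j * of_nat (count M j))"
  let ?f = "\<lambda>k. if k < 0 then heis p k (heis p (1 - k - 1) ?x) else heis p (1 - k - 1) (heis p k ?x)"
  have lower: "heis p (- int j) (heis p (int j) ?x) = g j *\<^sub>c ?x" if j: "j > 0" for j
  proof (cases "j \<in># M")
    case True
    then obtain N where "M = add_mset j N" by (meson multi_member_split)
    thus ?thesis using j by (simp add: heis_pos_single heis_neg_single clin_scale[OF clin_heis] g_def)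
  next
    case False
    thus ?thesis using j by (simp add: heis_pos_single clin_0[OF clin_heis] g_def not_in_iff)
  qed
  have f_neg: "?f (- int j) = g j *\<^sub>c ?x" and f_pos: "?f (int j) = g j *\<^sub>c ?x" if "j > 0" for j
    using lower[OF that] that by simp_all
  have f_0: "?f 0 = ((2 * of_nat p * of_rat r) * (2 * of_nat p * of_rat r)) *\<^sub>c ?x"
    by (simp add: heis_zero_single clin_scale[OF clin_heis])
  \<comment> \<open>Without 0 the indices j and -j are distinct; k = 0 is counted
    separately.\<close>
  let ?J = "set_mset M - {0}"
  let ?P = "int ` ?J" and ?N = "(\<lambda>j. - int j) ` ?J"
  have supp: "{k. ?f k \<noteq> 0} \<subseteq> ({0} \<union> ?P) \<union> ?N"
  proof
    fix k assume "k \<in> {k. ?f k \<noteq> 0}"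
    hence nz: "?f k \<noteq> 0" by simp
    show "k \<in> ({0} \<union> ?P) \<union> ?N"
    proof (cases k rule: int_cases3)
      case (1 j)
      hence "g j \<noteq> 0" using nz f_neg[of j] by auto
      hence "j \<in> ?J" using 1 by (auto simp: g_def)
      thus ?thesis using 1 by blast
    next
      case (3 j)
      hence "g j \<noteq> 0" using nz f_pos[of j] by auto
      hence "j \<in> ?J" using 3 by (auto simp: g_def)
      thus ?thesis using 3 by blast
    qed simp
  qed
  have "Sum_any ?f = sum ?f (({0} \<union> ?P) \<union> ?N)"
    by (rule Sum_any.expand_superset[OF _ supp]) simp
  also have "\<dots> = sum ?f ({0} \<union> ?P) + sum ?f ?N"
    by (rule sum.union_disjoint) auto
  also have "sum ?f ({0} \<union> ?P) = ?f 0 + sum ?f ?P"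
    by (subst sum.union_disjoint) auto
  also have "sum ?f ?P = (\<Sum>j\<in>?J. ?f (int j))"
    by (subst sum.reindex) simp_all
  also have "\<dots> = (\<Sum>j\<in>?J. g j *\<^sub>c ?x)"
    by (rule sum.cong[OF refl], rule f_pos) auto
  also have "sum ?f ?N = (\<Sum>j\<in>?J. ?f (- int j))"
    by (subst sum.reindex) (simp_all add: inj_on_def)
  also have "\<dots> = (\<Sum>j\<in>?J. g j *\<^sub>c ?x)"
    by (rule sum.cong[OF refl], rule f_neg) auto
  also have "(\<Sum>j\<in>?J. g j *\<^sub>c ?x) = (\<Sum>j\<in>?J. g j) *\<^sub>c ?x"
    by (rule cvec.scale_sum_left[symmetric])
  also have "(\<Sum>j\<in>?J. g j) = (\<Sum>j\<in>set_mset M. g j)"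
    by (rule sum.mono_neutral_left) (auto simp: g_def)
  also have "\<dots> = 2 * of_nat p * of_nat (sum_mset M)"
    unfolding sum_mset_count[OF finite_set_mset order_refl, of M, symmetric]
    by (simp add: g_def sum_distrib_left mult_ac del: One_nat_def)
  also note f_0
  also have "((2 * of_nat p * of_rat r) * (2 * of_nat p * of_rat r)) *\<^sub>c ?x +
      (2 * of_nat p * of_nat (sum_mset M)) *\<^sub>c ?x + (2 * of_nat p * of_nat (sum_mset M)) *\<^sub>c ?x =
      ((2 * of_nat p * of_rat r) * (2 * of_nat p * of_rat r) + 2 * of_nat p * of_nat (sum_mset M) +
       2 * of_nat p * of_nat (sum_mset M)) *\<^sub>c ?x"
    by (simp only: cvec.scale_left_distrib)
  finally have m11: "monomial_mode p 0 [1, 1] 1 ?x = ((2 * of_nat p * of_rat r) * (2 * of_nat p * of_rat r) +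
      2 * of_nat p * of_nat (sum_mset M) + 2 * of_nat p * of_nat (sum_mset M)) *\<^sub>c ?x"
    unfolding monomial_mode_11 .
  have m2: "monomial_mode p 0 [2] 1 ?x = (- (2 * of_nat p * of_rat r)) *\<^sub>c ?x"
    unfolding monomial_mode_2 by (simp add: heis_zero_single)
  have "(of_rat (weight p k) :: complex) =
      1 / (4 * of_nat p) * ((2 * of_nat p * of_rat r) * (2 * of_nat p * of_rat r) +
      2 * of_nat p * of_nat (sum_mset M) + 2 * of_nat p * of_nat (sum_mset M)) +
      (of_nat p - 1) / (2 * of_nat p) * (- (2 * of_nat p * of_rat r))"
    using p unfolding weight_def mset_level_def k
    by (simp add: of_rat_add of_rat_diff of_rat_mult field_simps del: of_nat_sum_mset)
  thus ?thesis
    unfolding lattice_mode_conf k m11 m2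
    by (simp only: cvec.scale_scale cvec.scale_left_distrib[symmetric])
qed

section \<open>The triplet algebra\<close>

lemma triplet_simps:
  "modes (triplet p) = lattice_mode p" "vacuum (triplet p) = exp_vec 0" "conformal (triplet p) = conf p"
  "carrier (triplet p) = {v \<in> fock_space \<int>. screening p v = 0}"
  by (simp_all add: triplet_def lattice_voa_def conf_def)

abbreviation screen_vec :: "nat \<Rightarrow> fock" where
  "screen_vec p \<equiv> exp_vec (- 1 / of_nat p)"

lemma screen_vec_charges: "p > 0 \<Longrightarrow> screen_vec p \<in> fock_space (charges p)"
  by (simp add: exp_vec_def fock_space_single charges_def)

lemma lattice_mode_exp_vec: "lattice_mode p (exp_vec r) n w = exp_mode p r n w"
  unfolding exp_vec_def lattice_mode_single by simp

lemma screening_exp_mode: "screening p v = exp_mode p (- 1 / of_nat p) 0 v"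
  unfolding screening_def by (rule lattice_mode_exp_vec)

lemma clin_screening: "clin (screening p)"
  unfolding screening_exp_mode[abs_def] by (rule clin_exp_mode)

text \<open>The zero mode of a vector of weight 1 preserves weights.\<close>

lemma homog_screening:
  assumes p: "p > 0" and x: "homog p g x"
  shows "homog p g (screening p x)"
proof -
  have "weight p (- 1 / of_nat p, {#}) = 1"
    using p by (simp add: weight_def field_simps)
  hence "homog p 1 (screen_vec p)"
    unfolding exp_vec_def using homog_single[of p "(- 1 / of_nat p, {#})" 1] by simp
  from homog_lattice_mode[OF this screen_vec_charges[OF p] x, of 0]
  show ?thesis by (simp add: screening_def)
qed

text \<open>By the commutator formula \<open>[Q, u\<^sub>k] = (Q u)\<^sub>k = 0\<close>.\<close>

lemma triplet_closed:
  assumes p: "p > 0" and u: "u \<in> carrier (triplet p)" and v: "v \<in> carrier (triplet p)"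
  shows "lattice_mode p u k v \<in> carrier (triplet p)"
proof -
  have u': "u \<in> fock_space \<int>" "lattice_mode p (screen_vec p) 0 u = 0"
    using u by (auto simp: triplet_simps screening_def)
  have v': "v \<in> fock_space \<int>" "lattice_mode p (screen_vec p) 0 v = 0"
    using v by (auto simp: triplet_simps screening_def)
  note q = screen_vec_charges[OF p]
  have "lattice_mode p (lattice_mode p (screen_vec p) 0 u) k v =
     lattice_mode p (screen_vec p) 0 (lattice_mode p u k v) - lattice_mode p u k (lattice_mode p (screen_vec p) 0 v)"
    unfolding lattice_iterate[OF p q u'(1) v'(1)] nprod_def borcherds_0 ..
  hence "lattice_mode p (screen_vec p) 0 (lattice_mode p u k v) = 0"
    unfolding u'(2) v'(2) by (simp add: clin_0[OF clin_lattice_mode_left] clin_0[OF field_clin[OF field_lattice[OF u'(1)]]])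
  thus ?thesis
    using lattice_mode_Ints[OF u'(1) v'(1)] by (simp add: triplet_simps screening_def)
qed

lemma vacuum_triplet: "exp_vec 0 \<in> carrier (triplet p)"
  using createsD(1)[OF exp_mode_creates, of 0 p "- 1 / of_nat p"]
  by (simp add: triplet_simps screening_exp_mode) (simp add: exp_vec_def fock_space_single)

text \<open>The pairing of -\<alpha>/p with -\<alpha> is 2, so Y(e^{-\<alpha>/p}, z) e^{-\<alpha>}
  begins with z^2 and has no residue.\<close>

lemma exp_vec_neg_triplet:
  assumes p: "p > 0"
  shows "exp_vec (- 1) \<in> carrier (triplet p)"
proof -
  have "2 * of_nat p * (- 1 / of_nat p) * (- 1) = (of_int 2 :: rat)" using p by simp
  from exp_mode_base[OF base_vector_exp_vec this, of 0]
  have "screening p (exp_vec (- 1)) = 0"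
    by (simp add: screening_exp_mode) (simp add: exp_neg_def)
  thus ?thesis by (simp add: triplet_simps exp_vec_def fock_space_single)
qed

lemma screening_heis:
  assumes "p > 0"
  shows "exp_mode p (- 1 / of_nat p) n (heis p l x) =
    heis p l (exp_mode p (- 1 / of_nat p) n x) + 2 *\<^sub>c exp_mode p (- 1 / of_nat p) (n + l) x"
proof -
  have c: "2 * of_nat p * of_rat (- 1 / of_nat p) = (- 2 :: complex)"
    using assms unfolding of_rat_divide of_rat_minus by simp
  show ?thesis unfolding exp_mode_heis c by simp
qed

lemma alpha_vacuum: "single (0, {#1#}) 1 = heis p (- 1) (exp_vec 0)"
  using heis_neg_single[of 1 p 0 "{#}"] by (simp add: exp_vec_def)

lemma screening_alpha:
  assumes "p > 0"
  shows "screening p (single (0, {#1#}) 1) = 2 *\<^sub>c screen_vec p"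
  unfolding alpha_vacuum[of p] screening_exp_mode screening_heis[OF assms]
  using createsD(1)[OF exp_mode_creates, of 0 p "- 1 / of_nat p"]
    createsD(2)[OF exp_mode_creates, of p "- 1 / of_nat p"]
  by (simp add: clin_0[OF clin_heis])

text \<open>Q maps both summands to multiples of \<alpha>(-1) e^{-\<alpha>/p}, and the coefficient
  (p - 1)/(2p) of \<alpha>(-2)1 is the one that makes them cancel.\<close>

lemma conf_triplet:
  assumes p: "p > 0"
  shows "conf p \<in> carrier (triplet p)"
proof -
  define r :: rat where "r = - 1 / of_nat p"
  let ?e = "exp_mode p r" and ?q = "exp_vec r"
  note heis = screening_heis[OF p, folded r_def]
  have e0: "?e 0 (exp_vec 0) = 0" and e1: "?e (- 1) (exp_vec 0) = ?q"
    using createsD(1)[OF exp_mode_creates, of 0 p r] createsD(2)[OF exp_mode_creates, of p r] by simp_all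
  \<comment> \<open>By translation covariance this coefficient on the vacuum is T
    e^{r\<alpha>}.\<close>
  have e2: "?e (- 2) (exp_vec 0) = of_rat r *\<^sub>c heis p (- 1) ?q"
    using transl_covD[OF transl_cov_exp_mode[OF p, of r], of "- 1" "exp_vec 0"]
    by (simp add: e1 transl_vacuum[OF p] clin_0[OF clin_exp_mode] transl_base[OF p base_vector_exp_vec])
  have i: "0 + - 1 = (- 1 :: int)" "- 1 + - 1 = (- 2 :: int)" by simp_all
  have k11: "single (0, {#1, 1#}) 1 = heis p (- 1) (heis p (- 1) (exp_vec 0))"
    unfolding alpha_vacuum[of p, symmetric] using heis_neg_single[of 1 p 0 "{#1#}"] by simp
  have k2: "single (0, {#2#}) 1 = heis p (- 2) (exp_vec 0)"
    using heis_neg_single[of 2 p 0 "{#}"] by (simp add: exp_vec_def)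
  have s11: "screening p (single (0, {#1, 1#}) 1) = (4 + 4 * of_rat r) *\<^sub>c heis p (- 1) ?q"
    unfolding k11 screening_exp_mode r_def[symmetric] heis
      i e0 e1 e2 clin_0[OF clin_heis] clin_add[OF clin_heis] clin_scale[OF clin_heis]
    by (intro poly_mapping_eqI) (simp only: lookup_add lookup_cscale lookup_zero, simp add: algebra_simps)
  have s2: "screening p (single (0, {#2#}) 1) = (2 * of_rat r) *\<^sub>c heis p (- 1) ?q"
    unfolding k2 screening_exp_mode r_def[symmetric] heis
    by (simp add: e0 e2 clin_0[OF clin_heis])
  have of_rat_r: "of_rat r = (- 1 / of_nat p :: complex)" unfolding r_def of_rat_divide of_rat_minus by simp
  have "1 / (4 * of_nat p) * (4 + 4 * of_rat r) + (of_nat p - 1) / (2 * of_nat p) * (2 * of_rat r) = (0 :: complex)"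
    using p unfolding of_rat_r by (simp add: field_simps)
  hence "screening p (conf p) = 0"
    unfolding conf_def clin_lin_comb[OF clin_screening] s11 s2 cvec.scale_scale cvec.scale_left_distrib[symmetric]
    by simp
  moreover have "conf p \<in> fock_space \<int>"
    unfolding conf_def by (intro fock_space_add fock_space_scale fock_space_single) auto
  ultimately show ?thesis by (simp add: triplet_simps)
qed

lemma virasoro_zero_mode_lookup:
  assumes "p > 0"
  shows "lookup (lattice_mode p (conf p) 1 x) k = of_rat (weight p k) * lookup x k"
proof -
  have lin: "clin (lattice_mode p (conf p) 1)"
    using conf_triplet[OF assms] by (intro field_clin[OF field_lattice]) (auto simp: triplet_simps)
  have "lookup (lattice_mode p (conf p) 1 x) k =
     (\<Sum>l\<in>keys x. if l = k then lookup x l * of_rat (weight p k) else 0)"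
    unfolding clin_expand[OF lin, of x] virasoro_zero_mode[OF assms] lookup_sum
    by (intro sum.cong refl) (simp add: lookup_single when_def)
  thus ?thesis by (simp add: sum.delta in_keys_iff)
qed

lemma homogeneous_iff:
  assumes "p > 0"
  shows "homogeneous (triplet p) h v \<longleftrightarrow> v \<in> carrier (triplet p) \<and> homog p (of_int h) v"
proof -
  have "lattice_mode p (conf p) 1 v = of_int h *\<^sub>c v \<longleftrightarrow>
     (\<forall>k. of_rat (weight p k) * lookup v k = of_int h * lookup v k)"
    by (simp add: poly_mapping_eq_iff fun_eq_iff virasoro_zero_mode_lookup[OF assms])
  also have "\<dots> \<longleftrightarrow> homog p (of_int h) v"
  proof -
    have *: "(of_rat a :: complex) = of_int h \<longleftrightarrow> a = of_int h" for a
      using of_rat_eq_iff[where 'a = complex, of a "of_int h"] by simp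
    show ?thesis
      unfolding homog_def in_keys_iff mult_cancel_right Ball_def * by blast
  qed
  finally show ?thesis by (simp add: homogeneous_def triplet_simps)
qed

section \<open>The lattice vertex algebra as a module over the triplet algebra\<close>

definition lattice_module :: "nat \<Rightarrow> (fock_key, fock_key) voa_module" where
  "lattice_module p = \<lparr>mcarrier = fock_space \<int>, act = lattice_mode p\<rparr>"

lemma csubspace_fock_space: "csubspace (fock_space A)"
  by (simp add: cvec.subspace_def fock_space_add fock_space_scale)

lemma weak_module_lattice:
  assumes p: "p > 0"
  shows "weak_module (triplet p) (lattice_module p)"
  unfolding weak_module_def
proof (intro conjI ballI allI)
  fix v n w assume "v \<in> carrier (triplet p)" "w \<in> mcarrier (lattice_module p)"
  thus "act (lattice_module p) v n w \<in> mcarrier (lattice_module p)"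
    by (simp add: lattice_module_def triplet_simps lattice_mode_Ints)
next
  fix v n a b w w' assume "v \<in> carrier (triplet p)"
  hence "clin (lattice_mode p v n)" by (intro field_clin field_lattice) (auto simp: triplet_simps)
  thus "act (lattice_module p) v n (a *\<^sub>c w + b *\<^sub>c w') = a *\<^sub>c act (lattice_module p) v n w + b *\<^sub>c act (lattice_module p) v n w'"
    by (simp add: lattice_module_def clin_lin_comb)
next
  fix v w assume "v \<in> carrier (triplet p)"
  hence "field_on (lattice_mode p v)" by (intro field_lattice) (auto simp: triplet_simps)
  thus "\<exists>N. \<forall>n\<ge>N. act (lattice_module p) v n w = 0"
    by (simp add: lattice_module_def field_on_def)
next
  fix u v w m n k
  assume u: "u \<in> carrier (triplet p)" and v: "v \<in> carrier (triplet p)" and w: "w \<in> mcarrier (lattice_module p)"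
  have u': "u \<in> fock_space \<int>" using u by (simp add: triplet_simps)
  have v': "v \<in> fock_space \<int>" using v by (simp add: triplet_simps)
  have w': "w \<in> fock_space \<int>" using w by (simp add: lattice_module_def)
  show "Sum_any (\<lambda>i::nat. (of_int m gchoose i) *\<^sub>c
            act (lattice_module p) (modes (triplet p) u (n + int i) v) (m + k - int i) w) =
        Sum_any (\<lambda>i::nat. ((- 1) ^ i * (of_int n gchoose i)) *\<^sub>c
            (act (lattice_module p) u (m + n - int i) (act (lattice_module p) v (k + int i) w)
             - ((- 1) powi n) *\<^sub>c act (lattice_module p) v (n + k - int i) (act (lattice_module p) u (m + int i) w)))"
    unfolding triplet_simps lattice_module_def voa_module.simps
      lattice_borcherds[OF p fock_space_mono[OF u' Ints_subset_charges] v' w']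
      borcherds_Sum_any[OF field_lattice[OF u'] field_lattice[OF v']] ..
qed (simp_all add: lattice_module_def csubspace_fock_space triplet_simps lattice_mode_vacuum
       clin_lin_comb[OF clin_lattice_mode_left])

text \<open>L(0) is diagonal on the keys, so (L(0) - \<mu>)^n multiplies a coefficient by the n-th
  power of its weight minus \<mu>.\<close>

lemma gen_weight_space_keys:
  assumes p: "p > 0" and w: "w \<in> gen_weight_space (triplet p) (lattice_module p) \<mu>"
    and k: "k \<in> keys w"
  shows "of_rat (weight p k) = \<mu>"
proof -
  let ?D = "\<lambda>x. lattice_mode p (conf p) 1 x - \<mu> *\<^sub>c x"
  obtain n where n: "(?D ^^ n) w = 0"
    using w by (auto simp: gen_weight_space_def triplet_simps lattice_module_def)
  have "lookup ((?D ^^ n) w) k = (of_rat (weight p k) - \<mu>) ^ n * lookup w k"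
    by (induction n) (simp_all add: lookup_minus virasoro_zero_mode_lookup[OF p] algebra_simps)
  thus ?thesis using k n by (simp add: in_keys_iff)
qed

lemma single_gen_weight_space:
  assumes "p > 0" "fst k \<in> \<int>" "0 \<notin># snd k"
  shows "single k 1 \<in> gen_weight_space (triplet p) (lattice_module p) (of_rat (weight p k))"
proof -
  have "single k 1 \<in> fock_space \<int>"
    using fock_space_single[of "fst k" \<int> "snd k"] assms by simp
  thus ?thesis
    by (auto simp: gen_weight_space_def triplet_simps lattice_module_def virasoro_zero_mode[OF assms(1)] intro!: exI[of _ 1])
qed

lemma in_cspan_keys:
  assumes "\<And>k. k \<in> keys w \<Longrightarrow> single k 1 \<in> S"
  shows "w \<in> cspan S"
  by (subst expand_singles[of w]) (intro cvec.span_sum cvec.span_scale cvec.span_base assms)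

lemma lattice_module_Mod:
  assumes p: "p > 0"
  shows "lattice_module p \<in> Mod (triplet p)"
proof -
  let ?G = "gen_weight_space (triplet p) (lattice_module p)"
  have carrier: "mcarrier (lattice_module p) = fock_space \<int>" by (simp add: lattice_module_def)
  have keys: "fst k \<in> \<int> \<and> 0 \<notin># snd k" if "w \<in> fock_space \<int>" "k \<in> keys w" for w k
    using that by (auto simp: fock_space_iff)
  have "fock_space \<int> = cspan (\<Union>\<mu>. ?G \<mu>)"
  proof
    show "fock_space \<int> \<subseteq> cspan (\<Union>\<mu>. ?G \<mu>)"
    proof
      fix w :: fock assume w: "w \<in> fock_space \<int>"
      show "w \<in> cspan (\<Union>\<mu>. ?G \<mu>)"
        using single_gen_weight_space[OF p] keys[OF w] by (intro in_cspan_keys) blast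
    qed
    have "(\<Union>\<mu>. ?G \<mu>) \<subseteq> fock_space \<int>" by (auto simp: gen_weight_space_def carrier)
    thus "cspan (\<Union>\<mu>. ?G \<mu>) \<subseteq> fock_space \<int>"
      by (rule cvec.span_minimal[OF _ csubspace_fock_space])
  qed
  moreover have "\<exists>B. finite B \<and> cspan (\<Union>\<nu>\<in>{\<nu>. Re \<nu> \<le> Re \<mu>}. ?G \<nu>) = cspan B" for \<mu>
  proof -
    \<comment> \<open>A rational bound above Re \<mu>, since weights are rational.\<close>
    define c :: rat where "c = of_int \<lceil>Re \<mu>\<rceil>"
    let ?U = "\<Union>\<nu>\<in>{\<nu>. Re \<nu> \<le> Re \<mu>}. ?G \<nu>"
    define K where "K = {k. fst k \<in> \<int> \<and> 0 \<notin># snd k \<and> Re (of_rat (weight p k)) \<le> Re \<mu>}"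
    define B where "B = (\<lambda>k. single k (1 :: complex)) ` K"
    have "K \<subseteq> {k. fst k \<in> \<int> \<and> 0 \<notin># snd k \<and> weight p k \<le> c}"
    proof
      fix k assume k: "k \<in> K"
      have "Re (of_rat (weight p k)) = (of_rat (weight p k) :: real)"
        by (cases "weight p k") (simp add: of_rat_rat)
      moreover have "Re \<mu> \<le> of_rat c" by (simp add: c_def)
      ultimately have "(of_rat (weight p k) :: real) \<le> of_rat c" using k by (simp add: K_def)
      thus "k \<in> {k. fst k \<in> \<int> \<and> 0 \<notin># snd k \<and> weight p k \<le> c}"
        using k by (simp add: K_def of_rat_less_eq)
    qed
    hence "finite B" unfolding B_def by (intro finite_imageI finite_subset[OF _ finite_small_weight[OF p]])
    moreover have "cspan ?U = cspan B"
    proof (rule cvec.span_eq[THEN iffD2], intro conjI subsetI)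
      fix w assume "w \<in> ?U"
      then obtain \<nu> where \<nu>: "Re \<nu> \<le> Re \<mu>" "w \<in> ?G \<nu>" by auto
      hence "w \<in> fock_space \<int>" by (simp add: gen_weight_space_def carrier)
      thus "w \<in> cspan B"
        using gen_weight_space_keys[OF p \<nu>(2)] \<nu>(1) keys
        by (intro in_cspan_keys) (auto simp: B_def K_def)
    next
      fix w assume "w \<in> B"
      then obtain k where k: "k \<in> K" "w = single k 1" by (auto simp: B_def)
      hence "w \<in> ?G (of_rat (weight p k))" using single_gen_weight_space[OF p, of k] by (simp add: K_def)
      thus "w \<in> cspan ?U" using k(1) by (intro cvec.span_base) (auto simp: K_def)
    qed
    ultimately show ?thesis by blast
  qed
  ultimately show ?thesis
    unfolding Mod_def using weak_module_lattice[OF p] by (simp add: carrier)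
qed

section \<open>The submodule generated by the lowest vectors\<close>

text \<open>The submodule generated by \<open>w\<close> is spanned by the \<open>x\<^sub>n w\<close>. By downward induction
  on \<open>k\<close>: with \<open>M\<close> so large that \<open>v\<^sub>i w = 0\<close> for \<open>i \<ge> M\<close>, the Borcherds identity expresses
  \<open>v\<^sub>m u\<^sub>k w\<close> by the \<open>(v\<^sub>i u)\<^sub>j w\<close> and the \<open>v\<^sub>i u\<^sub>j w\<close> with \<open>j > k\<close>.\<close>

lemma iterated_modes_kernel:
  assumes p: "p > 0" and f: "clin f" and w: "w \<in> fock_space \<int>"
    and zero: "\<And>x j. x \<in> carrier (triplet p) \<Longrightarrow> f (lattice_mode p x j w) = 0"
    and v: "v \<in> carrier (triplet p)" and u: "u \<in> carrier (triplet p)"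
  shows "f (lattice_mode p v m (lattice_mode p u k w)) = 0"
proof -
  have v': "v \<in> fock_space \<int>" and u': "u \<in> fock_space \<int>" using u v by (auto simp: triplet_simps)
  note Y = field_lattice[OF v'] field_lattice[OF u']
  obtain K where K: "\<And>k. k \<ge> K \<Longrightarrow> lattice_mode p u k w = 0" using field_below[OF Y(2)] by blast
  obtain M where M: "\<And>k. k \<ge> M \<Longrightarrow> lattice_mode p v k w = 0" using field_below[OF Y(1)] by blast
  obtain N where N: "\<And>n. n \<ge> N \<Longrightarrow> lattice_mode p v n u = 0" using field_below[OF Y(1)] by blast
  have "f (lattice_mode p v m (lattice_mode p u (K - int j) w)) = 0" for j m
  proof (induction j arbitrary: m rule: less_induct)
    case (less j)
    \<comment> \<open>Then M + n = m, so v_m u_k w is the term i = 0 of the Borcherds expansion with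
      indices M, n, k, and all terms containing v_{M+i} w vanish.\<close>
    define n where "n = m - M"
    define k where "k = K - int j"
    have later: "f (lattice_mode p v m' (lattice_mode p u (k + int i) w)) = 0" if "i > 0" for i m'
    proof (cases "i \<le> j")
      case True
      hence "k + int i = K - int (j - i)" by (simp add: k_def of_nat_diff)
      moreover have "f (lattice_mode p v m' (lattice_mode p u (K - int (j - i)) w)) = 0"
        using that True by (intro less) auto
      ultimately show ?thesis by (simp only:)
    next
      case False
      thus ?thesis using K[of "k + int i"] by (simp add: k_def clin_0[OF field_clin[OF Y(1)]] clin_0[OF f])
    qed
    have "borcherds (lattice_mode p v) (lattice_mode p u) n w M k =
        (\<Sum>i<Suc j. ((- 1) ^ i * (of_int n gchoose i)) *\<^sub>c
         (lattice_mode p v (M + n - int i) (lattice_mode p u (k + int i) w) -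
          (- 1) powi n *\<^sub>c lattice_mode p u (n + k - int i) (lattice_mode p v (M + int i) w)))"
      by (rule borcherds_eq_sum[OF Y]) (use K M in \<open>auto simp: k_def\<close>)
    also have "\<dots> = (\<Sum>i<Suc j. ((- 1) ^ i * (of_int n gchoose i)) *\<^sub>c
         lattice_mode p v (M + n - int i) (lattice_mode p u (k + int i) w))"
      by (intro sum.cong refl) (simp add: M clin_0[OF field_clin[OF Y(2)]])
    finally have "f (borcherds (lattice_mode p v) (lattice_mode p u) n w M k) =
        (\<Sum>i<Suc j. ((- 1) ^ i * (of_int n gchoose i)) *\<^sub>c
         f (lattice_mode p v (M + n - int i) (lattice_mode p u (k + int i) w)))"
      by (simp only: clin_sum[OF f] clin_scale[OF f])
    also have "\<dots> = f (lattice_mode p v (M + n) (lattice_mode p u k w))"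
      by (subst sum.lessThan_Suc_shift) (simp add: later del: of_nat_Suc)
    finally have "f (lattice_mode p v m (lattice_mode p u k w)) =
        f (borcherds (lattice_mode p v) (lattice_mode p u) n w M k)"
      by (simp add: n_def)
    also have "borcherds (lattice_mode p v) (lattice_mode p u) n w M k =
        Sum_any (\<lambda>i::nat. (of_int M gchoose i) *\<^sub>c lattice_mode p (lattice_mode p v (n + int i) u) (M + k - int i) w)"
      by (rule lattice_borcherds[OF p fock_space_mono[OF v' Ints_subset_charges] u' w, symmetric])
    also have "f \<dots> = Sum_any (\<lambda>i::nat. f ((of_int M gchoose i) *\<^sub>c lattice_mode p (lattice_mode p v (n + int i) u) (M + k - int i) w))"
      by (rule clin_Sum_any_nat[OF f, of "nat (N - n)"]) (simp add: N clin_0[OF clin_lattice_mode_left])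
    also have "\<dots> = 0"
      by (simp add: clin_scale[OF f] zero[OF triplet_closed[OF p v u]])
    finally show ?case by (simp add: k_def)
  qed
  from this[of m "nat (K - k)"] show ?thesis
    using K[of k] by (cases "k \<ge> K") (auto simp: clin_0[OF field_clin[OF Y(1)]] clin_0[OF f])
qed

text \<open>A coefficient functional whose value is kept as a multiple of a basis vector, so that it
  is a \<open>clin\<close> map of Fock space.\<close>

definition key_part :: "fock_key \<Rightarrow> fock \<Rightarrow> fock" where
  "key_part k x = lookup x k *\<^sub>c single k 1"

lemma lookup_key_part: "lookup (key_part k x) k = lookup x k"
  by (simp add: key_part_def)

lemma clin_key_part: "clin (key_part k)"
  by (rule clinI) (simp_all add: key_part_def lookup_add cvec.scale_left_distrib)

text \<open>The coefficient of \<open>e\<^bsup>-\<alpha>/p\<^esup>\<close> in \<open>Q x\<close>.\<close>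

definition screen_part :: "nat \<Rightarrow> fock \<Rightarrow> fock" where
  "screen_part p x = key_part (- 1 / of_nat p, {#}) (screening p x)"

lemma clin_screen_part: "clin (screen_part p)"
  unfolding screen_part_def[abs_def] by (rule clin_comp[OF clin_key_part clin_screening])

text \<open>The largest submodule of V_L inside the kernel of \<open>screen_part\<close>.
  Quantifying over all modes forces closure, and the vacuum mode -1 puts w itself into the
  kernel.\<close>

definition screened :: "nat \<Rightarrow> fock set" where
  "screened p = {w \<in> fock_space \<int>. \<forall>v\<in>carrier (triplet p). \<forall>n. screen_part p (lattice_mode p v n w) = 0}"

lemma submodule_screened:
  assumes p: "p > 0"
  shows "submodule (triplet p) (lattice_module p) (screened p)"
  unfolding submodule_def
proof (intro conjI ballI allI)
  show "screened p \<subseteq> mcarrier (lattice_module p)" by (auto simp: screened_def lattice_module_def)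
  have lin: "clin (lattice_mode p v n)" if "v \<in> carrier (triplet p)" for v n
    using that by (intro field_clin field_lattice) (auto simp: triplet_simps)
  show "csubspace (screened p)"
    unfolding cvec.subspace_def screened_def
    by (auto simp: fock_space_add fock_space_scale clin_0 clin_add clin_scale lin clin_screen_part)
  fix u n w assume u: "u \<in> carrier (triplet p)" and w: "w \<in> screened p"
  have "lattice_mode p u n w \<in> fock_space \<int>"
    using u w by (intro lattice_mode_Ints) (auto simp: screened_def triplet_simps)
  moreover have "screen_part p (lattice_mode p v m (lattice_mode p u n w)) = 0"
    if "v \<in> carrier (triplet p)" for v m
    by (rule iterated_modes_kernel[OF p clin_screen_part _ _ that u]) (use w in \<open>auto simp: screened_def\<close>)
  ultimately show "act (lattice_module p) u n w \<in> screened p"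
    by (simp add: screened_def lattice_module_def)
qed

text \<open>Q preserves weights and e^{-\<alpha>/p} has weight 1.\<close>

lemma homog_screen_part:
  assumes p: "p > 0" and x: "homog p g x" and g: "g \<noteq> 1"
  shows "screen_part p x = 0"
proof -
  have "weight p (- 1 / of_nat p, {#}) = 1"
    using p by (simp add: weight_def field_simps)
  hence "(- 1 / of_nat p, {#}) \<notin> keys (screening p x)"
    using homog_screening[OF p x] g by (auto simp: homog_def)
  thus ?thesis by (simp add: screen_part_def key_part_def in_keys_iff)
qed

lemma alpha_not_screened:
  assumes p: "p > 0"
  shows "single (0, {#1#}) 1 \<notin> screened p"
proof
  assume "single (0, {#1#}) 1 \<in> screened p"
  hence "screen_part p (lattice_mode p (exp_vec 0) (- 1) (single (0, {#1#}) 1)) = 0"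
    using vacuum_triplet unfolding screened_def by blast
  hence "key_part (- 1 / of_nat p, {#}) (2 *\<^sub>c screen_vec p) = 0"
    unfolding lattice_mode_vacuum screen_part_def if_P[OF refl] screening_alpha[OF p] .
  hence "lookup (2 *\<^sub>c screen_vec p) (- 1 / of_nat p, {#}) = 0"
    by (metis lookup_key_part lookup_zero)
  thus False by (simp add: exp_vec_def)
qed

section \<open>Weight 1 components of lowest vectors\<close>

lemma homog_lookup_0: "homog p h x \<Longrightarrow> weight p k \<noteq> h \<Longrightarrow> lookup x k = 0"
  by (auto simp: homog_def in_keys_iff)

lemma fock_space_lookup_0: "x \<in> fock_space A \<Longrightarrow> fst k \<notin> A \<Longrightarrow> lookup x k = 0"
  by (auto simp: fock_space_iff in_keys_iff)

text \<open>Only l could contribute to the coefficient of f w at k, so nothing cancels it.\<close>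

lemma isolated_key:
  assumes f: "clin f" "f w = 0" and l: "lookup (f (single l 1)) k \<noteq> 0"
    and other: "\<And>l'. l' \<in> keys w \<Longrightarrow> l' \<noteq> l \<Longrightarrow> lookup (f (single l' 1)) k = 0"
  shows "l \<notin> keys w"
proof
  assume lw: "l \<in> keys w"
  have "0 = (\<Sum>l'\<in>keys w. lookup w l' * lookup (f (single l' 1)) k)"
    using arg_cong[OF clin_expand[OF f(1), of w], of "\<lambda>x. lookup x k"] f(2)
    by (simp add: lookup_sum)
  also have "\<dots> = (\<Sum>l'\<in>{l}. lookup w l' * lookup (f (single l' 1)) k)"
    by (rule sum.mono_neutral_right) (use lw other in auto)
  finally show False using l lw by (simp add: in_keys_iff)
qed

text \<open>The two keys of weight 1 are separated by charge: L(1) keeps the charge and the mode of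
  e^{-\<alpha>} lowers it by 1, so each yields the vacuum from just one of them. Both modes lower
  the weight by 1, which excludes keys of other weights.\<close>

lemma lowest_vector_weight_1:
  assumes p: "p \<ge> 2" and w: "w \<in> lowest_vectors (triplet p) (lattice_module p)"
    and k: "k \<in> keys w"
  shows "weight p k \<noteq> 1"
proof
  assume wk: "weight p k = 1"
  have p0: "p > 0" using p by simp
  have wF: "w \<in> fock_space \<int>"
    and low: "\<And>h v n. homogeneous (triplet p) h v \<Longrightarrow> h - n - 1 < 0 \<Longrightarrow> lattice_mode p v n w = 0"
    using w by (auto simp: lowest_vectors_def lattice_module_def)
  have keys: "fst k \<in> \<int>" "0 \<notin># snd k" if "k \<in> keys w" for k
    using wF that by (auto simp: fock_space_iff)
  have small: "l = (0, {#1#}) \<or> l = (1, {#})" if "l \<in> keys w" "weight p l = 1" for l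
  proof -
    have "l = (0, {#}) \<or> l = (0, {#1#}) \<or> l = (1, {#})"
      by (rule weight_less_2[OF p keys]) (use that in auto)
    moreover have "weight p (0, {#}) = 0" by (simp add: weight_def)
    ultimately show ?thesis using that(2) by fastforce
  qed
  have vac: "weight p (0, {#}) = 0" by (simp add: weight_def)
  have conf_hom: "homog p 2 (conf p)"
    unfolding homog_def
  proof
    fix l assume "l \<in> keys (conf p)"
    hence "l = (0, {#1, 1#}) \<or> l = (0, {#2#})"
      unfolding conf_def by (auto simp: in_keys_iff lookup_add lookup_single when_def split: if_splits)
    thus "weight p l = 2" by (auto simp: weight_def)
  qed
  have conf_F: "conf p \<in> fock_space \<int>" using conf_triplet[OF p0] by (simp add: triplet_simps)
  have exp_hom: "homog p (of_int (2 * int p - 1)) (exp_vec (- 1))"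
    by (simp add: homog_def exp_vec_def weight_def algebra_simps)
  have exp_F: "exp_vec (- 1) \<in> fock_space \<int>" using exp_vec_neg_triplet[OF p0] by (simp add: triplet_simps)
  have exp_homogeneous: "homogeneous (triplet p) (2 * int p - 1) (exp_vec (- 1))"
    unfolding homogeneous_iff[OF p0] using exp_vec_neg_triplet[OF p0] exp_hom by blast
  consider "k = (0, {#1#})" | "k = (1, {#})" using small[OF k wk] by blast
  thus False
  proof cases
    case 1
    have "(0, {#1#}) \<notin> keys w"
    proof (rule isolated_key[where f = "lattice_mode p (conf p) 2" and k = "(0, {#})"])
      show "clin (lattice_mode p (conf p) 2)" by (rule field_clin[OF field_lattice[OF conf_F]])
      show "lattice_mode p (conf p) 2 w = 0"
        by (rule low[of 2]) (simp_all add: homogeneous_iff[OF p0] conf_triplet[OF p0] conf_hom)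
      show "lookup (lattice_mode p (conf p) 2 (single (0, {#1#}) 1)) (0, {#}) \<noteq> 0"
      proof -
        define x where "x = single (0 :: rat, {#1 :: nat#}) (1 :: complex)"
        have h: "heis p j x = (if j = 1 then (2 * of_nat p) *\<^sub>c exp_vec 0 else 0)" if "j \<ge> 0" for j
        proof (cases j rule: int_cases3)
          case (3 i)
          thus ?thesis by (simp add: x_def heis_pos_single exp_vec_def)
        qed (use that in \<open>auto simp: x_def heis_zero_single\<close>)
        have h0: "heis p 0 (exp_vec 0) = 0" using base_vector_heis(2)[OF base_vector_exp_vec[of 0], of p] by simp
        \<comment> \<open>Of the modes applied first only \<alpha>(1) is nonzero on \<alpha>(-1)1,
          and its partner \<alpha>(0) kills the vacuum.\<close>
        have "(if k < 0 then heis p k (heis p (2 - k - 1) x) else heis p (2 - k - 1) (heis p k x)) = 0" for k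
        proof (cases "k < 0")
          case True thus ?thesis by (simp add: h clin_0[OF clin_heis])
        next
          case False
          thus ?thesis by (simp add: h h0 clin_0[OF clin_heis] clin_scale[OF clin_heis])
        qed
        hence m11: "monomial_mode p 0 [1, 1] 2 x = 0" unfolding monomial_mode_11 by simp
        have m2: "monomial_mode p 0 [2] 2 x = (- (4 * of_nat p)) *\<^sub>c exp_vec 0"
          unfolding monomial_mode_2 using h[of 1] by simp
        \<comment> \<open>This is -2(p - 1), due to the summand \<alpha>(-2)1 of the conformal
          vector alone, and nonzero as p >= 2.\<close>
        have "lookup (lattice_mode p (conf p) 2 x) (0, {#}) =
            (of_nat p - 1) / (2 * of_nat p) * (- (4 * of_nat p))"
          unfolding lattice_mode_conf m11 m2 by (simp add: lookup_add exp_vec_def)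
        moreover have "(of_nat p :: complex) \<noteq> 1" "(of_nat p :: complex) \<noteq> 0"
          using p by (auto simp: of_nat_eq_1_iff)
        ultimately have "lookup (lattice_mode p (conf p) 2 x) (0, {#}) \<noteq> 0" by simp
        thus ?thesis unfolding x_def .
      qed
      fix l assume l: "l \<in> keys w" "l \<noteq> (0, {#1#})"
      show "lookup (lattice_mode p (conf p) 2 (single l 1)) (0, {#}) = 0"
      proof (cases "weight p l = 1")
        case False
        have "homog p (2 + weight p l - of_int 2 - 1) (lattice_mode p (conf p) 2 (single l 1))"
          by (rule homog_lattice_mode[OF conf_hom conf_F homog_single])
        thus ?thesis by (rule homog_lookup_0) (use False vac in simp)
      next
        case True
        hence "l = (1, {#})" using small[OF l(1)] l(2) by blast
        hence "lattice_mode p (conf p) 2 (single l 1) \<in> fock_space {1}"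
          by (intro lattice_mode_closed[of _ "{0}" _ "{1}"])
             (auto simp: conf_def intro!: fock_space_add fock_space_scale fock_space_single)
        thus ?thesis by (rule fock_space_lookup_0) simp
      qed
    qed
    thus False using 1 k by simp
  next
    case 2
    have "(1, {#}) \<notin> keys w"
    proof (rule isolated_key[where f = "lattice_mode p (exp_vec (- 1)) (2 * int p - 1)" and k = "(0, {#})"])
      show "clin (lattice_mode p (exp_vec (- 1)) (2 * int p - 1))" by (rule field_clin[OF field_lattice[OF exp_F]])
      show "lattice_mode p (exp_vec (- 1)) (2 * int p - 1) w = 0"
        by (rule low[OF exp_homogeneous]) simp
      show "lookup (lattice_mode p (exp_vec (- 1)) (2 * int p - 1) (single (1, {#}) 1)) (0, {#}) \<noteq> 0"
      proof -
        \<comment> \<open>Y(e^{-\<alpha>}, z) e^{\<alpha>} begins with z^{-2p} times the vacuum, and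
          z^{-2p} belongs to the mode 2p - 1.\<close>
        have "2 * of_nat p * (- 1) * 1 = (of_int (- 2 * int p) :: rat)" by simp
        from exp_mode_base[OF base_vector_exp_vec this, of "2 * int p - 1"]
        have "exp_mode p (- 1) (2 * int p - 1) (exp_vec 1) = exp_vec (- 1) * exp_vec 1"
          by (simp add: exp_neg_0)
        also have "\<dots> = exp_vec 0" by (simp add: exp_vec_def mult_single plus_prod_def)
        finally have "lattice_mode p (exp_vec (- 1)) (2 * int p - 1) (exp_vec 1) = exp_vec 0"
          by (simp only: lattice_mode_exp_vec)
        thus ?thesis by (simp add: exp_vec_def)
      qed
      fix l assume l: "l \<in> keys w" "l \<noteq> (1, {#})"
      show "lookup (lattice_mode p (exp_vec (- 1)) (2 * int p - 1) (single l 1)) (0, {#}) = 0"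
      proof (cases "weight p l = 1")
        case False
        have "homog p (of_int (2 * int p - 1) + weight p l - of_int (2 * int p - 1) - 1)
            (lattice_mode p (exp_vec (- 1)) (2 * int p - 1) (single l 1))"
          by (rule homog_lattice_mode[OF exp_hom exp_F homog_single])
        thus ?thesis by (rule homog_lookup_0) (use False vac in simp)
      next
        case True
        hence "l = (0, {#1#})" using small[OF l(1)] l(2) by blast
        hence "lattice_mode p (exp_vec (- 1)) (2 * int p - 1) (single l 1) \<in> fock_space {- 1}"
          by (intro lattice_mode_closed[of _ "{- 1}" _ "{0}"]) (auto simp: exp_vec_def intro!: fock_space_single)
        thus ?thesis by (rule fock_space_lookup_0) simp
      qed
    qed
    thus False using 2 k by simp
  qed
qed

section \<open>Weight components of vectors\<close>

definition weight_part :: "nat \<Rightarrow> rat \<Rightarrow> fock \<Rightarrow> fock" where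
  "weight_part p h = lin_ext (\<lambda>k. if weight p k = h then single k 1 else 0)"

lemma clin_weight_part: "clin (weight_part p h)"
  unfolding weight_part_def by simp

lemma lookup_weight_part:
  "lookup (weight_part p h x) k = (if weight p k = h then lookup x k else 0)"
proof -
  have "lookup (weight_part p h x) k =
     (\<Sum>l\<in>keys x. if l = k then (if weight p k = h then lookup x k else 0) else 0)"
    unfolding weight_part_def lin_ext_def lookup_sum
    by (intro sum.cong refl) (simp add: lookup_single when_def)
  thus ?thesis by (auto simp: sum.delta in_keys_iff)
qed

lemma homog_weight_part: "homog p h (weight_part p h x)"
  by (auto simp: homog_def in_keys_iff lookup_weight_part split: if_splits)

lemma sum_weight_part: "x = (\<Sum>h\<in>weight p ` keys x. weight_part p h x)"
  by (rule poly_mapping_eqI) (auto simp: lookup_sum lookup_weight_part sum.delta' in_keys_iff image_iff)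

lemma weight_part_homog: "homog p g x \<Longrightarrow> weight_part p h x = (if g = h then x else 0)"
  by (rule poly_mapping_eqI) (auto simp: lookup_weight_part homog_def in_keys_iff)

text \<open>Q preserves weights, so its kernel is graded. This reduces arbitrary v to homogeneous
  ones, the only v that \<open>lowest_vectors\<close> constrains.\<close>

lemma weight_part_triplet:
  assumes p: "p > 0" and v: "v \<in> carrier (triplet p)"
  shows "weight_part p h v \<in> carrier (triplet p)"
proof -
  have "screening p (weight_part p h v) = weight_part p h (screening p v)"
  proof (rule clin_eq_on_keys[OF clin_comp[OF clin_screening clin_weight_part] clin_comp[OF clin_weight_part clin_screening]])
    fix k
    show "screening p (weight_part p h (single k 1)) = weight_part p h (screening p (single k 1))"
      unfolding weight_part_homog[OF homog_single] weight_part_homog[OF homog_screening[OF p homog_single]]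
      by (simp add: clin_0[OF clin_screening])
  qed
  moreover have "weight_part p h v \<in> fock_space \<int>"
    using v by (auto simp: triplet_simps fock_space_iff in_keys_iff lookup_weight_part split: if_splits)
  ultimately show ?thesis
    using v by (simp add: triplet_simps clin_0[OF clin_weight_part])
qed

text \<open>Modes that lower the weight kill w. The others send the vacuum component of w into ker Q
  and every other component, of weight at least 2, to weight at least 2, where Q has no
  e^{-\<alpha>/p} part.\<close>

lemma lowest_vectors_screened:
  assumes p: "p \<ge> 2"
  shows "lowest_vectors (triplet p) (lattice_module p) \<subseteq> screened p"
proof
  fix w assume w: "w \<in> lowest_vectors (triplet p) (lattice_module p)"
  have p0: "p > 0" using p by simp
  have wF: "w \<in> fock_space \<int>"
    and low: "\<And>h v n. homogeneous (triplet p) h v \<Longrightarrow> h - n - 1 < 0 \<Longrightarrow> lattice_mode p v n w = 0"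
    using w by (auto simp: lowest_vectors_def lattice_module_def)
  have hom: "screen_part p (lattice_mode p v n w) = 0"
    if v: "v \<in> carrier (triplet p)" "homog p (of_int h) v" for v n h
  proof (cases "h - n - 1 < 0")
    case True
    thus ?thesis using low[of h v n] v by (simp add: homogeneous_iff[OF p0] clin_0[OF clin_screen_part])
  next
    case False
    have vF: "v \<in> fock_space \<int>" using v by (simp add: triplet_simps)
    have lin: "clin (\<lambda>x. screen_part p (lattice_mode p v n x))"
      by (rule clin_comp[OF clin_screen_part field_clin[OF field_lattice[OF vF]]])
    \<comment> \<open>By linearity each key of w is treated alone; lowering modes were dealt with
      for w as a whole, so no component has to be a lowest vector.\<close>
    have "screen_part p (lattice_mode p v n w) = (\<lambda>x. 0) w"
    proof (rule clin_eq_on_keys[OF lin clin_zero])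
      fix k assume k: "k \<in> keys w"
      have kF: "fst k \<in> \<int>" "0 \<notin># snd k" using wF k by (auto simp: fock_space_iff)
      show "screen_part p (lattice_mode p v n (single k 1)) = 0"
      proof (cases "k = (0, {#})")
        case True
        have "lattice_mode p v n (exp_vec 0) \<in> carrier (triplet p)"
          by (rule triplet_closed[OF p0 v(1) vacuum_triplet])
        thus ?thesis
          unfolding True exp_vec_def[symmetric] screen_part_def by (simp add: triplet_simps clin_0[OF clin_key_part])
      next
        case nvac: False
        have "weight p k \<ge> 2"
        proof (rule ccontr)
          assume "\<not> weight p k \<ge> 2"
          hence "k = (0, {#1#}) \<or> k = (1, {#})" using weight_less_2[OF p kF] nvac by auto
          hence "weight p k = 1" by (auto simp: weight_def)
          thus False using lowest_vector_weight_1[OF p w k] by simp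
        qed
        moreover have "(of_int h :: rat) - of_int n - 1 \<ge> 0"
        proof -
          have "(of_int (h - n - 1) :: rat) \<ge> 0" using False by (simp only: of_int_0_le_iff)
          thus ?thesis by simp
        qed
        ultimately have "of_int h + weight p k - of_int n - 1 \<noteq> 1" by linarith
        thus ?thesis
          by (rule homog_screen_part[OF p0 homog_lattice_mode[OF v(2) vF homog_single]])
      qed
    qed
    thus ?thesis by simp
  qed
  have "screen_part p (lattice_mode p v n w) = 0" if v: "v \<in> carrier (triplet p)" for v n
  proof -
    have lin: "clin (\<lambda>v. screen_part p (lattice_mode p v n w))"
      by (rule clin_comp[OF clin_screen_part clin_lattice_mode_left])
    have "screen_part p (lattice_mode p v n w) =
       (\<Sum>h\<in>weight p ` keys v. screen_part p (lattice_mode p (weight_part p h v) n w))"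
      by (subst sum_weight_part[of v p]) (rule clin_sum[OF lin])
    also have "\<dots> = 0"
    proof (rule sum.neutral, rule ballI)
      fix h assume "h \<in> weight p ` keys v"
      hence "h \<in> \<int>" using v by (auto simp: triplet_simps fock_space_iff intro!: weight_integral)
      then obtain a where "h = of_int a" by (auto elim: Ints_cases)
      thus "screen_part p (lattice_mode p (weight_part p h v) n w) = 0"
        using hom[OF weight_part_triplet[OF p0 v], of a h n] homog_weight_part[of p h v] by simp
    qed
    finally show ?thesis .
  qed
  thus "w \<in> screened p" using wF by (simp add: screened_def)
qed

theorem corollary1p13:
  fixes p :: nat
  assumes "p \<ge> 2"
  shows "\<exists>M :: (fock_key, fock_key) voa_module. M \<in> Mod (triplet p) \<and> \<not> lowest_generated (triplet p) M"
proof (intro exI conjI notI)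
  have p: "p > 0" using assms by simp
  show "lattice_module p \<in> Mod (triplet p)" by (rule lattice_module_Mod[OF p])
  assume "lowest_generated (triplet p) (lattice_module p)"
  \<comment> \<open>The generated submodule is an intersection, so any submodule containing the
    lowest vectors bounds it from above.\<close>
  hence "mcarrier (lattice_module p) \<subseteq> screened p"
    using submodule_screened[OF p] lowest_vectors_screened[OF assms]
    unfolding lowest_generated_def generated_def by blast
  moreover have "single (0, {#1#}) 1 \<in> mcarrier (lattice_module p)"
    by (simp add: lattice_module_def fock_space_single)
  ultimately show False using alpha_not_screened[OF p] by blast
qed

end
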